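(* Let $m>0$, let $n\ge1$ be an integer, let $\Omega\subseteq\mathbb{S}^2$ be a domain (possibly $\Omega=\mathbb{S}^2$), and let $\{u_j\}_{j=1}^n\subset\mathbf{H}^1_0(\Omega)$ be a family of vector functions with $\operatorname{div}u_j=0$ that is orthonormal in the sense that $$m^2(u_i,u_j)+(\operatorname{rot}u_i,\operatorname{rot}u_j)=\delta_{ij},\qquad 1\le i,j\le n.$$ Then for every $1\le p<\infty$ the function $\rho(x):=\sum_{j=1}^n|u_j(x)|^2$ satisfies $$\|\rho\|_{L^p}\le \mathrm{B}_p\,m^{-2/p}\,n^{1/p},\qquad\text{where}\qquad \mathrm{B}_p\le\left(\frac{p-1}{4\pi}\right)^{(p-1)/p};$$ that is, the inequality $\|\rho\|_{L^p(\Omega)}\le\left(\frac{p-1}{4\pi}\right)^{(p-1)/p}m^{-2/p}n^{1/p}$ holds, where for $p=1$ the constant $\left(\frac{p-1}{4\pi}\right)^{(p-1)/p}$ is understood as $1$.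
   Context: $\mathbb{S}^2$ is the unit two-dimensional sphere with its standard round metric and the natural (non-normalized) surface measure $d\sigma$, of total mass $4\pi$; $L^p$-norms are with respect to $d\sigma$. Vector functions are real tangent vector fields on $\Omega\subseteq\mathbb{S}^2$, with pointwise length $|u(x)|$ given by the metric, and $(\cdot,\cdot)$ denotes the $L^2(\Omega)$ scalar product of functions or of vector fields. $\mathbf{H}^1_0(\Omega)$ is the Sobolev space of tangent vector fields of class $H^1$ vanishing on $\partial\Omega$ (the closure in $\mathbf{H}^1$ of the smooth vector fields compactly supported in $\Omega$); for $\Omega=\mathbb{S}^2$ it is $\mathbf{H}^1(\mathbb{S}^2)$. The operator $\operatorname{div}$ is the Riemannian divergence, and the scalar $\operatorname{rot}u$ of a vector field $u$ is $\operatorname{rot}u:=\operatorname{div}(u^\perp)$, where in a local orthonormal frame $u^\perp=(u_2,-u_1)$, i.e. $u^\perp$ is the rotation of $u$ by $\pi/2$ clockwise in the tangent plane. *)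

theory Defs
  imports "HOL-Analysis.Analysis"
begin

abbreviation S2 :: "(real^3) set" where
  "S2 \<equiv> sphere 0 1"

definition radial :: "real^3 \<Rightarrow> real^3" where
  "radial x = x /\<^sub>R norm x"

text \<open>
  Surface measure: in polar coordinates \<open>dx = r\<^sup>2 dr d\<sigma>\<close> and
  \<open>\<integral>\<^sub>0\<^sup>1 r\<^sup>2 dr = 1/3\<close>, so \<open>\<sigma>(A)\<close> is three times the volume
  of the cone \<open>{x. 0 < norm x < 1, x / norm x \<in> A}\<close> over \<open>A\<close>.
\<close>

definition surface :: "(real^3) measure" where
  "surface = scale_measure 3
     (distr (restrict_space lborel (ball 0 1 - {0})) (restrict_space borel S2) radial)"

lemma radial_measurable:
  "radial \<in> restrict_space lborel (ball 0 1 - {0}) \<rightarrow>\<^sub>M restrict_space borel S2"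
proof (rule measurable_restrict_space2)
  show "radial \<in> space (restrict_space lborel (ball 0 1 - {0})) \<rightarrow> S2"
    by (auto simp: space_restrict_space radial_def)
  have "radial \<in> borel_measurable borel"
    unfolding radial_def by measurable
  then show "radial \<in> borel_measurable (restrict_space lborel (ball 0 1 - {0}))"
    by (intro measurable_restrict_space1) simp
qed

lemma space_surface: "space surface = S2"
  by (simp add: surface_def space_scale_measure space_restrict_space)

lemma sets_surface: "sets surface = sets (restrict_space borel S2)"
  by (simp add: surface_def)

lemma emeasure_surface_total: "emeasure surface S2 = ennreal (4 * pi)"
proof -
  let ?R = "restrict_space lborel (ball (0::real^3) 1 - {0})"
  have S: "S2 \<in> sets (restrict_space borel S2)"
    by (simp add: sets_restrict_space_iff)
  have "radial -` S2 \<inter> space ?R = ball 0 1 - {0}"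
    by (auto simp: space_restrict_space radial_def)
  then have "emeasure surface S2 = 3 * emeasure ?R (ball 0 1 - {0})"
    by (simp add: surface_def emeasure_distr[OF radial_measurable S])
  also have "emeasure ?R (ball 0 1 - {0}) = emeasure lborel (ball (0::real^3) 1 - {0})"
    by (subst emeasure_restrict_space) auto
  also have "\<dots> = emeasure lborel (ball (0::real^3) 1)"
    by (rule emeasure_Diff_null_set) auto
  also have "\<dots> = ennreal (4 / 3 * pi)"
    by (simp add: emeasure_ball eval_unit_ball_vol)
  also have "3 * ennreal (4 / 3 * pi) = ennreal (4 * pi)"
    by (simp flip: ennreal_numeral ennreal_mult)
  finally show ?thesis .
qed

text \<open>
  Scalar functions, vector fields and \<open>(1,1)\<close>-tensor fields on the sphere are functions on the
  ambient space of which only the values on \<open>S2\<close> matter.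
\<close>

definition L2 :: "(real^3) set \<Rightarrow> (real^3 \<Rightarrow> 'b::euclidean_space) \<Rightarrow> bool" where
  "L2 \<Omega> f \<longleftrightarrow> set_borel_measurable surface \<Omega> f \<and>
              set_integrable surface \<Omega> (\<lambda>x. (norm (f x))\<^sup>2)"

definition L2_inner ::
    "(real^3) set \<Rightarrow> (real^3 \<Rightarrow> 'b::euclidean_space) \<Rightarrow> (real^3 \<Rightarrow> 'b) \<Rightarrow> real" where
  "L2_inner \<Omega> f g = (LINT x:\<Omega>|surface. f x \<bullet> g x)"

definition Lp :: "(real^3) set \<Rightarrow> real \<Rightarrow> (real^3 \<Rightarrow> real) \<Rightarrow> bool" where
  "Lp \<Omega> p f \<longleftrightarrow> set_borel_measurable surface \<Omega> f \<and>
                set_integrable surface \<Omega> (\<lambda>x. \<bar>f x\<bar> powr p)"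

definition Lp_norm :: "(real^3) set \<Rightarrow> real \<Rightarrow> (real^3 \<Rightarrow> real) \<Rightarrow> real" where
  "Lp_norm \<Omega> p f = (LINT x:\<Omega>|surface. \<bar>f x\<bar> powr p) powr (1 / p)"

definition sphere_domain :: "(real^3) set \<Rightarrow> bool" where
  "sphere_domain \<Omega> \<longleftrightarrow> openin (top_of_set S2) \<Omega> \<and> connected \<Omega> \<and> \<Omega> \<noteq> {}"

text \<open>Intended for open \<open>S\<close> only.\<close>

primrec Ck_on :: "nat \<Rightarrow> 'a::real_normed_vector set \<Rightarrow> ('a \<Rightarrow> 'b::real_normed_vector) \<Rightarrow> bool" where
  "Ck_on 0 S f \<longleftrightarrow> continuous_on S f"
| "Ck_on (Suc k) S f \<longleftrightarrow>
     f differentiable_on S \<and> (\<forall>v. Ck_on k S (\<lambda>x. frechet_derivative f (at x) v))"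

text \<open>
  Smoothness and derivatives on the sphere are expressed through the extension of a function to
  \<open>UNIV - {0}\<close> that is constant along rays.
\<close>

definition smooth_on_S2 :: "(real^3 \<Rightarrow> 'b::real_normed_vector) \<Rightarrow> bool" where
  "smooth_on_S2 f \<longleftrightarrow> (\<forall>k. Ck_on k (UNIV - {0}) (f \<circ> radial))"

definition test_field :: "(real^3) set \<Rightarrow> (real^3 \<Rightarrow> real^3) \<Rightarrow> bool" where
  "test_field \<Omega> X \<longleftrightarrow> smooth_on_S2 X \<and> (\<forall>x\<in>S2. X x \<bullet> x = 0) \<and>
     (\<exists>K. compact K \<and> K \<subseteq> \<Omega> \<and> (\<forall>x\<in>S2 - K. X x = 0))"

definition tan_proj :: "real^3 \<Rightarrow> real^3 \<Rightarrow> real^3" where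
  "tan_proj x v = v - (v \<bullet> x) *\<^sub>R x"

text \<open>
  The Levi-Civita derivative of a smooth tangent field \<open>X\<close> at \<open>x\<close> is the tangential part of the
  ambient derivative. It is an endomorphism of the tangent plane, written as the \<open>3\<times>3\<close> matrix
  that annihilates the normal \<open>x\<close>: the extension being constant along rays, its derivative in
  direction \<open>x\<close> is \<open>0\<close>. The Euclidean norm on matrices is then the Hilbert-Schmidt norm, and
  \<open>trace\<close> is the trace on the tangent plane.
\<close>

definition cov_deriv :: "(real^3 \<Rightarrow> real^3) \<Rightarrow> real^3 \<Rightarrow> real^3^3" where
  "cov_deriv X x = matrix (\<lambda>v. tan_proj x (frechet_derivative (X \<circ> radial) (at x) v))"

text \<open>
  Weak covariant derivative. The integral identity is the integrated form of
  \<open>div (\<langle>u,Y\<rangle> X) = \<langle>\<nabla>\<^sub>X u, Y\<rangle> + \<langle>u, \<nabla>\<^sub>X Y\<rangle> + \<langle>u,Y\<rangle> div X\<close>, where \<open>div X = tr (\<nabla> X)\<close>.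
\<close>

definition has_weak_cov_deriv ::
    "(real^3) set \<Rightarrow> (real^3 \<Rightarrow> real^3) \<Rightarrow> (real^3 \<Rightarrow> real^3^3) \<Rightarrow> bool" where
  "has_weak_cov_deriv \<Omega> u D \<longleftrightarrow>
     L2 \<Omega> u \<and> L2 \<Omega> D \<and>
     (AE x in surface. x \<in> \<Omega> \<longrightarrow> u x \<bullet> x = 0 \<and> D x *v x = 0 \<and> (\<forall>v. (D x *v v) \<bullet> x = 0)) \<and>
     (\<forall>X Y. test_field \<Omega> X \<longrightarrow> test_field \<Omega> Y \<longrightarrow>
        (LINT x:\<Omega>|surface. (D x *v X x) \<bullet> Y x) =
        - (LINT x:\<Omega>|surface. u x \<bullet> (cov_deriv Y x *v X x) + (u x \<bullet> Y x) * trace (cov_deriv X x)))"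

definition H1 :: "(real^3) set \<Rightarrow> (real^3 \<Rightarrow> real^3) set" where
  "H1 \<Omega> = {u. \<exists>D. has_weak_cov_deriv \<Omega> u D}"

text \<open>Unique up to null sets for \<open>u \<in> H1 \<Omega>\<close>, unspecified otherwise.\<close>

definition weak_cov_deriv :: "(real^3) set \<Rightarrow> (real^3 \<Rightarrow> real^3) \<Rightarrow> real^3 \<Rightarrow> real^3^3" where
  "weak_cov_deriv \<Omega> u = (SOME D. has_weak_cov_deriv \<Omega> u D)"

text \<open>For smooth \<open>X\<close> the weak covariant derivative agrees with \<open>cov_deriv X\<close> almost everywhere.\<close>

definition H10 :: "(real^3) set \<Rightarrow> (real^3 \<Rightarrow> real^3) set" where
  "H10 \<Omega> = {u \<in> H1 \<Omega>. \<exists>X. (\<forall>k::nat. test_field \<Omega> (X k)) \<and>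
     (\<lambda>k. LINT x:\<Omega>|surface. (norm (u x - X k x))\<^sup>2 +
            (norm (weak_cov_deriv \<Omega> u x - cov_deriv (X k) x))\<^sup>2) \<longlonglongrightarrow> 0}"

definition weak_div :: "(real^3) set \<Rightarrow> (real^3 \<Rightarrow> real^3) \<Rightarrow> real^3 \<Rightarrow> real" where
  "weak_div \<Omega> u x = trace (weak_cov_deriv \<Omega> u x)"

text \<open>
  Clockwise rotation by \<open>\<pi>/2\<close>, the sphere being oriented by its outer normal: if
  \<open>e\<^sub>1 \<times> e\<^sub>2 = x\<close> then \<open>e\<^sub>1 \<times> x = - e\<^sub>2\<close> and \<open>e\<^sub>2 \<times> x = e\<^sub>1\<close>.
\<close>

definition perp :: "(real^3 \<Rightarrow> real^3) \<Rightarrow> real^3 \<Rightarrow> real^3" where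
  "perp u x = cross3 (u x) x"

definition weak_rot :: "(real^3) set \<Rightarrow> (real^3 \<Rightarrow> real^3) \<Rightarrow> real^3 \<Rightarrow> real" where
  "weak_rot \<Omega> u = weak_div \<Omega> (perp u)"

end

theory Submission
  imports Defs "HOL-Complex_Analysis.Conformal_Mappings"
begin

text \<open>
  Let \<open>L\<^sub>a\<close> be the derivative along the rotation about the \<open>a\<close>-th axis, so that \<open>L\<^sup>2 = \<Sum> L\<^sub>a\<^sup>2\<close> is the Laplacian of
  the sphere, and let \<open>U\<close> be one of the fields, extended by zero, with \<open>W = rot U\<close>. Since \<open>U\<close> is tangent and divergence
  free, \<open>L\<^sup>2 U\<^sub>a = L\<^sub>a W\<close> holds weakly for each Cartesian component. Hence the part of \<open>U\<close> of degree \<open>d\<close> is a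
  combination of the orthonormal fields \<open>e = LY / \<surd>\<lambda>\<close>, where \<open>\<lambda> = d(d+1)\<close> and \<open>Y\<close> runs through an orthonormal basis of
  the at most \<open>2d+1\<close> spherical harmonics of degree \<open>d\<close>. For every \<open>x\<close> one has \<open>\<Sum> \<bar>e(x)\<bar>\<^sup>2 \<le> (2d+1)/4\<pi>\<close>.

  By duality it suffices to show
  \<open>\<Sum>\<^sub>j \<integral> V \<bar>u\<^sub>j\<bar>\<^sup>2 \<le> n\<^bsup>1 - 1/q\<^esup> (\<integral> V\<^sup>q \<Sum>\<^sub>k r\<^sub>k\<^bsup>2q\<^esup> \<bar>e\<^sub>k\<bar>\<^sup>2)\<^bsup>1/q\<^esup>\<close> for \<open>V \<ge> 0\<close>, where \<open>r\<^sub>k = (m\<^sup>2 + \<lambda>\<^sub>k)\<^bsup>-1/2\<^esup>\<close>. This is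
  Lieb's argument, but instead of a trace inequality the three lines theorem is applied to
  \<open>F(z) = \<Sum>\<^sub>j \<integral> V\<^bsup>qz\<^esup> (\<Sum>\<^sub>k c\<^sub>j\<^sub>k r\<^sub>k\<^bsup>qz\<^esup> e\<^sub>k)\<^sup>2\<close>, where \<open>u\<^sub>j = \<Sum>\<^sub>k c\<^sub>j\<^sub>k r\<^sub>k e\<^sub>k\<close>. Orthonormality of the family says that
  the rows of \<open>c\<close> have Gram matrix at most \<open>1\<close>, which bounds \<open>F\<close> by \<open>n\<close> for \<open>Re z = 0\<close> and, through Bessel's
  inequality at each point, by the integral on the right for \<open>Re z = 1\<close>. The constant comes from
  \<open>\<Sum>\<^sub>d (2d+1) (m\<^sup>2 + d(d+1))\<^bsup>-q\<^esup>\<close>, which convexity compares with an integral.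
\<close>

section \<open>The three lines theorem and the eigenvalue sum\<close>

text \<open>The square in \<open>F\<close> is bilinear, not Hermitian: this keeps \<open>F\<close>
  holomorphic, costs nothing in the bounds because the square of P + iQ has modulus at most |P|^2 +
  |Q|^2, and at z = 1/q all coefficients are real, so that it is the squared norm again.
  Interpolation is applied to finitely many modes; the limit is taken afterwards.

  With q = p/(p-1) one has q - 1 = 1/(p-1), so the bound B = m^(-2(q-1)) / (4 pi (q-1)) for the
  weighted sum at a point gives B^(1/q) = ((p-1)/(4 pi))^((p-1)/p) m^(-2/p). The sum over degrees
  starts at 1 because the components of a solenoidal field have mean zero; for small m the convexity
  comparison would fail at degree 0.

  The obstacle is that \<open>weak_rot\<close> rests on a chosen weak derivative seen only by test
  fields inside \<open>\<Omega>\<close>, whereas the spectral expansion uses identities on the whole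
  sphere. Membership in \<open>H10\<close> supplies these: test fields are smooth on the whole
  sphere after extension by zero, so integration by parts against polynomials has no boundary term,
  and it survives the limit.\<close>

lemma Hadamard_three_lines:
  fixes f :: "complex \<Rightarrow> complex"
  assumes hol: "f holomorphic_on UNIV"
    and bdd: "\<And>z. 0 \<le> Re z \<Longrightarrow> Re z \<le> 1 \<Longrightarrow> norm (f z) \<le> C"
    and A: "\<And>z. Re z = 0 \<Longrightarrow> norm (f z) \<le> A" and B: "\<And>z. Re z = 1 \<Longrightarrow> norm (f z) \<le> B"
    and pos: "A > 0" "B > 0" and \<theta>: "0 \<le> \<theta>" "\<theta> \<le> 1"
  shows "norm (f (of_real \<theta>)) \<le> A powr (1 - \<theta>) * B powr \<theta>"
proof -
  have "norm (f 0) \<le> C" using bdd[of 0] by simp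
  hence C0: "C \<ge> 0" using norm_ge_zero[of "f 0"] by linarith
  \<comment> \<open>The exponential contains A^(z-1) B^(-z), which normalises both boundary lines to
    modulus 1, and exp (e (z^2 - 1)), whose modulus is at most 1 in the strip and decays as
    \<open>Im z\<close> grows.\<close>
  define h where "h e z = f z * exp ((z - 1) * of_real (ln A) - z * of_real (ln B) + of_real e * (z\<^sup>2 - 1))" for e z
  have norm_h: "norm (h e z) = norm (f z) * exp ((Re z - 1) * ln A - Re z * ln B + e * ((Re z)\<^sup>2 - (Im z)\<^sup>2 - 1))" for e z
    by (simp add: h_def norm_mult power2_eq_square)
  have est: "norm (h e (of_real \<theta>)) \<le> 1" if e: "e > 0" for e :: real
  proof -
    define C' where "C' = C * exp (\<bar>ln A\<bar> + \<bar>ln B\<bar>)"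
    \<comment> \<open>The rectangle must be so tall that the Gaussian factor beats the crude bound
      \<open>C'\<close> on its horizontal sides. The height \<open>max 1 (C' / e)\<close> suffices,
      since exp t exceeds t.\<close>
    have "C' \<le> exp (e * (max 1 (C' / e))\<^sup>2)"
    proof -
      have "C' / e \<le> 1 * max 1 (C' / e)" by simp
      also have "\<dots> \<le> (max 1 (C' / e)) * (max 1 (C' / e))"
        by (intro mult_right_mono) auto
      finally have "C' / e \<le> (max 1 (C' / e)) * (max 1 (C' / e))" .
      hence "C' \<le> e * (max 1 (C' / e))\<^sup>2"
        using e by (simp add: power2_eq_square field_simps)
      also have "\<dots> \<le> exp (e * (max 1 (C' / e))\<^sup>2)"
        using exp_ge_add_one_self[of "e * (max 1 (C' / e))\<^sup>2"] by linarith
      finally show ?thesis .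
    qed
    then obtain R where R: "R \<ge> 1" "C' \<le> exp (e * R\<^sup>2)" using max.cobounded1 by blast
    define S where "S = cbox (Complex 0 (-R)) (Complex 1 R)"
    show ?thesis
    proof (rule maximum_modulus_frontier[where S = S and f = "h e"])
      have hol_h: "h e holomorphic_on UNIV"
        unfolding h_def using hol by (auto intro!: holomorphic_intros)
      show "h e holomorphic_on interior S" using hol_h holomorphic_on_subset by blast
      show "continuous_on (closure S) (h e)"
        using hol_h holomorphic_on_imp_continuous_on continuous_on_subset by blast
      show "bounded S" by (simp add: S_def)
      show "complex_of_real \<theta> \<in> S" using \<theta> R by (auto simp: S_def in_cbox_complex_iff)
    next
      fix z assume z: "z \<in> frontier S"
      hence zS: "z \<in> S" "z \<notin> interior S"
        by (auto simp: S_def frontier_def)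
      have re: "0 \<le> Re z" "Re z \<le> 1" "-R \<le> Im z" "Im z \<le> R"
        using zS by (auto simp: S_def in_cbox_complex_iff)
      have "z \<notin> box (Complex 0 (-R)) (Complex 1 R)"
        using zS by (simp add: S_def interior_cbox)
      hence "Re z = 0 \<or> Re z = 1 \<or> \<bar>Im z\<bar> = R"
        using re by (auto simp: in_box_complex_iff)
      moreover have sq1: "(Re z)\<^sup>2 \<le> 1"
        using re by (simp add: power_le_one)
      moreover
      { assume r0: "Re z = 0"
        have "- 1 \<le> (Im z)\<^sup>2" by (rule order_trans[of _ 0]) auto
        note im1 = this
        have "norm (h e z) \<le> A * exp (- ln A + e * (- (Im z)\<^sup>2 - 1))"
          using A[OF r0] unfolding norm_h r0 by (auto intro!: mult_right_mono)
        also have "\<dots> \<le> A * exp (- ln A)"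
          using pos e im1 by (auto intro!: mult_left_mono mult_nonneg_nonpos)
        also have "\<dots> = 1" using pos by (simp add: exp_minus)
        finally have "norm (h e z) \<le> 1" . }
      moreover
      { assume r1: "Re z = 1"
        have "norm (h e z) \<le> B * exp (- ln B + e * (- (Im z)\<^sup>2))"
          using B[OF r1] unfolding norm_h r1 by (auto intro!: mult_right_mono)
        also have "\<dots> \<le> B * exp (- ln B)"
          using pos e by (auto intro!: mult_left_mono mult_nonneg_nonpos)
        also have "\<dots> = 1" using pos by (simp add: exp_minus)
        finally have "norm (h e z) \<le> 1" . }
      moreover
      { assume im: "\<bar>Im z\<bar> = R"
        have i2: "(Im z)\<^sup>2 = R\<^sup>2" using im by (metis power2_abs)
        have a1: "(Re z - 1) * ln A \<le> \<bar>ln A\<bar>"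
        proof -
          have "(Re z - 1) * ln A \<le> \<bar>Re z - 1\<bar> * \<bar>ln A\<bar>" by (metis abs_ge_self abs_mult)
          also have "\<dots> \<le> 1 * \<bar>ln A\<bar>" using re by (intro mult_right_mono) auto
          finally show ?thesis by simp
        qed
        have a2: "- (Re z * ln B) \<le> \<bar>ln B\<bar>"
        proof -
          have "- (Re z * ln B) \<le> \<bar>Re z\<bar> * \<bar>ln B\<bar>" by (metis abs_ge_minus_self abs_mult)
          also have "\<dots> \<le> 1 * \<bar>ln B\<bar>" using re by (intro mult_right_mono) auto
          finally show ?thesis by simp
        qed
        have a3: "e * ((Re z)\<^sup>2 - (Im z)\<^sup>2 - 1) \<le> - (e * R\<^sup>2)"
        proof -
          have "e * ((Re z)\<^sup>2 - (Im z)\<^sup>2 - 1) \<le> e * (- R\<^sup>2)"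
            using sq1 i2 e by (intro mult_left_mono) auto
          thus ?thesis by simp
        qed
        have "norm (h e z) \<le> C * exp (\<bar>ln A\<bar> + \<bar>ln B\<bar> - e * R\<^sup>2)"
          unfolding norm_h using bdd[OF re(1,2)] C0 a1 a2 a3 by (intro mult_mono) auto
        also have "\<dots> = C' / exp (e * R\<^sup>2)" by (simp add: C'_def exp_diff exp_add)
        also have "\<dots> \<le> 1" using R by (simp add: field_simps)
        finally have "norm (h e z) \<le> 1" . }
      ultimately show "norm (h e z) \<le> 1" by blast
    qed
  qed
  have lim: "((\<lambda>e. norm (h e (of_real \<theta>))) \<longlongrightarrow> norm (h 0 (of_real \<theta>))) (at_right 0)"
    unfolding h_def by (intro tendsto_intros)
  have "norm (h 0 (of_real \<theta>)) \<le> 1"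
    by (rule tendsto_upperbound[OF lim]) (auto simp: eventually_at_right_less est intro!: eventually_at_rightI[of 0 1])
  hence "norm (f (of_real \<theta>)) * exp ((\<theta> - 1) * ln A - \<theta> * ln B) \<le> 1"
    by (simp add: norm_h)
  hence "norm (f (of_real \<theta>)) \<le> exp (- ((\<theta> - 1) * ln A - \<theta> * ln B))"
    unfolding exp_minus by (simp add: field_simps)
  also have "\<dots> = A powr (1 - \<theta>) * B powr \<theta>"
    using pos by (simp add: powr_def exp_add[symmetric] algebra_simps)
  finally show ?thesis .
qed

text \<open>Midpoint (Hermite-Hadamard) inequality for the convex function t^(-q) on [c - s, c + s],
  whose integral is the right side. The difference of the two sides vanishes at s = 0, and its
  derivative in s is nonnegative by midpoint convexity.\<close>

lemma powr_convex_midpoint_integral: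
  fixes c q s :: real
  assumes q: "q > 1" and c: "c > 0" and s: "0 \<le> s" "s < c"
  shows "2 * s * c powr (- q) \<le> ((c - s) powr (1 - q) - (c + s) powr (1 - q)) / (q - 1)"
proof -
  define h where "h t = ((c - t) powr (1 - q) - (c + t) powr (1 - q)) / (q - 1) - 2 * t * c powr (- q)" for t
  have "h 0 \<le> h s"
  proof (rule DERIV_nonneg_imp_nondecreasing[of 0 s h])
    show "0 \<le> s" by fact
    fix t assume t: "0 \<le> t" "t \<le> s"
    have d: "(h has_real_derivative ((c - t) powr (- q) + (c + t) powr (- q) - 2 * c powr (- q))) (at t)"
    proof -
      have "((\<lambda>t. (c - t) powr (1 - q)) has_real_derivative ((1 - q) * (c - t) powr (1 - q - 1) * (- 1))) (at t)"
        using t s by (intro DERIV_chain2[OF has_real_derivative_powr]) (auto intro!: derivative_eq_intros)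
      moreover have "((\<lambda>t. (c + t) powr (1 - q)) has_real_derivative ((1 - q) * (c + t) powr (1 - q - 1) * 1)) (at t)"
        using t c by (intro DERIV_chain2[OF has_real_derivative_powr]) (auto intro!: derivative_eq_intros)
      moreover have "t < c" "0 < c + t" using t s c by auto
      ultimately show ?thesis
        unfolding h_def using q by (auto intro!: derivative_eq_intros simp: divide_simps) (auto simp: algebra_simps)
    qed
    have cv: "convex_on {0<..} (\<lambda>x. x powr (- q))"
    proof (rule f''_ge0_imp_convex)
      show "((\<lambda>x. x powr - q) has_real_derivative (- q * x powr (- q - 1))) (at x)" if "x \<in> {0<..}" for x
        using that by (auto intro!: derivative_eq_intros)
      show "((\<lambda>x. - q * x powr (- q - 1)) has_real_derivative (- q * ((- q - 1) * x powr (- q - 2)))) (at x)" if "x \<in> {0<..}" for x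
        using that by (auto intro!: derivative_eq_intros simp: algebra_simps)
      show "0 \<le> - q * ((- q - 1) * x powr (- q - 2))" for x using q by (simp add: zero_le_mult_iff mult_le_0_iff)
    qed simp
    have "((1/2) *\<^sub>R (c - t) + (1/2) *\<^sub>R (c + t)) powr (- q) \<le> (1/2) * (c - t) powr (- q) + (1/2) * (c + t) powr (- q)"
      using convex_onD[OF cv, of "1/2" "c - t" "c + t"] t s c by simp
    hence "c powr (- q) \<le> (1/2) * (c - t) powr (- q) + (1/2) * (c + t) powr (- q)"
      by (simp add: algebra_simps flip: add_divide_distrib)
    with d show "\<exists>y. (h has_real_derivative y) (at t) \<and> 0 \<le> y" by force
  qed
  thus ?thesis by (simp add: h_def)
qed

text \<open>The right side is the integral of t^(-q) from m^2 to infinity. The comparison intervals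
  are adjacent and the first starts at m^2 + 1/2, so the sum telescopes below it.\<close>

lemma sum_eigenvalues_bound:
  fixes m q :: real
  assumes m: "m > 0" and q: "q > 1"
  shows "(\<Sum>l=1..N. (2 * real l + 1) * (m\<^sup>2 + real l * (real l + 1)) powr (- q)) \<le> m powr (- 2 * (q - 1)) / (q - 1)"
proof -
  define \<Phi> where "\<Phi> l = (m\<^sup>2 + (real l)\<^sup>2 - 1/2) powr (1 - q) / (q - 1)" for l :: nat
  have m2: "m\<^sup>2 > 0" using m by simp
  \<comment> \<open>\<open>l(l+1)\<close> is the midpoint of the interval from \<open>l\<^sup>2 - 1/2\<close> to \<open>(l+1)\<^sup>2 - 1/2\<close>, of length \<open>2l+1\<close>\<close>
  have "(\<Sum>l=1..N. (2 * real l + 1) * (m\<^sup>2 + real l * (real l + 1)) powr (- q)) \<le> (\<Sum>l=1..N. \<Phi> l - \<Phi> (Suc l))"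
  proof (rule sum_mono)
    fix l assume l: "l \<in> {1..N}"
    have l1: "real l \<ge> 1" using l by auto
    have ll: "real l * real l \<ge> 1 * 1" using l1 by (intro mult_mono) auto
    \<comment> \<open>The interval around the midpoint must stay positive, that is m^2 + l^2 > 1/2.
      For every m > 0 this holds because l is at least 1.\<close>
    have pp: "0 < m\<^sup>2 + real l * (real l + 1)" "0 \<le> real l + 1/2" "real l + 1/2 < m\<^sup>2 + real l * (real l + 1)"
      unfolding distrib_left using m2 l1 ll by linarith+
    have "2 * (real l + 1/2) * (m\<^sup>2 + real l * (real l + 1)) powr (- q) \<le>
      ((m\<^sup>2 + real l * (real l + 1) - (real l + 1/2)) powr (1 - q) - (m\<^sup>2 + real l * (real l + 1) + (real l + 1/2)) powr (1 - q)) / (q - 1)"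
      using q pp by (intro powr_convex_midpoint_integral) auto
    moreover have "m\<^sup>2 + real l * (real l + 1) - (real l + 1/2) = m\<^sup>2 + (real l)\<^sup>2 - 1/2"
      "m\<^sup>2 + real l * (real l + 1) + (real l + 1/2) = m\<^sup>2 + (real (Suc l))\<^sup>2 - 1/2"
      "2 * (real l + 1/2) = 2 * real l + 1"
      by (auto simp: power2_eq_square algebra_simps)
    ultimately show "(2 * real l + 1) * (m\<^sup>2 + real l * (real l + 1)) powr (- q) \<le> \<Phi> l - \<Phi> (Suc l)"
      unfolding \<Phi>_def by (simp only: diff_divide_distrib)
  qed
  also have "\<dots> = \<Phi> 1 - \<Phi> (Suc N)"
    using sum_Suc_diff[of 1 N \<Phi>] by (simp add: sum_subtractf)
  also have "\<dots> \<le> \<Phi> 1" using q by (simp add: \<Phi>_def)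
  also have "\<dots> \<le> (m\<^sup>2) powr (1 - q) / (q - 1)"
    unfolding \<Phi>_def using q m2 by (intro divide_right_mono powr_mono2') auto
  also have "(m\<^sup>2) powr (1 - q) = m powr (- 2 * (q - 1))"
    using m by (simp add: powr_powr[symmetric] powr_def ln_realpow algebra_simps)
  finally show ?thesis .
qed

section \<open>Square integrable functions\<close>

text \<open>Square integrability on the whole space of \<open>M\<close>: fields on
  \<open>\<Omega>\<close> are extended by zero, so that all later integrals run over the entire
  sphere.\<close>

definition sqi :: "'a measure \<Rightarrow> ('a \<Rightarrow> 'b::euclidean_space) \<Rightarrow> bool" where
  "sqi M f \<longleftrightarrow> f \<in> borel_measurable M \<and> integrable M (\<lambda>x. (norm (f x))\<^sup>2)"

lemma sqi_measurable: "sqi M f \<Longrightarrow> f \<in> borel_measurable M"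
  and sqi_integrable: "sqi M f \<Longrightarrow> integrable M (\<lambda>x. (norm (f x))\<^sup>2)"
  by (auto simp: sqi_def)

lemma sqi_inner_integrable:
  assumes "sqi M f" "sqi M g"
  shows "integrable M (\<lambda>x. f x \<bullet> g x)"
proof (rule Bochner_Integration.integrable_bound)
  show "integrable M (\<lambda>x. (norm (f x))\<^sup>2 + (norm (g x))\<^sup>2)"
    using assms by (auto simp: sqi_def)
  show "(\<lambda>x. f x \<bullet> g x) \<in> borel_measurable M"
    using assms by (auto simp: sqi_def intro!: borel_measurable_inner)
  have "\<bar>f x \<bullet> g x\<bar> \<le> (norm (f x))\<^sup>2 + (norm (g x))\<^sup>2" for x
  proof -
    have "\<bar>f x \<bullet> g x\<bar> \<le> norm (f x) * norm (g x)" by (rule Cauchy_Schwarz_ineq2)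
    also have "2 * (norm (f x) * norm (g x)) \<le> (norm (f x))\<^sup>2 + (norm (g x))\<^sup>2"
      using sum_squares_bound[of "norm (f x)" "norm (g x)"] by simp
    moreover have "0 \<le> norm (f x) * norm (g x)" by simp
    ultimately show ?thesis by linarith
  qed
  thus "AE x in M. norm (f x \<bullet> g x) \<le> norm ((norm (f x))\<^sup>2 + (norm (g x))\<^sup>2)"
    by auto
qed

lemma sqi_scaleR: "sqi M f \<Longrightarrow> sqi M (\<lambda>x. c *\<^sub>R f x)"
  by (auto simp: sqi_def power_mult_distrib)

lemma sqi_add:
  assumes "sqi M f" "sqi M g" shows "sqi M (\<lambda>x. f x + g x)"
proof -
  have "integrable M (\<lambda>x. (norm (f x))\<^sup>2 + (norm (g x))\<^sup>2 + 2 * (f x \<bullet> g x))"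
    using assms sqi_inner_integrable[OF assms] by (auto simp: sqi_def)
  thus ?thesis using assms
    by (auto simp: sqi_def power2_norm_eq_inner inner_add_left inner_add_right inner_commute algebra_simps)
qed

lemma sqi_minus: "sqi M f \<Longrightarrow> sqi M (\<lambda>x. - f x)"
  by (auto simp: sqi_def)

lemma sqi_diff: "sqi M f \<Longrightarrow> sqi M g \<Longrightarrow> sqi M (\<lambda>x. f x - g x)"
  using sqi_add[of M f "\<lambda>x. - g x"] by (simp add: sqi_minus)

lemma sqi_zero: "sqi M (\<lambda>x. 0)"
  by (simp add: sqi_def)

lemma sqi_sum: "(\<And>i. i \<in> I \<Longrightarrow> sqi M (f i)) \<Longrightarrow> sqi M (\<lambda>x. \<Sum>i\<in>I. f i x)"
  by (induction I rule: infinite_finite_induct) (auto intro: sqi_zero sqi_add)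

lemma sqi_dominated:
  assumes f: "sqi M f" and g: "g \<in> borel_measurable M" and le: "\<And>x. x \<in> space M \<Longrightarrow> norm (g x) \<le> C * norm (f x)"
  shows "sqi M g" "(LINT x|M. (norm (g x))\<^sup>2) \<le> C\<^sup>2 * (LINT x|M. (norm (f x))\<^sup>2)"
proof -
  have sq: "(norm (g x))\<^sup>2 \<le> C\<^sup>2 * (norm (f x))\<^sup>2" if "x \<in> space M" for x
    using power_mono[OF le[OF that], of 2] by (simp add: power_mult_distrib)
  have m: "(\<lambda>x. (norm (g x))\<^sup>2) \<in> borel_measurable M"
    by (rule measurable_compose[OF g]) measurable
  have i: "integrable M (\<lambda>x. C\<^sup>2 * (norm (f x))\<^sup>2)" using f by (simp add: sqi_def)
  have ig: "integrable M (\<lambda>x. (norm (g x))\<^sup>2)"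
    by (rule Bochner_Integration.integrable_bound[OF i m]) (use sq in \<open>auto intro!: AE_I2\<close>)
  show "sqi M g" using g ig by (simp add: sqi_def)
  show "(LINT x|M. (norm (g x))\<^sup>2) \<le> C\<^sup>2 * (LINT x|M. (norm (f x))\<^sup>2)"
    using integral_mono[OF ig i sq] by simp
qed

lemma sqi_component:
  assumes "sqi M f" shows "sqi M (\<lambda>x. f x \<bullet> b)"
proof (rule sqi_dominated(1)[OF assms, where C = "norm b"])
  show "(\<lambda>x. f x \<bullet> b) \<in> borel_measurable M" using assms by (auto simp: sqi_def)
  show "norm (f x \<bullet> b) \<le> norm b * norm (f x)" for x
    using Cauchy_Schwarz_ineq2[of "f x" b] by (simp add: mult.commute)
qed

lemma sqi_bounded_scale:
  fixes g :: "'a \<Rightarrow> real"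
  assumes f: "sqi M f" and g: "g \<in> borel_measurable M" and B: "\<And>x. x \<in> space M \<Longrightarrow> \<bar>g x\<bar> \<le> B"
  shows "sqi M (\<lambda>x. g x *\<^sub>R f x)"
proof (rule sqi_dominated(1)[OF f, where C = B])
  show "(\<lambda>x. g x *\<^sub>R f x) \<in> borel_measurable M" using f g by (auto simp: sqi_def)
qed (simp add: B mult_right_mono)

lemma sqi_finite_bounded:
  assumes "finite_measure M" "f \<in> borel_measurable M" "\<And>x. x \<in> space M \<Longrightarrow> norm (f x) \<le> B"
  shows "sqi M f"
  unfolding sqi_def
proof
  interpret finite_measure M by fact
  show "integrable M (\<lambda>x. (norm (f x))\<^sup>2)"
    using assms(2,3) by (intro integrable_const_bound[where B = "B\<^sup>2"]) (auto intro!: AE_I2 power_mono)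
qed fact

lemma integral_Cauchy_Schwarz:
  assumes f: "sqi M f" and g: "sqi M g"
  shows "\<bar>LINT x|M. f x \<bullet> g x\<bar> \<le> sqrt (LINT x|M. (norm (f x))\<^sup>2) * sqrt (LINT x|M. (norm (g x))\<^sup>2)"
proof -
  define a b c where "a = (LINT x|M. (norm (f x))\<^sup>2)" and "b = (LINT x|M. f x \<bullet> g x)" and "c = (LINT x|M. (norm (g x))\<^sup>2)"
  have nn: "a \<ge> 0" "c \<ge> 0" by (auto simp: a_def c_def)
  note I = sqi_integrable[OF f] sqi_integrable[OF g] sqi_inner_integrable[OF f g]
  have q: "0 \<le> a * s\<^sup>2 + 2 * s * t * b + c * t\<^sup>2" for s t :: real
  proof -
    have "0 \<le> (LINT x|M. (norm (s *\<^sub>R f x + t *\<^sub>R g x))\<^sup>2)" by simp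
    also have "\<dots> = (LINT x|M. s\<^sup>2 * (norm (f x))\<^sup>2 + (2 * s * t) * (f x \<bullet> g x) + t\<^sup>2 * (norm (g x))\<^sup>2)"
      by (intro Bochner_Integration.integral_cong)
         (auto simp: power2_norm_eq_inner inner_add_left inner_add_right inner_commute algebra_simps power2_eq_square[of s] power2_eq_square[of t])
    also have "\<dots> = a * s\<^sup>2 + 2 * s * t * b + c * t\<^sup>2"
      using I by (simp add: a_def b_def c_def algebra_simps)
    finally show ?thesis .
  qed
  have "b\<^sup>2 \<le> a * c"
  proof (cases "a = 0")
    case True
    have "b = 0"
    proof (rule ccontr)
      assume "b \<noteq> 0"
      \<comment> \<open>With \<open>a = 0\<close> the form at t = 1 is affine in s, so a nonzero
        slope makes it negative somewhere; this s gives the value \<open>- c - 2\<close>.\<close>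
      have "0 \<le> 2 * (- (c + 1) / b) * b + c" using q[of "- (c + 1) / b" 1] True by simp
      also have "\<dots> = - c - 2" using \<open>b \<noteq> 0\<close> by (simp add: field_simps)
      finally show False using nn by simp
    qed
    thus ?thesis using nn True by simp
  next
    case False
    hence "a > 0" using nn by simp
    have "0 \<le> a * (- b)\<^sup>2 + 2 * (- b) * a * b + c * a\<^sup>2" by (rule q)
    also have "\<dots> = a * (a * c - b\<^sup>2)" by (simp add: power2_eq_square algebra_simps)
    finally show ?thesis using \<open>a > 0\<close> by (simp add: zero_le_mult_iff)
  qed
  hence "sqrt (b\<^sup>2) \<le> sqrt (a * c)" by (rule real_sqrt_le_mono)
  thus ?thesis by (simp add: a_def b_def c_def real_sqrt_mult)
qed

lemma sqi_inner_tendsto: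
  assumes f: "sqi M f" and fk: "\<And>k. sqi M (F k)" and g: "sqi M g"
    and lim: "(\<lambda>k. LINT x|M. (norm (f x - F k x))\<^sup>2) \<longlonglongrightarrow> 0"
  shows "(\<lambda>k. LINT x|M. F k x \<bullet> g x) \<longlonglongrightarrow> (LINT x|M. f x \<bullet> g x)"
proof (rule LIM_zero_cancel, rule Lim_null_comparison)
  show "\<forall>\<^sub>F k in sequentially. norm ((LINT x|M. F k x \<bullet> g x) - (LINT x|M. f x \<bullet> g x))
     \<le> sqrt (LINT x|M. (norm (f x - F k x))\<^sup>2) * sqrt (LINT x|M. (norm (g x))\<^sup>2)"
  proof (rule always_eventually, rule allI)
    fix k
    have "(LINT x|M. F k x \<bullet> g x) - (LINT x|M. f x \<bullet> g x) = - (LINT x|M. (f x - F k x) \<bullet> g x)"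
      using sqi_inner_integrable[OF f g] sqi_inner_integrable[OF fk g, of k]
      by (simp add: inner_diff_left)
    thus "norm ((LINT x|M. F k x \<bullet> g x) - (LINT x|M. f x \<bullet> g x))
     \<le> sqrt (LINT x|M. (norm (f x - F k x))\<^sup>2) * sqrt (LINT x|M. (norm (g x))\<^sup>2)"
      using integral_Cauchy_Schwarz[OF sqi_diff[OF f fk] g, of k] by simp
  qed
  have "(\<lambda>k. sqrt (LINT x|M. (norm (f x - F k x))\<^sup>2) * sqrt (LINT x|M. (norm (g x))\<^sup>2)) \<longlonglongrightarrow> sqrt 0 * sqrt (LINT x|M. (norm (g x))\<^sup>2)"
    by (intro tendsto_intros lim)
  thus "(\<lambda>k. sqrt (LINT x|M. (norm (f x - F k x))\<^sup>2) * sqrt (LINT x|M. (norm (g x))\<^sup>2)) \<longlonglongrightarrow> 0" by simp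
qed

section \<open>Complex interpolation\<close>

text \<open>A matrix and its transpose have the same operator norm. Testing the hypothesis with the
  vector t = c y, Cauchy-Schwarz gives S^2 <= S |y|^2, where S = |t|^2.\<close>

lemma Bessel_of_Gram:
  fixes c :: "'j \<Rightarrow> 'k \<Rightarrow> real"
  assumes J: "finite J" and K: "finite K"
    and Gram: "\<And>t. (\<Sum>k\<in>K. (\<Sum>j\<in>J. t j * c j k)\<^sup>2) \<le> (\<Sum>j\<in>J. (t j)\<^sup>2)"
  shows "(\<Sum>j\<in>J. (\<Sum>k\<in>K. c j k * y k)\<^sup>2) \<le> (\<Sum>k\<in>K. (y k)\<^sup>2)"
proof -
  define t where "t j = (\<Sum>k\<in>K. c j k * y k)" for j
  define S where "S = (\<Sum>j\<in>J. (t j)\<^sup>2)"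
  have "S = (\<Sum>j\<in>J. \<Sum>k\<in>K. t j * c j k * y k)"
    by (simp add: S_def power2_eq_square t_def sum_distrib_left mult.assoc)
  also have "\<dots> = (\<Sum>k\<in>K. (\<Sum>j\<in>J. t j * c j k) * y k)"
    by (subst sum.swap) (simp add: sum_distrib_right)
  finally have "S\<^sup>2 = (\<Sum>k\<in>K. (\<Sum>j\<in>J. t j * c j k) * y k)\<^sup>2" by simp
  also have "\<dots> \<le> (\<Sum>k\<in>K. (\<Sum>j\<in>J. t j * c j k)\<^sup>2) * (\<Sum>k\<in>K. (y k)\<^sup>2)"
    by (rule Cauchy_Schwarz_ineq_sum)
  also have "\<dots> \<le> S * (\<Sum>k\<in>K. (y k)\<^sup>2)"
    unfolding S_def by (intro mult_right_mono Gram sum_nonneg) auto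
  finally have *: "S * S \<le> S * (\<Sum>k\<in>K. (y k)\<^sup>2)" by (simp add: power2_eq_square)
  have "S \<ge> 0" by (simp add: S_def sum_nonneg)
  moreover have "(\<Sum>k\<in>K. (y k)\<^sup>2) \<ge> 0" by (simp add: sum_nonneg)
  ultimately have "S \<le> (\<Sum>k\<in>K. (y k)\<^sup>2)"
    using * by (cases "S = 0") auto
  thus ?thesis by (simp add: S_def t_def)
qed

lemma norm_sum_squared_eq:
  fixes f :: "'k \<Rightarrow> 'b::euclidean_space"
  shows "(norm (\<Sum>k\<in>K. a k *\<^sub>R f k))\<^sup>2 = (\<Sum>b\<in>Basis. (\<Sum>k\<in>K. a k * (f k \<bullet> b))\<^sup>2)"
  unfolding power2_norm_eq_inner
  by (subst euclidean_inner) (simp add: inner_sum_left power2_eq_square)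

lemma inner_sum_sum:
  fixes f :: "'k \<Rightarrow> 'b::real_inner"
  shows "(\<Sum>k\<in>K. a k *\<^sub>R f k) \<bullet> (\<Sum>k\<in>K. b k *\<^sub>R f k) = (\<Sum>k\<in>K. \<Sum>l\<in>K. a k * b l * (f k \<bullet> f l))"
  unfolding inner_sum_left by (intro sum.cong refl) (simp add: inner_sum_right sum_distrib_left mult_ac)

text \<open>This is \<open>Bessel_of_Gram\<close> for each Cartesian component at the fixed point
  \<open>x\<close>, with \<open>y k = s k * (e k x \<bullet> b)\<close>.\<close>

lemma Bessel_pointwise:
  fixes c :: "'j \<Rightarrow> 'k \<Rightarrow> real" and e :: "'k \<Rightarrow> 'a \<Rightarrow> 'b::euclidean_space"
  assumes J: "finite J" and K: "finite K"
    and Gram: "\<And>t. (\<Sum>k\<in>K. (\<Sum>j\<in>J. t j * c j k)\<^sup>2) \<le> (\<Sum>j\<in>J. (t j)\<^sup>2)"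
  shows "(\<Sum>j\<in>J. (norm (\<Sum>k\<in>K. (c j k * s k) *\<^sub>R e k x))\<^sup>2) \<le> (\<Sum>k\<in>K. (s k)\<^sup>2 * (norm (e k x))\<^sup>2)"
proof -
  have "(\<Sum>j\<in>J. (norm (\<Sum>k\<in>K. (c j k * s k) *\<^sub>R e k x))\<^sup>2)
    = (\<Sum>b\<in>Basis. \<Sum>j\<in>J. (\<Sum>k\<in>K. c j k * (s k * (e k x \<bullet> b)))\<^sup>2)"
    unfolding norm_sum_squared_eq sum.swap[of _ _ J] by (simp add: mult.assoc)
  also have "\<dots> \<le> (\<Sum>b\<in>Basis. \<Sum>k\<in>K. (s k * (e k x \<bullet> b))\<^sup>2)"
    by (intro sum_mono Bessel_of_Gram[OF J K Gram])
  also have "\<dots> = (\<Sum>k\<in>K. (s k)\<^sup>2 * (norm (e k x))\<^sup>2)"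
  proof (subst sum.swap, intro sum.cong refl)
    fix k
    show "(\<Sum>b\<in>Basis. (s k * (e k x \<bullet> b))\<^sup>2) = (s k)\<^sup>2 * (norm (e k x))\<^sup>2"
      unfolding power2_norm_eq_inner
      by (subst euclidean_inner[of "e k x" "e k x"]) (simp add: power_mult_distrib sum_distrib_left power2_eq_square mult_ac)
  qed
  finally show ?thesis .
qed

lemma orthonormal_norm_sum:
  fixes e :: "'k \<Rightarrow> 'a \<Rightarrow> 'b::euclidean_space"
  assumes K: "finite K" and sq: "\<And>k. k \<in> K \<Longrightarrow> sqi M (e k)"
    and on: "\<And>k l. k \<in> K \<Longrightarrow> l \<in> K \<Longrightarrow> (LINT x|M. e k x \<bullet> e l x) = (if k = l then 1 else 0)"
  shows "(LINT x|M. (norm (\<Sum>k\<in>K. a k *\<^sub>R e k x))\<^sup>2) = (\<Sum>k\<in>K. (a k)\<^sup>2)"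
proof -
  have "(LINT x|M. (norm (\<Sum>k\<in>K. a k *\<^sub>R e k x))\<^sup>2)
      = (LINT x|M. (\<Sum>k\<in>K. \<Sum>l\<in>K. a k * (a l * (e k x \<bullet> e l x))))"
    by (simp add: power2_norm_eq_inner inner_sum_sum mult.assoc)
  also have "\<dots> = (\<Sum>k\<in>K. \<Sum>l\<in>K. a k * (a l * (LINT x|M. e k x \<bullet> e l x)))"
    using sqi_inner_integrable[OF sq sq] by (subst Bochner_Integration.integral_sum) (auto intro!: Bochner_Integration.integrable_sum)
  also have "\<dots> = (\<Sum>k\<in>K. \<Sum>l\<in>K. a k * (a l * (if k = l then 1 else 0)))"
    by (intro sum.cong refl) (simp add: on)
  also have "\<dots> = (\<Sum>k\<in>K. (a k)\<^sup>2)"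
    using K by (simp add: if_distrib power2_eq_square sum.delta' cong: if_cong)
  finally show ?thesis .
qed

text \<open>With P and Q built from the real and imaginary parts of the coefficients, the integrand
  on the left is the bilinear square of P + iQ, namely |P|^2 - |Q|^2 + 2i P.Q. Cauchy-Schwarz bounds
  its modulus by |P|^2 + |Q|^2. No conjugate occurs, so the left sum is holomorphic in the
  coefficients.\<close>

lemma bilinear_complex_bound:
  fixes e :: "'k \<Rightarrow> 'a \<Rightarrow> 'b::euclidean_space" and a :: "'k \<Rightarrow> complex"
  assumes K: "finite K" and sq: "\<And>k. k \<in> K \<Longrightarrow> sqi M (e k)" and A: "A \<in> sets M"
  shows "norm (\<Sum>k\<in>K. \<Sum>l\<in>K. a k * a l * of_real (LINT x|M. indicator A x * (e k x \<bullet> e l x)))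
    \<le> (LINT x|M. indicator A x * ((norm (\<Sum>k\<in>K. Re (a k) *\<^sub>R e k x))\<^sup>2 + (norm (\<Sum>k\<in>K. Im (a k) *\<^sub>R e k x))\<^sup>2))"
proof -
  define P Q where "P x = (\<Sum>k\<in>K. Re (a k) *\<^sub>R e k x)" and "Q x = (\<Sum>k\<in>K. Im (a k) *\<^sub>R e k x)" for x
  have sP: "sqi M P" and sQ: "sqi M Q"
    unfolding P_def Q_def by (auto intro!: sqi_sum sqi_scaleR sq)
  have int: "integrable M (\<lambda>x. indicator A x * (f x \<bullet> g x))" if "sqi M f" "sqi M g" for f g :: "'a \<Rightarrow> 'b"
    using integrable_mult_indicator[OF A sqi_inner_integrable[OF that]] by simp
  have "(\<Sum>k\<in>K. \<Sum>l\<in>K. a k * a l * of_real (LINT x|M. indicator A x * (e k x \<bullet> e l x)))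
    = (\<Sum>k\<in>K. \<Sum>l\<in>K. (LINT x|M. a k * a l * complex_of_real (indicator A x * (e k x \<bullet> e l x))))"
    by (simp only: integral_mult_right_zero integral_complex_of_real)
  also have "\<dots> = (LINT x|M. (\<Sum>k\<in>K. \<Sum>l\<in>K. a k * a l * complex_of_real (indicator A x * (e k x \<bullet> e l x))))"
  proof -
    have i: "integrable M (\<lambda>x. a k * a l * complex_of_real (indicator A x * (e k x \<bullet> e l x)))" if "k \<in> K" "l \<in> K" for k l
      by (intro integrable_mult_right integrable_of_real int sq that)
    show ?thesis
      by (subst Bochner_Integration.integral_sum, intro Bochner_Integration.integrable_sum i, assumption+)
         (intro sum.cong refl Bochner_Integration.integral_sum[symmetric] i)
  qed
  also have "\<dots> = (LINT x|M. complex_of_real (indicator A x) * Complex ((norm (P x))\<^sup>2 - (norm (Q x))\<^sup>2) (2 * (P x \<bullet> Q x)))"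
  proof (intro Bochner_Integration.integral_cong refl)
    fix x
    have "(\<Sum>k\<in>K. \<Sum>l\<in>K. a k * a l * complex_of_real (indicator A x * (e k x \<bullet> e l x)))
        = complex_of_real (indicator A x) * (\<Sum>k\<in>K. \<Sum>l\<in>K. a k * a l * complex_of_real (e k x \<bullet> e l x))"
      by (simp add: sum_distrib_left algebra_simps)
    also have "(\<Sum>k\<in>K. \<Sum>l\<in>K. a k * a l * complex_of_real (e k x \<bullet> e l x)) = Complex ((norm (P x))\<^sup>2 - (norm (Q x))\<^sup>2) (2 * (P x \<bullet> Q x))"
    proof (rule complex_eqI)
      show "Re (\<Sum>k\<in>K. \<Sum>l\<in>K. a k * a l * complex_of_real (e k x \<bullet> e l x)) = Re (Complex ((norm (P x))\<^sup>2 - (norm (Q x))\<^sup>2) (2 * (P x \<bullet> Q x)))"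
        by (simp add: P_def Q_def power2_norm_eq_inner inner_sum_sum algebra_simps flip: sum_subtractf)
      have "Q x \<bullet> P x = P x \<bullet> Q x" by (rule inner_commute)
      hence "2 * (P x \<bullet> Q x) = P x \<bullet> Q x + Q x \<bullet> P x" by simp
      thus "Im (\<Sum>k\<in>K. \<Sum>l\<in>K. a k * a l * complex_of_real (e k x \<bullet> e l x)) = Im (Complex ((norm (P x))\<^sup>2 - (norm (Q x))\<^sup>2) (2 * (P x \<bullet> Q x)))"
        by (simp add: P_def Q_def inner_sum_sum algebra_simps flip: sum.distrib)
    qed
    finally show "(\<Sum>k\<in>K. \<Sum>l\<in>K. a k * a l * complex_of_real (indicator A x * (e k x \<bullet> e l x))) =
      complex_of_real (indicator A x) * Complex ((norm (P x))\<^sup>2 - (norm (Q x))\<^sup>2) (2 * (P x \<bullet> Q x))" .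
  qed
  finally have "norm (\<Sum>k\<in>K. \<Sum>l\<in>K. a k * a l * of_real (LINT x|M. indicator A x * (e k x \<bullet> e l x)))
    = norm (LINT x|M. complex_of_real (indicator A x) * Complex ((norm (P x))\<^sup>2 - (norm (Q x))\<^sup>2) (2 * (P x \<bullet> Q x)))"
    by simp
  also have "\<dots> \<le> (LINT x|M. indicator A x * ((norm (P x))\<^sup>2 + (norm (Q x))\<^sup>2))"
  proof (rule order_trans[OF integral_norm_bound integral_mono])
    have "integrable M (\<lambda>x. complex_of_real (indicator A x * (P x \<bullet> P x)) - complex_of_real (indicator A x * (Q x \<bullet> Q x))
        + \<i> * complex_of_real (2 * (indicator A x * (P x \<bullet> Q x))))"
      by (intro Bochner_Integration.integrable_add Bochner_Integration.integrable_diff integrable_mult_right integrable_of_real int sP sQ)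
    also have "(\<lambda>x. complex_of_real (indicator A x * (P x \<bullet> P x)) - complex_of_real (indicator A x * (Q x \<bullet> Q x))
        + \<i> * complex_of_real (2 * (indicator A x * (P x \<bullet> Q x)))) =
       (\<lambda>x. complex_of_real (indicator A x) * Complex ((norm (P x))\<^sup>2 - (norm (Q x))\<^sup>2) (2 * (P x \<bullet> Q x)))"
      by (auto simp: fun_eq_iff complex_eq_iff power2_norm_eq_inner algebra_simps)
    finally show "integrable M (\<lambda>x. norm (complex_of_real (indicator A x) * Complex ((norm (P x))\<^sup>2 - (norm (Q x))\<^sup>2) (2 * (P x \<bullet> Q x))))"
      by (rule integrable_norm)
    show "integrable M (\<lambda>x. indicator A x * ((norm (P x))\<^sup>2 + (norm (Q x))\<^sup>2))"
      using Bochner_Integration.integrable_add[OF int[OF sP sP] int[OF sQ sQ]]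
      by (simp add: power2_norm_eq_inner algebra_simps)
    fix x
    have "(P x \<bullet> Q x)\<^sup>2 \<le> (norm (P x))\<^sup>2 * (norm (Q x))\<^sup>2"
      using Cauchy_Schwarz_ineq[of "P x" "Q x"] by (simp add: power2_norm_eq_inner)
    hence "((norm (P x))\<^sup>2 - (norm (Q x))\<^sup>2)\<^sup>2 + (2 * (P x \<bullet> Q x))\<^sup>2 \<le> ((norm (P x))\<^sup>2 + (norm (Q x))\<^sup>2)\<^sup>2"
      by (simp add: power2_diff power2_sum power_mult_distrib)
    hence "cmod (Complex ((norm (P x))\<^sup>2 - (norm (Q x))\<^sup>2) (2 * (P x \<bullet> Q x))) \<le> (norm (P x))\<^sup>2 + (norm (Q x))\<^sup>2"
      unfolding complex_norm by (simp add: real_le_lsqrt)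
    thus "norm (complex_of_real (indicator A x) * Complex ((norm (P x))\<^sup>2 - (norm (Q x))\<^sup>2) (2 * (P x \<bullet> Q x)))
      \<le> indicator A x * ((norm (P x))\<^sup>2 + (norm (Q x))\<^sup>2)"
      by (auto simp: norm_mult indicator_def)
  qed
  finally show ?thesis by (simp add: P_def Q_def)
qed

proposition interpolation_bound:
  fixes e :: "'k \<Rightarrow> 'a \<Rightarrow> 'b::euclidean_space" and c :: "'j \<Rightarrow> 'k \<Rightarrow> real" and r :: "'k \<Rightarrow> real"
  assumes J: "finite J" "J \<noteq> {}" and K: "finite K" and sq: "\<And>k. k \<in> K \<Longrightarrow> sqi M (e k)"
    and on: "\<And>k l. k \<in> K \<Longrightarrow> l \<in> K \<Longrightarrow> (LINT x|M. e k x \<bullet> e l x) = (if k = l then 1 else 0)"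
    and Gram: "\<And>t. (\<Sum>k\<in>K. (\<Sum>j\<in>J. t j * c j k)\<^sup>2) \<le> (\<Sum>j\<in>J. (t j)\<^sup>2)"
    and r: "\<And>k. k \<in> K \<Longrightarrow> r k > 0"
    and B: "\<And>x. x \<in> space M \<Longrightarrow> (\<Sum>k\<in>K. r k powr (2 * q) * (norm (e k x))\<^sup>2) \<le> B"
    and q: "q > 1"
    and V: "simple_function M V" "\<And>x. x \<in> space M \<Longrightarrow> V x \<ge> 0" and fin: "finite_measure M"
    and X: "X > 0" "B * (LINT x|M. V x powr q) \<le> X"
  shows "(\<Sum>j\<in>J. LINT x|M. V x * (norm (\<Sum>k\<in>K. (c j k * r k) *\<^sub>R e k x))\<^sup>2)
     \<le> real (card J) powr (1 - 1 / q) * X powr (1 / q)"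
proof -
  interpret finite_measure M by fact
  \<comment> \<open>The value 0 is dropped because the powers v^(qz) are formed with
    \<open>ln v\<close>. As \<open>V\<close> has finitely many values, \<open>F\<close> becomes a
    finite sum of exponentials and is entire.\<close>
  define I where "I = V ` space M - {0}"
  define A where "A v = V -` {v} \<inter> space M" for v
  have I: "finite I" using V(1) by (auto simp: I_def simple_function_def)
  have Ipos: "v > 0" if "v \<in> I" for v using that V(2) by (force simp: I_def)
  have As: "A v \<in> sets M" if "v \<in> I" for v
    using that V(1) by (auto simp: A_def I_def simple_function_def)
  have Isum: "(\<Sum>v\<in>I. h v * indicator (A v) x) = (if V x = 0 then 0 else h (V x))"
    if "x \<in> space M" for x and h :: "real \<Rightarrow> real"
  proof -
    have "(\<Sum>v\<in>I. h v * indicator (A v) x) = (\<Sum>v\<in>I. if v = V x then h (V x) else 0)"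
      using that by (intro sum.cong) (auto simp: A_def indicator_def)
    also have "\<dots> = (if V x = 0 then 0 else h (V x))"
      using I that by (auto simp: I_def)
    finally show ?thesis .
  qed
  have sG: "sqi M (\<lambda>x. \<Sum>k\<in>K. a k *\<^sub>R e k x)" for a
    by (intro sqi_sum sqi_scaleR sq)
  have intG: "integrable M (\<lambda>x. (norm (\<Sum>k\<in>K. a k *\<^sub>R e k x))\<^sup>2)" for a
    by (rule sqi_integrable[OF sG])
  have intGA: "integrable M (\<lambda>x. indicator (A v) x * (norm (\<Sum>k\<in>K. a k *\<^sub>R e k x))\<^sup>2)" if "v \<in> I" for a v
    using integrable_mult_indicator[OF As[OF that] intG] by simp
  \<comment> \<open>This is \<open>c j k\<close> times r^(qz). The factor q in the exponent restores
    \<open>c j k * r k\<close> at z = 1/q and produces the weights r^(2q) on the line Re z =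
    1.\<close>
  define \<alpha> where "\<alpha> z j k = complex_of_real (c j k) * exp (of_real (q * ln (r k)) * z)" for z j k
  define H where "H v k l = (LINT x|M. indicator (A v) x * (e k x \<bullet> e l x))" for v k l
  define F where "F z = (\<Sum>j\<in>J. \<Sum>v\<in>I. exp (of_real (q * ln v) * z) *
      (\<Sum>k\<in>K. \<Sum>l\<in>K. \<alpha> z j k * \<alpha> z j l * of_real (H v k l)))" for z
  have holF: "F holomorphic_on UNIV"
    unfolding F_def \<alpha>_def by (intro holomorphic_intros)
  define G where "G z j x = (norm (\<Sum>k\<in>K. Re (\<alpha> z j k) *\<^sub>R e k x))\<^sup>2 + (norm (\<Sum>k\<in>K. Im (\<alpha> z j k) *\<^sub>R e k x))\<^sup>2" for z j x
  have intGv: "integrable M (\<lambda>x. indicator (A v) x * G z j x)" if "v \<in> I" for v z j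
    unfolding G_def distrib_left by (intro Bochner_Integration.integrable_add intGA that)
  \<comment> \<open>The modulus of V^(qz) when Re z = s, with the value 0 where V vanishes.\<close>
  define w where "w s x = (if V x = 0 then 0 else exp (q * ln (V x) * s))" for s x
  have Fbound: "norm (F z) \<le> (\<Sum>j\<in>J. LINT x|M. w (Re z) x * G z j x)" for z
  proof -
    have "norm (F z) \<le> (\<Sum>j\<in>J. \<Sum>v\<in>I. norm (exp (of_real (q * ln v) * z)) *
        norm (\<Sum>k\<in>K. \<Sum>l\<in>K. \<alpha> z j k * \<alpha> z j l * of_real (H v k l)))"
      unfolding F_def by (intro order_trans[OF norm_sum] sum_mono) (simp add: norm_mult)
    also have "\<dots> \<le> (\<Sum>j\<in>J. \<Sum>v\<in>I. exp (q * ln v * Re z) * (LINT x|M. indicator (A v) x * G z j x))"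
      unfolding H_def G_def
      by (intro sum_mono mult_mono bilinear_complex_bound K sq As) auto
    also have "\<dots> = (\<Sum>j\<in>J. LINT x|M. (\<Sum>v\<in>I. exp (q * ln v * Re z) * (indicator (A v) x * G z j x)))"
      by (intro sum.cong refl, subst Bochner_Integration.integral_sum)
         (auto intro!: intGv sum.cong)
    also have "\<dots> = (\<Sum>j\<in>J. LINT x|M. w (Re z) x * G z j x)"
    proof (intro sum.cong refl Bochner_Integration.integral_cong)
      fix j x assume "x \<in> space M"
      from Isum[OF this, of "\<lambda>v. exp (q * ln v * Re z)"]
      show "(\<Sum>v\<in>I. exp (q * ln v * Re z) * (indicator (A v) x * G z j x)) = w (Re z) x * G z j x"
        by (simp add: w_def sum_distrib_right[symmetric] mult.assoc[symmetric])
    qed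
    finally show ?thesis .
  qed
  have \<alpha>_norm: "(Re (\<alpha> z j k))\<^sup>2 + (Im (\<alpha> z j k))\<^sup>2 = (c j k)\<^sup>2 * exp (2 * (q * ln (r k) * Re z))" for z j k
    unfolding cmod_power2[symmetric]
    by (simp add: \<alpha>_def norm_mult power_mult_distrib power2_eq_square exp_add[symmetric] mult_ac)
  have intGz: "integrable M (G z j)" for z j
    unfolding G_def by (intro Bochner_Integration.integrable_add intG)
  have LG: "(LINT x|M. G z j x) = (\<Sum>k\<in>K. (c j k)\<^sup>2 * exp (2 * (q * ln (r k) * Re z)))" for z j
    unfolding G_def using intG
    by (subst Bochner_Integration.integral_add) (auto simp: orthonormal_norm_sum[OF K sq on] \<alpha>_norm[symmetric] sum.distrib)
  \<comment> \<open>The Gram bound is tested with the unit vector of index \<open>j\<close>.\<close>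
  have cj: "(\<Sum>k\<in>K. (c j k)\<^sup>2) \<le> 1" if "j \<in> J" for j
  proof -
    have "(\<Sum>k\<in>K. (\<Sum>i\<in>J. of_bool (i = j) * c i k)\<^sup>2) \<le> (\<Sum>i\<in>J. (of_bool (i = j))\<^sup>2)"
      by (rule Gram)
    thus ?thesis using J that by (simp add: of_bool_def if_distrib if_distribR sum.delta cong: if_cong)
  qed
  have wmeas: "w s \<in> borel_measurable M" for s
    unfolding w_def using borel_measurable_simple_function[OF V(1)] by measurable
  have VM: "finite (V ` space M)" using V(1) by (simp add: simple_function_def)
  define D where "D = (\<Sum>v\<in>V ` space M. exp \<bar>q * ln v\<bar>)"
  have D: "w s y \<le> D" if s: "0 \<le> s" "s \<le> 1" and y: "y \<in> space M" for s y
  proof -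
    have "w s y \<le> exp \<bar>q * ln (V y)\<bar>"
    proof -
      have "q * ln (V y) * s \<le> \<bar>q * ln (V y)\<bar> * 1"
        using s by (metis abs_ge_self abs_ge_zero mult_mono)
      thus ?thesis by (simp add: w_def)
    qed
    also have "\<dots> \<le> (\<Sum>v\<in>V ` space M. exp \<bar>q * ln v\<bar>)"
      using y by (intro member_le_sum[where f = "\<lambda>v. exp \<bar>q * ln v\<bar>"] VM) auto
    finally show "w s y \<le> D" unfolding D_def .
  qed
  have D0: "D \<ge> 0" by (simp add: D_def sum_nonneg)
  have w0: "w s x \<ge> 0" for s x by (simp add: w_def)
  have G0: "G z j x \<ge> 0" for z j x by (simp add: G_def)
  have intwG: "integrable M (\<lambda>x. w s x * G z j x)" if "0 \<le> s" "s \<le> 1" for s z j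
  proof (rule Bochner_Integration.integrable_bound)
    show "integrable M (\<lambda>x. D * G z j x)" using intGz by simp
    show "(\<lambda>x. w s x * G z j x) \<in> borel_measurable M" using wmeas intGz by (auto intro!: borel_measurable_times)
    show "AE x in M. norm (w s x * G z j x) \<le> norm (D * G z j x)"
      using D D0 that w0 G0 by (intro AE_I2) (auto simp: abs_mult mult_right_mono)
  qed
  define N where "N = real (card J)"
  have N: "N > 0" using J by (auto simp: N_def card_gt_0_iff)
  have bdd: "\<exists>C. \<forall>z. 0 \<le> Re z \<longrightarrow> Re z \<le> 1 \<longrightarrow> norm (F z) \<le> C"
  proof (intro exI allI impI)
    fix z assume z: "0 \<le> Re z" "Re z \<le> 1"
    have "norm (F z) \<le> (\<Sum>j\<in>J. LINT x|M. w (Re z) x * G z j x)" by (rule Fbound)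
    also have "\<dots> \<le> (\<Sum>j\<in>J. LINT x|M. D * G z j x)"
      using z D G0 by (intro sum_mono integral_mono intwG integrable_mult_right intGz mult_right_mono) auto
    also have "\<dots> = (\<Sum>j\<in>J. D * (\<Sum>k\<in>K. (c j k)\<^sup>2 * exp (2 * (q * ln (r k) * Re z))))"
      by (simp add: LG)
    also have "\<dots> \<le> (\<Sum>j\<in>J. D * (\<Sum>k\<in>K. (c j k)\<^sup>2 * exp (2 * \<bar>q * ln (r k)\<bar>)))"
    proof (intro sum_mono mult_left_mono)
      fix k
      have "q * ln (r k) * Re z \<le> \<bar>q * ln (r k)\<bar> * 1"
        using z by (metis abs_ge_self abs_ge_zero mult_mono)
      thus "exp (2 * (q * ln (r k) * Re z)) \<le> exp (2 * \<bar>q * ln (r k)\<bar>)" by simp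
    qed (use D0 in auto)
    finally show "norm (F z) \<le> (\<Sum>j\<in>J. D * (\<Sum>k\<in>K. (c j k)\<^sup>2 * exp (2 * \<bar>q * ln (r k)\<bar>)))" .
  qed
  then obtain C where C: "\<And>z. 0 \<le> Re z \<Longrightarrow> Re z \<le> 1 \<Longrightarrow> norm (F z) \<le> C" by blast
  \<comment> \<open>On this line \<open>w\<close> is at most 1 and the factors r^(qz) are
    unimodular. Orthonormality of \<open>e\<close> reduces each summand to the squared length of a
    row of \<open>c\<close>.\<close>
  have left: "norm (F z) \<le> N" if z: "Re z = 0" for z
  proof -
    have "norm (F z) \<le> (\<Sum>j\<in>J. LINT x|M. w (Re z) x * G z j x)" by (rule Fbound)
    also have "\<dots> \<le> (\<Sum>j\<in>J. LINT x|M. G z j x)"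
      using z G0 by (intro sum_mono integral_mono intwG intGz) (auto simp: w_def)
    also have "\<dots> \<le> (\<Sum>j\<in>J. 1)"
      using z cj by (intro sum_mono) (simp add: LG)
    finally show ?thesis by (simp add: N_def)
  qed
  have right: "norm (F z) \<le> X" if z: "Re z = 1" for z
  proof -
    \<comment> \<open>Bessel's inequality is used separately for the real and the imaginary part of
      r^(qz); their squares add up to r^(2q) when Re z = 1.\<close>
    have Gs: "(\<Sum>j\<in>J. G z j x) \<le> B" if x: "x \<in> space M" for x
    proof -
      have "(\<Sum>j\<in>J. (norm (\<Sum>k\<in>K. Re (\<alpha> z j k) *\<^sub>R e k x))\<^sup>2)
        \<le> (\<Sum>k\<in>K. (Re (exp (of_real (q * ln (r k)) * z)))\<^sup>2 * (norm (e k x))\<^sup>2)"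
        using Bessel_pointwise[OF J(1) K Gram, of "\<lambda>k. Re (exp (of_real (q * ln (r k)) * z))" e x]
        by (simp add: \<alpha>_def)
      moreover have "(\<Sum>j\<in>J. (norm (\<Sum>k\<in>K. Im (\<alpha> z j k) *\<^sub>R e k x))\<^sup>2)
        \<le> (\<Sum>k\<in>K. (Im (exp (of_real (q * ln (r k)) * z)))\<^sup>2 * (norm (e k x))\<^sup>2)"
        using Bessel_pointwise[OF J(1) K Gram, of "\<lambda>k. Im (exp (of_real (q * ln (r k)) * z))" e x]
        by (simp add: \<alpha>_def)
      ultimately have "(\<Sum>j\<in>J. G z j x) \<le> (\<Sum>k\<in>K. ((Re (exp (of_real (q * ln (r k)) * z)))\<^sup>2 +
          (Im (exp (of_real (q * ln (r k)) * z)))\<^sup>2) * (norm (e k x))\<^sup>2)"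
        unfolding G_def sum.distrib distrib_right by linarith
      also have "\<dots> = (\<Sum>k\<in>K. r k powr (2 * q) * (norm (e k x))\<^sup>2)"
        unfolding cmod_power2[symmetric] using r z
        by (intro sum.cong refl) (simp add: powr_def power2_eq_square exp_add[symmetric] mult_ac, metis less_irrefl)
      also have "\<dots> \<le> B" by (rule B[OF x])
      finally show ?thesis .
    qed
    have "norm (F z) \<le> (\<Sum>j\<in>J. LINT x|M. w (Re z) x * G z j x)" by (rule Fbound)
    also have "\<dots> = (LINT x|M. w 1 x * (\<Sum>j\<in>J. G z j x))"
      unfolding sum_distrib_left using z intwG by (subst Bochner_Integration.integral_sum) auto
    also have "\<dots> \<le> (LINT x|M. V x powr q * B)"
    proof (rule integral_mono)
      show "integrable M (\<lambda>x. w 1 x * (\<Sum>j\<in>J. G z j x))"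
        unfolding sum_distrib_left using intwG by (intro Bochner_Integration.integrable_sum) auto
      have sf: "simple_function M (\<lambda>x. V x powr q)"
        using simple_function_compose1[OF V(1), of "\<lambda>v. v powr q"] by simp
      show "integrable M (\<lambda>x. V x powr q * B)"
        using integrable_const_bound[of "\<lambda>x. V x powr q" "Max ((\<lambda>x. V x powr q) ` space M)"] sf
        by (auto intro!: integrable_mult_left simp: simple_function_def borel_measurable_simple_function[OF sf])
      fix x assume x: "x \<in> space M"
      have "w 1 x = V x powr q" using V(2)[OF x] by (auto simp: w_def powr_def)
      thus "w 1 x * (\<Sum>j\<in>J. G z j x) \<le> V x powr q * B"
        using Gs[OF x] by (simp add: mult_left_mono)
    qed
    also have "\<dots> \<le> X" using X(2) by (simp add: mult.commute)
    finally show ?thesis .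
  qed
  have "norm (F (of_real (1/q))) \<le> N powr (1 - 1/q) * X powr (1/q)"
    using Hadamard_three_lines[OF holF C left right N X(1), of "1/q"] q by simp
  moreover have "F (of_real (1/q)) = of_real (\<Sum>j\<in>J. LINT x|M. V x * (norm (\<Sum>k\<in>K. (c j k * r k) *\<^sub>R e k x))\<^sup>2)"
  proof -
    have \<alpha>1: "\<alpha> (of_real (1/q)) j k = of_real (c j k * r k)" if "k \<in> K" for j k
    proof -
      have "exp (of_real (q * ln (r k)) * of_real (1/q)) = complex_of_real (r k)"
      proof -
        have "of_real (q * ln (r k)) * of_real (1/q) = complex_of_real (ln (r k))" using q by simp
        thus ?thesis using r[OF that] by (simp add: exp_of_real del: of_real_mult of_real_divide)
      qed
      thus ?thesis by (simp add: \<alpha>_def)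
    qed
    have v1: "exp (of_real (q * ln v) * of_real (1/q)) = complex_of_real v" if "v \<in> I" for v
    proof -
      have "of_real (q * ln v) * of_real (1/q) = complex_of_real (ln v)" using q by simp
      thus ?thesis using Ipos[OF that] by (simp add: exp_of_real del: of_real_mult of_real_divide)
    qed
    have "F (of_real (1/q)) = of_real (\<Sum>j\<in>J. \<Sum>v\<in>I. v * (\<Sum>k\<in>K. \<Sum>l\<in>K. (c j k * r k) * (c j l * r l) * H v k l))"
      unfolding F_def by (simp only: \<alpha>1 v1 v1[unfolded of_real_mult] of_real_mult of_real_sum cong: sum.cong)
    also have "(\<Sum>j\<in>J. \<Sum>v\<in>I. v * (\<Sum>k\<in>K. \<Sum>l\<in>K. (c j k * r k) * (c j l * r l) * H v k l))
      = (\<Sum>j\<in>J. LINT x|M. V x * (norm (\<Sum>k\<in>K. (c j k * r k) *\<^sub>R e k x))\<^sup>2)"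
    proof (rule sum.cong[OF refl])
      fix j
      have "(\<Sum>k\<in>K. \<Sum>l\<in>K. (c j k * r k) * (c j l * r l) * H v k l)
        = (LINT x|M. indicator (A v) x * (norm (\<Sum>k\<in>K. (c j k * r k) *\<^sub>R e k x))\<^sup>2)" if v: "v \<in> I" for v
      proof -
        have int: "integrable M (\<lambda>x. indicator (A v) x * (e k x \<bullet> e l x))" if "k \<in> K" "l \<in> K" for k l
          using integrable_mult_indicator[OF As[OF v] sqi_inner_integrable[OF sq sq]] that by simp
        have "(\<Sum>k\<in>K. \<Sum>l\<in>K. (c j k * r k) * (c j l * r l) * H v k l)
          = (LINT x|M. (\<Sum>k\<in>K. \<Sum>l\<in>K. (c j k * r k) * (c j l * r l) * (indicator (A v) x * (e k x \<bullet> e l x))))"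
          unfolding H_def using int by (subst Bochner_Integration.integral_sum) (auto intro!: Bochner_Integration.integrable_sum)
        also have "\<dots> = (LINT x|M. indicator (A v) x * (norm (\<Sum>k\<in>K. (c j k * r k) *\<^sub>R e k x))\<^sup>2)"
          by (intro Bochner_Integration.integral_cong refl)
             (simp add: power2_norm_eq_inner inner_sum_sum sum_distrib_left mult_ac)
        finally show ?thesis .
      qed
      hence "(\<Sum>v\<in>I. v * (\<Sum>k\<in>K. \<Sum>l\<in>K. (c j k * r k) * (c j l * r l) * H v k l))
        = (\<Sum>v\<in>I. LINT x|M. v * (indicator (A v) x * (norm (\<Sum>k\<in>K. (c j k * r k) *\<^sub>R e k x))\<^sup>2))" by simp
      also have "\<dots> = (LINT x|M. (\<Sum>v\<in>I. v * (indicator (A v) x * (norm (\<Sum>k\<in>K. (c j k * r k) *\<^sub>R e k x))\<^sup>2)))"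
        using intGA by (subst Bochner_Integration.integral_sum) auto
      also have "\<dots> = (LINT x|M. V x * (norm (\<Sum>k\<in>K. (c j k * r k) *\<^sub>R e k x))\<^sup>2)"
      proof (intro Bochner_Integration.integral_cong refl)
        fix x assume "x \<in> space M"
        from Isum[OF this, of "\<lambda>v. v"]
        show "(\<Sum>v\<in>I. v * (indicator (A v) x * (norm (\<Sum>k\<in>K. (c j k * r k) *\<^sub>R e k x))\<^sup>2)) = V x * (norm (\<Sum>k\<in>K. (c j k * r k) *\<^sub>R e k x))\<^sup>2"
          by (simp add: sum_distrib_right[symmetric] mult.assoc[symmetric])
      qed
      finally show "(\<Sum>v\<in>I. v * (\<Sum>k\<in>K. \<Sum>l\<in>K. (c j k * r k) * (c j l * r l) * H v k l))
        = (LINT x|M. V x * (norm (\<Sum>k\<in>K. (c j k * r k) *\<^sub>R e k x))\<^sup>2)" .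
    qed
    finally show ?thesis .
  qed
  ultimately show ?thesis by (simp only: N_def norm_of_real abs_le_iff)
qed

section \<open>Smooth functions on the sphere\<close>

lemma has_derivative_frechet:
  "f differentiable_on S \<Longrightarrow> open S \<Longrightarrow> x \<in> S \<Longrightarrow> (f has_derivative frechet_derivative f (at x)) (at x)"
  by (metis at_within_open differentiable_on_def frechet_derivative_works)

lemma frechet_eqI: "(f has_derivative f') (at x) \<Longrightarrow> frechet_derivative f (at x) = f'"
  using frechet_derivative_at by metis

lemma frechet_cong:
  assumes "open S" "\<And>x. x \<in> S \<Longrightarrow> f x = g x" "x \<in> S"
  shows "frechet_derivative f (at x) = frechet_derivative g (at x)"
proof -
  have "(f has_derivative h) (at x) \<longleftrightarrow> (g has_derivative h) (at x)" for h
    using has_derivative_transform_within_open[OF _ assms(1,3)] assms(2) by metis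
  thus ?thesis by (simp add: frechet_derivative_def)
qed

lemma Ck_on_cong:
  assumes S: "open S" and "\<And>x. x \<in> S \<Longrightarrow> f x = g x"
  shows "Ck_on k S f \<longleftrightarrow> Ck_on k S g"
  using assms(2)
proof (induction k arbitrary: f g)
  case 0
  then show ?case by (simp cong: continuous_on_cong)
next
  case (Suc k)
  have "f differentiable_on S \<longleftrightarrow> g differentiable_on S"
    unfolding differentiable_on_def differentiable_def
    using has_derivative_transform[of _ S g f] has_derivative_transform[of _ S f g] Suc.prems by metis
  moreover have "Ck_on k S (\<lambda>x. frechet_derivative f (at x) v) = Ck_on k S (\<lambda>x. frechet_derivative g (at x) v)" for v
    by (rule Suc.IH) (simp add: frechet_cong[OF S Suc.prems])
  ultimately show ?case by simp
qed

lemma Ck_on_Suc_imp: "Ck_on (Suc k) S f \<Longrightarrow> Ck_on k S f"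
proof (induction k arbitrary: f)
  case 0
  then show ?case by (simp add: differentiable_imp_continuous_on)
next
  case (Suc k)
  from Suc.prems have "f differentiable_on S" "\<And>v. Ck_on (Suc k) S (\<lambda>x. frechet_derivative f (at x) v)" by auto
  with Suc.IH show ?case by simp
qed

lemma Ck_on_SucI:
  assumes S: "open S" and d: "\<And>x. x \<in> S \<Longrightarrow> (f has_derivative D x) (at x)" and c: "\<And>v. Ck_on k S (\<lambda>x. D x v)"
  shows "Ck_on (Suc k) S f"
proof -
  have "f differentiable_on S"
    using d by (meson differentiable_at_imp_differentiable_on differentiable_def)
  moreover have "Ck_on k S (\<lambda>x. frechet_derivative f (at x) v)" for v
    using c[of v] Ck_on_cong[OF S, of "\<lambda>x. frechet_derivative f (at x) v" "\<lambda>x. D x v"] frechet_eqI[OF d] by simp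
  ultimately show ?thesis by simp
qed

lemma Ck_on_const: "open S \<Longrightarrow> Ck_on k S (\<lambda>x. c)"
proof (induction k arbitrary: c)
  case (Suc k)
  show ?case by (rule Ck_on_SucI[where D = "\<lambda>x v. 0"]) (auto simp: Suc)
qed auto

lemma Ck_on_linear:
  assumes T: "bounded_linear T" and S: "open S"
  shows "Ck_on k S f \<Longrightarrow> Ck_on k S (\<lambda>x. T (f x))"
proof (induction k arbitrary: f)
  case 0
  then show ?case using bounded_linear.continuous_on[OF T] by auto
next
  case (Suc k)
  show ?case
  proof (rule Ck_on_SucI[OF S])
    show "((\<lambda>x. T (f x)) has_derivative (\<lambda>v. T (frechet_derivative f (at x) v))) (at x)" if "x \<in> S" for x
      using Suc.prems bounded_linear.has_derivative[OF T] has_derivative_frechet[OF _ S that] by auto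
    show "Ck_on k S (\<lambda>x. T (frechet_derivative f (at x) v))" for v
      using Suc by auto
  qed
qed

lemma Ck_on_add:
  assumes S: "open S"
  shows "Ck_on k S f \<Longrightarrow> Ck_on k S g \<Longrightarrow> Ck_on k S (\<lambda>x. f x + g x)"
proof (induction k arbitrary: f g)
  case 0
  then show ?case by (auto intro: continuous_on_add)
next
  case (Suc k)
  show ?case
  proof (rule Ck_on_SucI[OF S])
    show "((\<lambda>x. f x + g x) has_derivative (\<lambda>v. frechet_derivative f (at x) v + frechet_derivative g (at x) v)) (at x)" if "x \<in> S" for x
      using Suc.prems by (intro has_derivative_add has_derivative_frechet[OF _ S that]) auto
    show "Ck_on k S (\<lambda>x. frechet_derivative f (at x) v + frechet_derivative g (at x) v)" for v
      using Suc by auto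
  qed
qed

lemma Ck_on_bilinear:
  assumes p: "bounded_bilinear p" and S: "open S"
  shows "Ck_on k S f \<Longrightarrow> Ck_on k S g \<Longrightarrow> Ck_on k S (\<lambda>x. p (f x) (g x))"
proof (induction k arbitrary: f g)
  case 0
  then show ?case using bounded_bilinear.continuous_on[OF p] by auto
next
  case (Suc k)
  show ?case
  proof (rule Ck_on_SucI[OF S])
    show "((\<lambda>x. p (f x) (g x)) has_derivative (\<lambda>v. p (f x) (frechet_derivative g (at x) v) + p (frechet_derivative f (at x) v) (g x))) (at x)" if "x \<in> S" for x
      using Suc.prems by (intro bounded_bilinear.FDERIV[OF p] has_derivative_frechet[OF _ S that]) auto
    show "Ck_on k S (\<lambda>x. p (f x) (frechet_derivative g (at x) v) + p (frechet_derivative f (at x) v) (g x))" for v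
      using Suc Ck_on_Suc_imp[OF Suc.prems(1)] Ck_on_Suc_imp[OF Suc.prems(2)] by (intro Ck_on_add S Suc.IH) auto
  qed
qed

lemma Ck_on_ident: "open S \<Longrightarrow> Ck_on k S (\<lambda>x. x)"
proof (cases k)
  case (Suc j)
  assume "open S"
  thus ?thesis unfolding Suc
    by (intro Ck_on_SucI[where D = "\<lambda>x v. v"]) (auto intro!: Ck_on_const derivative_eq_intros)
qed auto

lemma has_derivative_inverse_norm:
  fixes x :: "'a::real_inner" assumes "x \<noteq> 0"
  shows "((\<lambda>x. inverse (norm x)) has_derivative (\<lambda>v. - ((x \<bullet> v) * (inverse (norm x) * (inverse (norm x) * inverse (norm x)))))) (at x)"
  using assms
  by (auto intro!: derivative_eq_intros has_derivative_norm simp: sgn_div_norm fun_eq_iff inner_commute field_simps)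

text \<open>The derivative of 1/|x| is a linear function of x times the cube of 1/|x|, so the
  induction closes under the product rule.\<close>

lemma Ck_on_inverse_norm: "Ck_on k (UNIV - {0}) (\<lambda>x::'a::real_inner. inverse (norm x))"
proof (induction k)
  case 0
  show ?case by (auto intro!: continuous_intros)
next
  case (Suc k)
  have o: "open (UNIV - {0::'a})" by (simp add: open_delete)
  show ?case
  proof (rule Ck_on_SucI[OF o])
    show "((\<lambda>x. inverse (norm x)) has_derivative (\<lambda>v. - ((x \<bullet> v) * (inverse (norm x) * (inverse (norm x) * inverse (norm x)))))) (at x)"
      if "x \<in> UNIV - {0}" for x :: 'a using has_derivative_inverse_norm that by auto
    show "Ck_on k (UNIV - {0}) (\<lambda>x::'a. - ((x \<bullet> v) * (inverse (norm x) * (inverse (norm x) * inverse (norm x)))))" for v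
      by (intro Ck_on_linear[OF bounded_linear_minus[OF bounded_linear_ident] o] Ck_on_bilinear[OF bounded_bilinear_mult o] Suc
          Ck_on_linear[OF bounded_linear_inner_left o] Ck_on_ident o)
  qed
qed

section \<open>Functions on the sphere through their radial extension\<close>

abbreviation punctured :: "(real^3) set" where "punctured \<equiv> UNIV - {0}"

lemma open_punctured: "open punctured"
  by (simp add: open_delete)

lemma radial_S2 [simp]: "norm x = 1 \<Longrightarrow> radial x = x"
  by (simp add: radial_def)

lemma radial_in_S2: "x \<noteq> 0 \<Longrightarrow> radial x \<in> S2"
  by (simp add: radial_def)

lemma S2_nonzero: "x \<in> S2 \<Longrightarrow> x \<noteq> 0" by auto

lemma S2_inner: "x \<in> S2 \<Longrightarrow> x \<bullet> x = 1"
  by (simp add: dot_square_norm)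

lemma radial_scaleR: "c > 0 \<Longrightarrow> radial (c *\<^sub>R x) = radial x"
  by (simp add: radial_def)

lemma has_derivative_radial:
  assumes "x \<in> S2"
  shows "(radial has_derivative (\<lambda>v. v - (x \<bullet> v) *\<^sub>R x)) (at x)"
proof -
  have "x \<noteq> 0" "norm x = 1" using assms by auto
  show ?thesis
    unfolding radial_def
    using has_derivative_scaleR[OF has_derivative_inverse_norm[OF \<open>x \<noteq> 0\<close>] has_derivative_ident] \<open>norm x = 1\<close> by simp
qed

lemma Ck_on_radial: "Ck_on k punctured radial"
  unfolding radial_def
  by (intro Ck_on_bilinear[OF bounded_bilinear_scaleR open_punctured] Ck_on_inverse_norm Ck_on_ident open_punctured)

lemma smooth_cong:
  assumes "smooth_on_S2 f" "\<And>x. x \<in> S2 \<Longrightarrow> f x = g x"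
  shows "smooth_on_S2 g"
proof -
  have "Ck_on k punctured (f \<circ> radial) = Ck_on k punctured (g \<circ> radial)" for k
    by (rule Ck_on_cong[OF open_punctured]) (auto simp: o_def intro!: assms(2) radial_in_S2)
  thus ?thesis using assms(1) by (simp add: smooth_on_S2_def)
qed

lemma smooth_const: "smooth_on_S2 (\<lambda>x. c)"
  by (simp add: smooth_on_S2_def o_def Ck_on_const open_punctured)

lemma smooth_ident: "smooth_on_S2 (\<lambda>x. x)"
  by (simp add: smooth_on_S2_def o_def Ck_on_radial)

lemma smooth_linear: "bounded_linear T \<Longrightarrow> smooth_on_S2 f \<Longrightarrow> smooth_on_S2 (\<lambda>x. T (f x))"
  using Ck_on_linear[OF _ open_punctured] by (auto simp: smooth_on_S2_def o_def)

lemma smooth_add: "smooth_on_S2 f \<Longrightarrow> smooth_on_S2 g \<Longrightarrow> smooth_on_S2 (\<lambda>x. f x + g x)"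
  using Ck_on_add[OF open_punctured, of _ "f \<circ> radial" "g \<circ> radial"] unfolding smooth_on_S2_def o_def by blast

lemma smooth_bilinear: "bounded_bilinear p \<Longrightarrow> smooth_on_S2 f \<Longrightarrow> smooth_on_S2 g \<Longrightarrow> smooth_on_S2 (\<lambda>x. p (f x) (g x))"
  using Ck_on_bilinear[OF _ open_punctured, of p _ "f \<circ> radial" "g \<circ> radial"] unfolding smooth_on_S2_def o_def by blast

lemmas smooth_mult = smooth_bilinear[OF bounded_bilinear_mult]
  and smooth_scaleR = smooth_bilinear[OF bounded_bilinear_scaleR]
  and smooth_inner = smooth_bilinear[OF bounded_bilinear_inner]
  and smooth_minus = smooth_linear[OF bounded_linear_minus[OF bounded_linear_ident]]

lemma bounded_bilinear_cross3: "bounded_bilinear cross3"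
  using bilinear_cross by (simp add: bilinear_conv_bounded_bilinear)

lemmas smooth_cross3 = smooth_bilinear[OF bounded_bilinear_cross3]

lemma smooth_sum: "(\<And>i. i \<in> I \<Longrightarrow> smooth_on_S2 (f i)) \<Longrightarrow> smooth_on_S2 (\<lambda>x. \<Sum>i\<in>I. f i x)"
  by (induction I rule: infinite_finite_induct) (auto intro: smooth_const smooth_add)

lemma smooth_component: "smooth_on_S2 f \<Longrightarrow> smooth_on_S2 (\<lambda>x. f x $ i)"
  by (rule smooth_linear[OF bounded_linear_vec_nth])

definition sdiff :: "(real^3 \<Rightarrow> 'b::real_normed_vector) \<Rightarrow> bool" where
  "sdiff f \<longleftrightarrow> (f \<circ> radial) differentiable_on punctured"

lemma smooth_sdiff: "smooth_on_S2 f \<Longrightarrow> sdiff f"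
  unfolding smooth_on_S2_def sdiff_def using Ck_on.simps(2) by blast

lemma sdiff_deriv: "sdiff f \<Longrightarrow> x \<noteq> 0 \<Longrightarrow> ((f \<circ> radial) has_derivative frechet_derivative (f \<circ> radial) (at x)) (at x)"
  unfolding sdiff_def by (rule has_derivative_frechet[OF _ open_punctured]) auto

lemma smooth_continuous_on: 
  assumes "smooth_on_S2 f" shows "continuous_on S2 f"
proof -
  have "Ck_on 0 punctured (f \<circ> radial)" using assms by (simp only: smooth_on_S2_def)
  hence "continuous_on punctured (f \<circ> radial)" by simp
  hence "continuous_on S2 (f \<circ> radial)" by (rule continuous_on_subset) auto
  thus ?thesis by (rule continuous_on_eq) simp
qed

text \<open>
  Angular momentum: the derivative along the Killing field \<open>x \<mapsto> w \<times> x\<close>.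
\<close>

definition Lw :: "real^3 \<Rightarrow> (real^3 \<Rightarrow> 'b::real_normed_vector) \<Rightarrow> real^3 \<Rightarrow> 'b" where
  "Lw w f x = frechet_derivative (f \<circ> radial) (at x) (cross3 w x)"

lemma Lw_cong:
  assumes "\<And>x. x \<in> S2 \<Longrightarrow> f x = g x" "x \<noteq> 0"
  shows "Lw w f x = Lw w g x"
proof -
  have "frechet_derivative (f \<circ> radial) (at x) = frechet_derivative (g \<circ> radial) (at x)"
    using assms by (intro frechet_cong[OF open_punctured]) (auto intro!: assms(1) radial_in_S2 simp del: mem_sphere)
  thus ?thesis by (simp add: Lw_def)
qed

lemma Lw_const [simp]: "Lw w (\<lambda>x. c) x = 0"
  by (simp add: Lw_def o_def frechet_derivative_const)

lemma Lw_ident: "x \<in> S2 \<Longrightarrow> Lw w (\<lambda>x. x) x = cross3 w x"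
  unfolding Lw_def o_def
  by (subst frechet_eqI[OF has_derivative_radial]) (auto simp: dot_cross_self)

lemma Lw_linear:
  assumes T: "bounded_linear T" and f: "sdiff f" and x: "x \<noteq> 0"
  shows "Lw w (\<lambda>x. T (f x)) x = T (Lw w f x)"
  unfolding Lw_def
  using frechet_eqI[OF bounded_linear.has_derivative[OF T sdiff_deriv[OF f x]]] by (simp add: o_def)

lemma Lw_add:
  assumes f: "sdiff f" "sdiff g" and x: "x \<noteq> 0"
  shows "Lw w (\<lambda>x. f x + g x) x = Lw w f x + Lw w g x"
  unfolding Lw_def
  using frechet_eqI[OF has_derivative_add[OF sdiff_deriv[OF f(1) x] sdiff_deriv[OF f(2) x]]] by (simp add: o_def)

lemma Lw_bilinear:
  assumes p: "bounded_bilinear p" and f: "sdiff f" "sdiff g" and x: "x \<in> S2"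
  shows "Lw w (\<lambda>x. p (f x) (g x)) x = p (f x) (Lw w g x) + p (Lw w f x) (g x)"
  unfolding Lw_def
  using frechet_eqI[OF bounded_bilinear.FDERIV[OF p sdiff_deriv[OF f(1) S2_nonzero[OF x]] sdiff_deriv[OF f(2) S2_nonzero[OF x]]]] x by (auto simp: o_def)

lemmas Lw_mult = Lw_bilinear[OF bounded_bilinear_mult]

lemma Lw_component: "sdiff f \<Longrightarrow> x \<noteq> 0 \<Longrightarrow> Lw w (\<lambda>x. f x $ i) x = Lw w f x $ i"
  by (rule Lw_linear[OF bounded_linear_vec_nth])

lemma Lw_coord: "x \<in> S2 \<Longrightarrow> Lw w (\<lambda>x. x $ i) x = cross3 w x $ i"
  using Lw_component[OF smooth_sdiff[OF smooth_ident]] Lw_ident S2_nonzero by metis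

lemma Lw_sum: 
  "(\<And>i. i \<in> I \<Longrightarrow> smooth_on_S2 (f i)) \<Longrightarrow> x \<noteq> 0 \<Longrightarrow> Lw w (\<lambda>x. \<Sum>i\<in>I. f i x) x = (\<Sum>i\<in>I. Lw w (f i) x)"
  by (induction I rule: infinite_finite_induct) (auto simp: Lw_add smooth_sdiff smooth_sum)

lemma Lw_direction: 
  assumes "sdiff f" "x \<noteq> 0"
  shows "Lw (a *\<^sub>R v + b *\<^sub>R w) f x = a *\<^sub>R Lw v f x + b *\<^sub>R Lw w f x"
proof -
  have "linear (frechet_derivative (f \<circ> radial) (at x))"
    using sdiff_deriv[OF assms] has_derivative_linear by blast
  from linear_add[OF this] linear_scale[OF this] show ?thesis
    by (simp add: Lw_def cross_add_left cross_mult_left)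
qed

text \<open>\<open>f \<circ> radial\<close> is constant along rays, so its derivative is homogeneous of degree \<open>-1\<close>.\<close>

lemma Lw_radial:
  assumes f: "sdiff f" and x: "x \<noteq> 0"
  shows "Lw w f (radial x) = Lw w f x"
proof -
  define c where "c = inverse (norm x)"
  have c: "c > 0" using x by (simp add: c_def)
  have r: "radial x = c *\<^sub>R x" by (simp add: radial_def c_def)
  have "((f \<circ> radial) has_derivative frechet_derivative (f \<circ> radial) (at (c *\<^sub>R x))) (at (c *\<^sub>R x))"
    using sdiff_deriv[OF f] x c by auto
  moreover have "((\<lambda>y. c *\<^sub>R y) has_derivative (\<lambda>v. c *\<^sub>R v)) (at x)" by (auto intro!: derivative_eq_intros)
  ultimately have "((\<lambda>y. (f \<circ> radial) (c *\<^sub>R y)) has_derivative (\<lambda>v. frechet_derivative (f \<circ> radial) (at (c *\<^sub>R x)) (c *\<^sub>R v))) (at x)"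
    using diff_chain_at[of "\<lambda>y. c *\<^sub>R y" _ x "f \<circ> radial"] by (simp add: o_def)
  also have "(\<lambda>y. (f \<circ> radial) (c *\<^sub>R y)) = f \<circ> radial" using c by (auto simp: radial_scaleR)
  finally have "frechet_derivative (f \<circ> radial) (at x) = (\<lambda>v. frechet_derivative (f \<circ> radial) (at (c *\<^sub>R x)) (c *\<^sub>R v))"
    by (rule frechet_eqI)
  thus ?thesis by (simp add: Lw_def r cross_mult_right)
qed

text \<open>By \<open>Lw_radial\<close>, \<open>Lw w f\<close> is already constant along rays off
  the origin. Its radial extension is therefore a sum of partial derivatives of
  \<open>f \<circ> radial\<close> with linear coefficients.\<close>

lemma smooth_Lw:
  assumes "smooth_on_S2 f" shows "smooth_on_S2 (Lw w f)"
  unfolding smooth_on_S2_def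
proof
  fix k
  have sd: "sdiff f" by (rule smooth_sdiff[OF assms])
  have D: "Ck_on k punctured (\<lambda>x. frechet_derivative (f \<circ> radial) (at x) v)" for v
    using assms unfolding smooth_on_S2_def by (metis Ck_on.simps(2))
  have lin: "frechet_derivative (f \<circ> radial) (at x) v = (\<Sum>i\<in>UNIV. (v $ i) *\<^sub>R frechet_derivative (f \<circ> radial) (at x) (axis i 1))"
    if "x \<noteq> 0" for x v
  proof -
    have l: "linear (frechet_derivative (f \<circ> radial) (at x))"
      using sdiff_deriv[OF sd that] has_derivative_linear by blast
    have "v = (\<Sum>i\<in>UNIV. (v $ i) *\<^sub>R axis i 1)"
      using basis_expansion[of v] by (simp add: scalar_mult_eq_scaleR)
    hence "frechet_derivative (f \<circ> radial) (at x) v = frechet_derivative (f \<circ> radial) (at x) (\<Sum>i\<in>UNIV. (v $ i) *\<^sub>R axis i 1)"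
      by simp
    also have "\<dots> = (\<Sum>i\<in>UNIV. (v $ i) *\<^sub>R frechet_derivative (f \<circ> radial) (at x) (axis i 1))"
      by (simp only: linear_sum[OF l] linear_scale[OF l])
    finally show ?thesis .
  qed
  have "Ck_on k punctured (Lw w f \<circ> radial) = Ck_on k punctured
      (\<lambda>x. \<Sum>i\<in>UNIV. (cross3 w x $ i) *\<^sub>R frechet_derivative (f \<circ> radial) (at x) (axis i 1))"
  proof (rule Ck_on_cong[OF open_punctured])
    fix x :: "real^3" assume "x \<in> punctured"
    hence x: "x \<noteq> 0" by simp
    have "(Lw w f \<circ> radial) x = Lw w f x" using Lw_radial[OF sd x] by simp
    also have "\<dots> = (\<Sum>i\<in>UNIV. (cross3 w x $ i) *\<^sub>R frechet_derivative (f \<circ> radial) (at x) (axis i 1))"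
      unfolding Lw_def by (rule lin[OF x])
    finally show "(Lw w f \<circ> radial) x = (\<Sum>i\<in>UNIV. (cross3 w x $ i) *\<^sub>R frechet_derivative (f \<circ> radial) (at x) (axis i 1))" .
  qed
  also have "\<dots>" unfolding sum_3
    by (intro Ck_on_add Ck_on_bilinear[OF bounded_bilinear_scaleR open_punctured] open_punctured D
      Ck_on_linear[OF bounded_linear_vec_nth] Ck_on_bilinear[OF bounded_bilinear_cross3 open_punctured] Ck_on_const Ck_on_ident)
  finally show "Ck_on k punctured (Lw w f \<circ> radial)" .
qed

section \<open>Rotation invariance of the surface measure\<close>

lemma finite_measure_surface: "finite_measure surface"
  by (rule finite_measureI) (simp add: space_surface emeasure_surface_total)

lemma measure_surface: "measure surface S2 = 4 * pi"
  by (simp add: measure_def emeasure_surface_total)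

lemma borel_measurable_surface: "f \<in> borel_measurable borel \<Longrightarrow> f \<in> borel_measurable surface"
  by (simp add: measurable_cong_sets[OF sets_surface refl] measurable_restrict_space1)

lemma continuous_on_surface:
  fixes f :: "real^3 \<Rightarrow> 'b::topological_space"
  shows "continuous_on S2 f \<Longrightarrow> f \<in> borel_measurable surface"
  by (simp add: measurable_cong_sets[OF sets_surface refl] borel_measurable_continuous_on_restrict)

lemma continuous_on_S2_bounded:
  fixes f :: "real^3 \<Rightarrow> 'b::real_normed_vector"
  assumes "continuous_on S2 f" obtains B where "B > 0" "\<And>x. x \<in> S2 \<Longrightarrow> norm (f x) \<le> B"
proof -
  have "bounded (f ` S2)" using assms by (intro compact_imp_bounded compact_continuous_image) auto
  thus ?thesis using that unfolding bounded_pos by (metis imageI)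
qed

lemma sqi_continuous:
  fixes f :: "real^3 \<Rightarrow> 'b::euclidean_space"
  assumes "continuous_on S2 f" shows "sqi surface f"
proof -
  obtain B where "\<And>x. x \<in> S2 \<Longrightarrow> norm (f x) \<le> B" using continuous_on_S2_bounded[OF assms] by metis
  thus ?thesis
    by (intro sqi_finite_bounded[where B = B] finite_measure_surface continuous_on_surface assms) (auto simp: space_surface)
qed

lemma integrable_continuous_surface:
  fixes f :: "real^3 \<Rightarrow> 'b::euclidean_space"
  assumes "continuous_on S2 f" shows "integrable surface f"
proof -
  interpret finite_measure surface by (rule finite_measure_surface)
  obtain B where "\<And>x. x \<in> S2 \<Longrightarrow> norm (f x) \<le> B" using continuous_on_S2_bounded[OF assms] by metis
  thus ?thesis
    by (intro integrable_const_bound[where B = B] continuous_on_surface assms) (auto simp: space_surface)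
qed

lemma cone_borel:
  assumes "A \<in> sets surface"
  shows "{x \<in> ball 0 1 - {0}. radial x \<in> A} \<in> sets borel"
proof -
  have "radial -` A \<inter> space (restrict_space lborel (ball 0 1 - {0})) \<in> sets (restrict_space lborel (ball 0 1 - {0}))"
    by (rule measurable_sets[OF radial_measurable]) (use assms in \<open>simp only: sets_surface\<close>)
  hence "radial -` A \<inter> (ball 0 1 - {0}) \<in> sets lborel"
    by (simp add: space_restrict_space sets_restrict_space_iff)
  also have "radial -` A \<inter> (ball 0 1 - {0}) = {x \<in> ball 0 1 - {0}. radial x \<in> A}" by auto
  finally show ?thesis by simp
qed

lemma emeasure_surface:
  assumes "A \<in> sets surface"
  shows "emeasure surface A = 3 * emeasure lborel {x \<in> ball 0 1 - {0}. radial x \<in> A}"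
proof -
  let ?R = "restrict_space lborel (ball (0::real^3) 1 - {0})"
  have "emeasure surface A = 3 * emeasure ?R (radial -` A \<inter> space ?R)"
    using assms by (simp add: surface_def emeasure_distr[OF radial_measurable] sets_surface[unfolded surface_def])
  also have "radial -` A \<inter> space ?R = {x \<in> ball 0 1 - {0}. radial x \<in> A}"
    by (auto simp: space_restrict_space)
  also have "emeasure ?R \<dots> = emeasure lborel \<dots>"
    by (subst emeasure_restrict_space) auto
  finally show ?thesis .
qed

lemma emeasure_lborel_orthogonal_vimage:
  fixes R :: "real^3 \<Rightarrow> real^3"
  assumes R: "orthogonal_transformation R" and C: "C \<in> sets borel" "bounded C"
  shows "emeasure lborel (R -` C) = emeasure lborel C"
proof -
  have bij: "bij R" using R by (rule orthogonal_transformation_bij)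
  have inv: "orthogonal_transformation (inv R)" using R by (rule orthogonal_transformation_inv)
  have eq: "R -` C = inv R ` C" using bij by (simp add: bij_vimage_eq_inv_image)
  have m: "R -` C \<in> sets borel"
    using measurable_sets[OF borel_measurable_continuous_onI[OF linear_continuous_on[OF linear_conv_bounded_linear[THEN iffD1]]] C(1), of R]
      orthogonal_transformation_linear[OF R] by simp
  have bd: "bounded (R -` C)"
    unfolding eq by (intro bounded_linear_image C linear_conv_bounded_linear[THEN iffD1] orthogonal_transformation_linear inv)
  have Cm: "C \<in> lmeasurable" using C by (simp add: bounded_set_imp_lmeasurable)
  have "measure lebesgue (R -` C) = measure lebesgue C"
    unfolding eq by (rule measure_orthogonal_image[OF inv Cm])
  hence "measure lborel (R -` C) = measure lborel C"
    using m C by (simp add: measure_completion)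
  thus ?thesis
    using emeasure_bounded_finite[OF bd] emeasure_bounded_finite[OF C(2)]
      emeasure_eq_ennreal_measure[of lborel C] emeasure_eq_ennreal_measure[of lborel "R -` C"]
    by (simp add: less_top)
qed

text \<open>Orthogonal maps commute with \<open>radial\<close>, so the cone over a preimage is the
  preimage of the cone, and Lebesgue measure is invariant under them.\<close>

lemma surface_rotation_invariant:
  fixes R :: "real^3 \<Rightarrow> real^3"
  assumes R: "orthogonal_transformation R"
  shows "R \<in> surface \<rightarrow>\<^sub>M surface" "distr surface surface R = surface"
proof -
  have nR: "norm (R x) = norm x" for x using R by (simp add: orthogonal_transformation_norm)
  have lin: "linear R" using R by (rule orthogonal_transformation_linear)
  have cR: "continuous_on UNIV R" using lin by (simp add: linear_continuous_on linear_conv_bounded_linear)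
  show m: "R \<in> surface \<rightarrow>\<^sub>M surface"
    unfolding measurable_cong_sets[OF sets_surface sets_surface]
    by (intro measurable_restrict_space2 measurable_restrict_space1 borel_measurable_continuous_onI cR)
       (auto simp: space_restrict_space nR)
  show "distr surface surface R = surface"
  proof (rule measure_eqI)
    fix A assume "A \<in> sets (distr surface surface R)"
    hence A: "A \<in> sets surface" by simp
    have Rr: "radial (R x) = R (radial x)" for x
      using linear_scale[OF lin] by (simp add: radial_def nR)
    have A': "R -` A \<inter> space surface \<in> sets surface" using m A by (rule measurable_sets)
    have "emeasure (distr surface surface R) A = emeasure surface (R -` A \<inter> space surface)"
      by (rule emeasure_distr[OF m A])
    also have "\<dots> = 3 * emeasure lborel {x \<in> ball 0 1 - {0}. radial x \<in> R -` A \<inter> space surface}"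
      by (rule emeasure_surface[OF A'])
    also have "{x \<in> ball 0 1 - {0}. radial x \<in> R -` A \<inter> space surface} = R -` {x \<in> ball 0 1 - {0}. radial x \<in> A}"
      using radial_in_S2 by (auto simp: space_surface Rr nR) (metis nR norm_eq_zero)+
    also have "emeasure lborel \<dots> = emeasure lborel {x \<in> ball 0 1 - {0}. radial x \<in> A}"
      by (rule emeasure_lborel_orthogonal_vimage[OF R cone_borel[OF A]]) (rule bounded_subset[OF bounded_ball[of 0 1]], auto)
    also have "3 * \<dots> = emeasure surface A" by (rule emeasure_surface[OF A, symmetric])
    finally show "emeasure (distr surface surface R) A = emeasure surface A" .
  qed simp
qed

lemma integral_surface_rotation:
  fixes R :: "real^3 \<Rightarrow> real^3" and f :: "real^3 \<Rightarrow> real"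
  assumes R: "orthogonal_transformation R" and f: "f \<in> borel_measurable surface"
  shows "(LINT x|surface. f (R x)) = (LINT x|surface. f x)"
  using integral_distr[OF surface_rotation_invariant(1)[OF R] f] surface_rotation_invariant(2)[OF R] by simp

text \<open>Rodrigues' formula for the rotation by the angle \<open>t\<close> about the unit vector
  \<open>w\<close>; its orbits are the integral curves of the Killing field of
  \<open>Lw w\<close>.\<close>

definition axis_rotation :: "real^3 \<Rightarrow> real \<Rightarrow> real^3 \<Rightarrow> real^3" where
  "axis_rotation w t x = ((w \<bullet> x) * (1 - cos t)) *\<^sub>R w + cos t *\<^sub>R x + sin t *\<^sub>R cross3 w x"

lemma norm_axis_rotation:
  assumes w: "norm w = 1"
  shows "norm (axis_rotation w t x) = norm x"
proof -
  define a where "a = w \<bullet> x"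
  have ww: "w \<bullet> w = 1" using w by (simp add: dot_square_norm)
  have b: "cross3 w x \<bullet> cross3 w x = x \<bullet> x - a\<^sup>2"
    using norm_cross_dot[of w x] w by (simp add: a_def power2_norm_eq_inner algebra_simps)
  have s: "sin t * sin t = 1 - cos t * cos t" using sin_cos_squared_add[of t] by (simp add: power2_eq_square)
  have "axis_rotation w t x \<bullet> axis_rotation w t x =
    (a * (1 - cos t))\<^sup>2 + (cos t)\<^sup>2 * (x \<bullet> x) + sin t * sin t * (x \<bullet> x - a\<^sup>2) + 2 * (a * (1 - cos t)) * cos t * a"
    unfolding b[symmetric]
    by (simp add: axis_rotation_def inner_add_left inner_add_right dot_cross_self ww a_def[symmetric]
        inner_commute[of x w] power2_eq_square algebra_simps)
  also have "\<dots> = x \<bullet> x"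
    unfolding s by (simp add: power2_eq_square algebra_simps)
  finally show ?thesis by (simp add: norm_eq_sqrt_inner)
qed

lemma orthogonal_axis_rotation:
  assumes w: "norm w = 1"
  shows "orthogonal_transformation (axis_rotation w t)"
  unfolding orthogonal_transformation
proof
  show "linear (axis_rotation w t)"
    by (rule linearI)
       (simp_all add: axis_rotation_def inner_add_right cross_add_right cross_mult_right algebra_simps scaleR_add_left[symmetric] del: scaleR_add_left)
qed (simp add: norm_axis_rotation[OF w])

lemma has_derivative_axis_rotation:
  assumes w: "norm w = 1"
  shows "((\<lambda>t. axis_rotation w t x) has_vector_derivative cross3 w (axis_rotation w t x)) (at t)"
proof -
  have ww: "w \<bullet> w = 1" using w by (simp add: dot_square_norm)
  have "((\<lambda>t. axis_rotation w t x) has_vector_derivative (((w \<bullet> x) * sin t) *\<^sub>R w - sin t *\<^sub>R x + cos t *\<^sub>R cross3 w x)) (at t)"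
    unfolding axis_rotation_def
    by (rule derivative_eq_intros refl | simp)+
  also have "((w \<bullet> x) * sin t) *\<^sub>R w - sin t *\<^sub>R x + cos t *\<^sub>R cross3 w x = cross3 w (axis_rotation w t x)"
    by (simp add: axis_rotation_def cross_add_right cross_mult_right Cross3.right_diff_distrib Lagrange ww algebra_simps)
  finally show ?thesis .
qed

text \<open>Rotation invariance gives integral zero to every difference quotient of \<open>f\<close>
  along the flow, and these quotients converge to \<open>Lw w f\<close>.\<close>

lemma integral_Lw:
  fixes f :: "real^3 \<Rightarrow> real"
  assumes f: "smooth_on_S2 f" and w: "norm w = 1"
  shows "(LINT x|surface. Lw w f x) = 0"
proof -
  interpret finite_measure surface by (rule finite_measure_surface)
  let ?R = "axis_rotation w"
  have cL: "continuous_on S2 (Lw w f)" by (rule smooth_continuous_on[OF smooth_Lw[OF f]])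
  have cf: "continuous_on S2 f" by (rule smooth_continuous_on[OF f])
  obtain B where B: "\<And>x. x \<in> S2 \<Longrightarrow> norm (Lw w f x) \<le> B" using continuous_on_S2_bounded[OF cL] by metis
  have RS: "?R t x \<in> S2" if "x \<in> S2" for t x using that by (simp add: norm_axis_rotation[OF w])
  have der: "((\<lambda>t. f (?R t x)) has_real_derivative Lw w f (?R t x)) (at t)" if x: "x \<in> S2" for x t
  proof -
    have "?R t x \<noteq> 0" using S2_nonzero[OF RS[OF x]] .
    have "((f \<circ> radial) has_derivative frechet_derivative (f \<circ> radial) (at (?R t x))) (at (?R t x))"
      by (rule sdiff_deriv[OF smooth_sdiff[OF f] \<open>?R t x \<noteq> 0\<close>])
    from vector_derivative_diff_chain_within[OF has_derivative_axis_rotation[OF w, of x t] has_derivative_at_withinI[OF this]]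
    have "(((f \<circ> radial) \<circ> (\<lambda>t. ?R t x)) has_vector_derivative Lw w f (?R t x)) (at t)"
      by (simp add: Lw_def o_def)
    also have "(f \<circ> radial) \<circ> (\<lambda>t. ?R t x) = (\<lambda>t. f (?R t x))"
      using x by (auto simp: norm_axis_rotation[OF w])
    finally show ?thesis by (simp add: has_real_derivative_iff_has_vector_derivative)
  qed
  define s where "s k x = (f (?R (1 / real (Suc k)) x) - f x) * real (Suc k)" for k :: nat and x
  have sm: "s k \<in> borel_measurable surface" for k
    unfolding s_def
    by (intro borel_measurable_times borel_measurable_diff continuous_on_surface cf borel_measurable_const
        measurable_compose[OF surface_rotation_invariant(1)[OF orthogonal_axis_rotation[OF w]]])
  have s0: "(LINT x|surface. s k x) = 0" for k
  proof -
    have m: "(\<lambda>x. f (?R (1 / real (Suc k)) x)) \<in> borel_measurable surface"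
      by (intro measurable_compose[OF surface_rotation_invariant(1)[OF orthogonal_axis_rotation[OF w]]] continuous_on_surface cf)
    obtain C where C: "\<And>x. x \<in> S2 \<Longrightarrow> norm (f x) \<le> C" using continuous_on_S2_bounded[OF cf] by metis
    have "integrable surface (\<lambda>x. f (?R (1 / real (Suc k)) x))"
      using m C RS by (intro integrable_const_bound[where B = C]) (auto simp: space_surface simp del: mem_sphere)
    thus ?thesis
      using integrable_continuous_surface[OF cf] integral_surface_rotation[OF orthogonal_axis_rotation[OF w] continuous_on_surface[OF cf]]
      by (simp add: s_def del: of_nat_Suc)
  qed
  have "(\<lambda>k. LINT x|surface. s k x) \<longlonglongrightarrow> (LINT x|surface. Lw w f x)"
  proof (rule integral_dominated_convergence[where w = "\<lambda>_. B"])
    show "AE x in surface. (\<lambda>k. s k x) \<longlonglongrightarrow> Lw w f x"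
    proof (rule AE_I2)
      fix x assume "x \<in> space surface"
      hence x: "x \<in> S2" by (simp only: space_surface)
      have R0: "?R 0 x = x" by (simp add: axis_rotation_def)
      from der[OF x, of 0] have "((\<lambda>t. (f (?R t x) - f x) / t) \<longlongrightarrow> Lw w f x) (at 0)"
        by (simp add: R0 has_field_derivative_iff)
      hence "((\<lambda>t. (f (?R t x) - f x) / t) \<circ> (\<lambda>k. 1 / real (Suc k))) \<longlonglongrightarrow> Lw w f x"
        by (rule tendsto_at_iff_sequentially[THEN iffD1, rule_format]) (use LIMSEQ_inverse_real_of_nat in \<open>auto simp: inverse_eq_divide\<close>)
      thus "(\<lambda>k. s k x) \<longlonglongrightarrow> Lw w f x" by (simp add: o_def s_def del: of_nat_Suc)
    qed
    show "AE x in surface. norm (s k x) \<le> B" for k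
    proof (rule AE_I2)
      fix x assume "x \<in> space surface"
      hence x: "x \<in> S2" by (simp only: space_surface)
      have R0: "?R 0 x = x" by (simp add: axis_rotation_def)
      \<comment> \<open>The mean value theorem identifies the quotient with a value of
        \<open>Lw w f\<close> at a rotated point, so one constant dominates all quotients.\<close>
      have "\<exists>z>0. z < 1 / real (Suc k) \<and> f (?R (1 / real (Suc k)) x) - f (?R 0 x) = (1 / real (Suc k) - 0) * Lw w f (?R z x)"
        by (rule MVT2) (auto intro: der x simp del: mem_sphere)
      then obtain z where "f (?R (1 / real (Suc k)) x) - f x = (1 / real (Suc k)) * Lw w f (?R z x)" by (auto simp: R0)
      hence "s k x = Lw w f (?R z x)" by (simp add: s_def del: of_nat_Suc)
      thus "norm (s k x) \<le> B" using B[OF RS[OF x]] by simp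
    qed
  qed (auto intro: continuous_on_surface cL sm)
  thus ?thesis by (simp add: s0 LIMSEQ_const_iff)
qed


section \<open>Density of polynomials\<close>

definition poly_approx :: "(real^3 \<Rightarrow> real) \<Rightarrow> bool" where
  "poly_approx f \<longleftrightarrow> (\<forall>e>0. \<exists>p. real_polynomial_function p \<and> (LINT x|surface. (f x - p x)\<^sup>2) < e)"

lemma sqi_real_iff: "sqi M (f :: 'a \<Rightarrow> real) \<longleftrightarrow> f \<in> borel_measurable M \<and> integrable M (\<lambda>x. (f x)\<^sup>2)"
  by (simp add: sqi_def)

lemma sqi_poly: "real_polynomial_function p \<Longrightarrow> sqi surface p"
  by (intro sqi_continuous continuous_at_imp_continuous_on ballI continuous_real_polymonial_function)

lemma integral_sum_squares_le:
  fixes f g :: "'a \<Rightarrow> real"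
  assumes "sqi M f" "sqi M g"
  shows "(LINT x|M. (f x + g x)\<^sup>2) \<le> 2 * (LINT x|M. (f x)\<^sup>2) + 2 * (LINT x|M. (g x)\<^sup>2)"
proof -
  have "(LINT x|M. (f x + g x)\<^sup>2) \<le> (LINT x|M. 2 * (f x)\<^sup>2 + 2 * (g x)\<^sup>2)"
  proof (rule integral_mono)
    show "integrable M (\<lambda>x. (f x + g x)\<^sup>2)" using sqi_add[OF assms] by (simp add: sqi_real_iff)
    show "integrable M (\<lambda>x. 2 * (f x)\<^sup>2 + 2 * (g x)\<^sup>2)" using assms by (simp add: sqi_real_iff)
    show "(f x + g x)\<^sup>2 \<le> 2 * (f x)\<^sup>2 + 2 * (g x)\<^sup>2" for x
      using zero_le_power2[of "f x - g x"] by (simp add: power2_eq_square algebra_simps)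
  qed
  also have "\<dots> = 2 * (LINT x|M. (f x)\<^sup>2) + 2 * (LINT x|M. (g x)\<^sup>2)"
    using assms by (simp add: sqi_real_iff)
  finally show ?thesis .
qed

lemma poly_approx_limit:
  assumes f: "sqi surface f" and F: "\<And>e. e > 0 \<Longrightarrow> \<exists>g. sqi surface g \<and> poly_approx g \<and> (LINT x|surface. (f x - g x)\<^sup>2) < e"
  shows "poly_approx f"
  unfolding poly_approx_def
proof (intro allI impI)
  fix e :: real assume e: "e > 0"
  obtain g where g: "sqi surface g" "poly_approx g" "(LINT x|surface. (f x - g x)\<^sup>2) < e/4" using F[of "e/4"] e by auto
  obtain p where p: "real_polynomial_function p" "(LINT x|surface. (g x - p x)\<^sup>2) < e/4"
    using g(2) e unfolding poly_approx_def by (meson divide_pos_pos zero_less_numeral)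
  have "(LINT x|surface. ((f x - g x) + (g x - p x))\<^sup>2) \<le> 2 * (LINT x|surface. (f x - g x)\<^sup>2) + 2 * (LINT x|surface. (g x - p x)\<^sup>2)"
    by (intro integral_sum_squares_le sqi_diff f g sqi_poly p)
  also have "\<dots> < e" using g(3) p(2) by simp
  finally show "\<exists>p. real_polynomial_function p \<and> (LINT x|surface. (f x - p x)\<^sup>2) < e" using p(1) by auto
qed

lemma poly_approx_add:
  assumes "sqi surface f" "sqi surface g" "poly_approx f" "poly_approx g"
  shows "poly_approx (\<lambda>x. f x + g x)"
  unfolding poly_approx_def
proof (intro allI impI)
  fix e :: real assume e: "e > 0"
  hence e4: "e/4 > 0" by simp
  obtain p where p: "real_polynomial_function p" "(LINT x|surface. (f x - p x)\<^sup>2) < e/4"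
    using assms(3) e4 unfolding poly_approx_def by blast
  obtain q where q: "real_polynomial_function q" "(LINT x|surface. (g x - q x)\<^sup>2) < e/4"
    using assms(4) e4 unfolding poly_approx_def by blast
  have "(LINT x|surface. ((f x - p x) + (g x - q x))\<^sup>2) \<le> 2 * (LINT x|surface. (f x - p x)\<^sup>2) + 2 * (LINT x|surface. (g x - q x)\<^sup>2)"
    by (intro integral_sum_squares_le sqi_diff assms sqi_poly p q)
  also have "\<dots> < e" using q(2) p(2) by simp
  finally have "(LINT x|surface. (f x + g x - (p x + q x))\<^sup>2) < e" by (simp add: algebra_simps)
  thus "\<exists>p. real_polynomial_function p \<and> (LINT x|surface. (f x + g x - p x)\<^sup>2) < e"
    using real_polynomial_function.intros(3)[OF p(1) q(1)] by blast
qed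

lemma poly_approx_continuous:
  assumes "continuous_on S2 f" shows "poly_approx f"
  unfolding poly_approx_def
proof (intro allI impI)
  fix e :: real assume e: "e > 0"
  interpret finite_measure surface by (rule finite_measure_surface)
  \<comment> \<open>Chosen so that d^2 times the total area 4 pi equals e/2.\<close>
  define d where "d = sqrt (e / (8 * pi))"
  have d: "d > 0" using e by (simp add: d_def)
  obtain p where p: "polynomial_function p" "\<And>x. x \<in> S2 \<Longrightarrow> norm (f x - p x) < d"
    using Stone_Weierstrass_polynomial_function[OF _ assms d] by auto
  have rp: "real_polynomial_function p" using p(1) by (simp add: real_polynomial_function_eq)
  have "(LINT x|surface. (f x - p x)\<^sup>2) \<le> (LINT x|surface. d\<^sup>2)"
  proof (rule integral_mono)
    show "integrable surface (\<lambda>x. (f x - p x)\<^sup>2)"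
      using sqi_diff[OF sqi_continuous[OF assms] sqi_poly[OF rp]] by (simp add: sqi_real_iff)
    fix x assume "x \<in> space surface"
    hence "\<bar>f x - p x\<bar> \<le> d" using p(2) by (force simp: space_surface)
    hence "\<bar>f x - p x\<bar>\<^sup>2 \<le> d\<^sup>2" by (intro power_mono) auto
    thus "(f x - p x)\<^sup>2 \<le> d\<^sup>2" by simp
  qed simp
  also have "\<dots> = 4 * pi * d\<^sup>2" by (simp add: space_surface measure_surface)
  also have "\<dots> = e / 2" using e by (simp add: d_def)
  also have "\<dots> < e" using e by simp
  finally show "\<exists>p. real_polynomial_function p \<and> (LINT x|surface. (f x - p x)\<^sup>2) < e" using rp by blast
qed

lemma poly_approx_cong: 
  assumes "\<And>x. x \<in> S2 \<Longrightarrow> f x = g x" "poly_approx f" shows "poly_approx g"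
proof -
  have "(LINT x|surface. (f x - p x)\<^sup>2) = (LINT x|surface. (g x - p x)\<^sup>2)" for p
    using assms(1) by (intro Bochner_Integration.integral_cong) (auto simp only: space_surface)
  thus ?thesis using assms(2) by (simp add: poly_approx_def)
qed

lemma poly_approx_scale:
  assumes "poly_approx f" shows "poly_approx (\<lambda>x. c * f x)"
proof (cases "c = 0")
  case True
  thus ?thesis by (simp add: poly_approx_continuous)
next
  case False
  show ?thesis unfolding poly_approx_def
  proof (intro allI impI)
    fix e :: real assume "e > 0"
    hence "e / c\<^sup>2 > 0" using False by simp
    then obtain p where p: "real_polynomial_function p" "(LINT x|surface. (f x - p x)\<^sup>2) < e / c\<^sup>2"
      using assms unfolding poly_approx_def by blast
    have "(LINT x|surface. (c * f x - c * p x)\<^sup>2) = c\<^sup>2 * (LINT x|surface. (f x - p x)\<^sup>2)"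
      by (simp add: power_mult_distrib flip: right_diff_distrib)
    also have "\<dots> < e" using p(2) False by (simp add: field_simps)
    finally show "\<exists>p. real_polynomial_function p \<and> (LINT x|surface. (c * f x - p x)\<^sup>2) < e"
      using real_polynomial_function.intros(4)[OF real_polynomial_function.intros(2) p(1), of c] by blast
  qed
qed

text \<open>Used for the passage from continuous functions to closed sets, from finite to countable
  unions, and from simple functions to square integrable ones.\<close>

lemma poly_approx_dominated:
  fixes f :: "real^3 \<Rightarrow> real"
  assumes f: "sqi surface f" and s: "\<And>k. sqi surface (s k)" "\<And>k. poly_approx (s k)"
    and lim: "\<And>x. x \<in> S2 \<Longrightarrow> (\<lambda>k. s k x) \<longlonglongrightarrow> f x"
    and g: "integrable surface g" and dom: "\<And>k x. x \<in> S2 \<Longrightarrow> (f x - s k x)\<^sup>2 \<le> g x"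
  shows "poly_approx f"
proof (rule poly_approx_limit[OF f])
  have "(\<lambda>k. LINT x|surface. (f x - s k x)\<^sup>2) \<longlonglongrightarrow> (LINT x|surface. 0)"
  proof (rule integral_dominated_convergence[OF _ _ g])
    show "(\<lambda>x. (f x - s k x)\<^sup>2) \<in> borel_measurable surface" for k
      using sqi_diff[OF f s(1), of k] by (auto simp: sqi_real_iff)
    show "AE x in surface. (\<lambda>k. (f x - s k x)\<^sup>2) \<longlonglongrightarrow> 0"
    proof (rule AE_I2)
      fix x assume "x \<in> space surface"
      hence "(\<lambda>k. (f x - s k x)\<^sup>2) \<longlonglongrightarrow> (f x - f x)\<^sup>2"
        using lim[of x] by (intro tendsto_intros) (simp add: space_surface)
      thus "(\<lambda>k. (f x - s k x)\<^sup>2) \<longlonglongrightarrow> 0" by simp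
    qed
    show "AE x in surface. norm ((f x - s k x)\<^sup>2) \<le> g x" for k
      using dom by (intro AE_I2) (simp add: space_surface)
  qed auto
  hence l: "(\<lambda>k. LINT x|surface. (f x - s k x)\<^sup>2) \<longlonglongrightarrow> 0" by simp
  fix e :: real assume "e > 0"
  from order_tendstoD(2)[OF l this] obtain k where "(LINT x|surface. (f x - s k x)\<^sup>2) < e"
    by (auto simp: eventually_sequentially)
  thus "\<exists>g. sqi surface g \<and> poly_approx g \<and> (LINT x|surface. (f x - g x)\<^sup>2) < e" using s by blast
qed

lemma sqi_indicator: "A \<in> sets borel \<Longrightarrow> sqi surface (indicat_real A)"
  by (intro sqi_finite_bounded[where B = 1] finite_measure_surface borel_measurable_surface) (auto simp: indicator_def)

text \<open>The sets with approximable indicator form a Dynkin system, and the closed sets are an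
  intersection-stable generator of the Borel sets, so only closed sets call for a direct
  construction.\<close>

lemma poly_approx_indicator:
  assumes "A \<in> sets borel" shows "poly_approx (indicat_real A)"
proof -
  interpret finite_measure surface by (rule finite_measure_surface)
  have "A \<in> sigma_sets UNIV {S::(real^3) set. closed S}"
    using assms by (simp add: borel_eq_closed sets_measure_of)
  thus ?thesis
  proof (rule sigma_sets_induct_disjoint[rotated 2])
    show "{S::(real^3) set. closed S} \<subseteq> Pow UNIV" by simp
    show "Int_stable {S::(real^3) set. closed S}" by (auto simp: Int_stable_def)
  next
    fix C :: "(real^3) set" assume "C \<in> {S. closed S}"
    hence C: "closed C" by simp
    show "poly_approx (indicat_real C)"
    proof (cases "C = {}")
      case True
      thus ?thesis by (simp add: poly_approx_continuous)
    next
      case False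
      \<comment> \<open>Continuous functions with values in [0, 1] that decrease to the indicator of
        \<open>C\<close>: a point outside the closed set has positive distance from it.\<close>
      define s where "s k x = max 0 (1 - real k * infdist x C)" for k x
      have cont: "continuous_on S2 (s k)" for k
        unfolding s_def by (intro continuous_intros)
      show ?thesis
      proof (rule poly_approx_dominated[where s = s and g = "\<lambda>_. 1"])
        show "sqi surface (indicat_real C)" using C by (intro sqi_indicator) simp
        show "sqi surface (s k)" "poly_approx (s k)" for k
          using cont by (auto intro: sqi_continuous poly_approx_continuous)
        fix x
        show "(\<lambda>k. s k x) \<longlonglongrightarrow> indicat_real C x"
        proof (cases "x \<in> C")
          case True
          hence "infdist x C = 0" by simp
          thus ?thesis using True by (simp add: s_def)
        next
          case F: False
          hence i: "infdist x C > 0" using in_closed_iff_infdist_zero[OF C False, of x] infdist_nonneg[of x C] by linarith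
          have "\<forall>\<^sub>F k in sequentially. real k * infdist x C > 1"
          proof -
            obtain n where "real n > 1 / infdist x C" using reals_Archimedean2 by blast
            have "real k * infdist x C > 1" if "k \<ge> n" for k
            proof -
              have "1 / infdist x C < real k" using \<open>real n > 1 / infdist x C\<close> that by (meson less_le_trans of_nat_le_iff)
              thus ?thesis using i by (simp add: field_simps)
            qed
            thus ?thesis using eventually_sequentially by blast
          qed
          hence "\<forall>\<^sub>F k in sequentially. s k x = 0" by eventually_elim (simp add: s_def)
          thus ?thesis using F by (simp add: tendsto_eventually)
        qed
        fix k
        have "0 \<le> real k * infdist x C" by (simp add: infdist_nonneg)
        hence "\<bar>indicat_real C x - s k x\<bar> \<le> 1" by (auto simp: s_def indicator_def)
        hence "\<bar>indicat_real C x - s k x\<bar>\<^sup>2 \<le> 1\<^sup>2" by (intro power_mono) auto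
        thus "(indicat_real C x - s k x)\<^sup>2 \<le> 1" by simp
      qed simp
    qed
  next
    show "poly_approx (indicat_real {})" by (simp add: poly_approx_continuous)
  next
    fix A :: "(real^3) set" assume A: "A \<in> sigma_sets UNIV {S. closed S}" and pa: "poly_approx (indicat_real A)"
    have "A \<in> sets borel" using A by (simp add: borel_eq_closed sets_measure_of)
    hence "poly_approx (\<lambda>x. 1 + (-1) * indicat_real A x)"
      using sqi_scaleR[OF sqi_indicator, of A "-1"] sqi_continuous[of "\<lambda>_. 1::real"]
      by (intro poly_approx_add poly_approx_scale pa poly_approx_continuous) auto
    moreover have "(\<lambda>x. 1 + (-1) * indicat_real A x) = indicat_real (UNIV - A)" by (auto simp: indicator_def fun_eq_iff)
    ultimately show "poly_approx (indicat_real (UNIV - A))" by simp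
  next
    fix A :: "nat \<Rightarrow> (real^3) set" assume disj: "disjoint_family A" and A: "range A \<subseteq> sigma_sets UNIV {S. closed S}"
      and pa: "\<And>i. poly_approx (indicat_real (A i))"
    have Ab: "A i \<in> sets borel" for i using A by (auto simp: borel_eq_closed sets_measure_of)
    define s where "s k x = (\<Sum>i<k. indicat_real (A i) x)" for k x
    have s: "sqi surface (s k) \<and> poly_approx (s k)" for k
    proof (induction k)
      case 0 thus ?case by (simp add: s_def[abs_def] poly_approx_continuous sqi_zero)
    next
      case (Suc k)
      have "s (Suc k) = (\<lambda>x. s k x + indicat_real (A k) x)" by (simp add: s_def fun_eq_iff)
      thus ?case using Suc Ab by (auto intro: sqi_add poly_approx_add sqi_indicator pa)
    qed
    have sU: "s k = indicat_real (\<Union>i<k. A i)" for k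
      unfolding s_def[abs_def] fun_eq_iff
      using disj by (subst indicator_UN_disjoint) (auto simp: disjoint_family_on_def)
    show "poly_approx (indicat_real (\<Union>i. A i))"
    proof (rule poly_approx_dominated[where s = s and g = "\<lambda>_. 1"])
      show "sqi surface (indicat_real (\<Union>i. A i))" using Ab by (intro sqi_indicator) auto
      fix x
      show "(\<lambda>k. s k x) \<longlonglongrightarrow> indicat_real (\<Union>i. A i) x"
        unfolding sU by (rule LIMSEQ_indicator_UN)
      show "(indicat_real (\<Union>i. A i) x - s k x)\<^sup>2 \<le> 1" for k
        unfolding sU by (auto simp: indicator_def)
    qed (use s in auto)
  qed
qed

theorem poly_dense:
  assumes f: "sqi surface f" shows "poly_approx f"
proof -
  have fm: "f \<in> borel_measurable surface" using f by (simp add: sqi_real_iff)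
  obtain F where F: "\<And>i. simple_function surface (F i)" "\<And>x. x \<in> space surface \<Longrightarrow> (\<lambda>i. F i x) \<longlonglongrightarrow> f x"
    "\<And>i x. x \<in> space surface \<Longrightarrow> dist (F i x) 0 \<le> 2 * dist (f x) 0"
    using borel_measurable_implies_sequence_metric[OF fm, of 0] by blast
  have F2: "sqi surface (F i) \<and> poly_approx (F i)" for i
  proof -
    define V where "V = F i ` space surface"
    have V: "finite V" using F(1) by (simp add: V_def simple_function_def)
    \<comment> \<open>A level set is measurable only relative to the sphere. It is the trace of an
      ambient Borel set, and \<open>poly_approx_indicator\<close> speaks of those.\<close>
    have "\<exists>B\<in>sets borel. F i -` {v} \<inter> space surface = B \<inter> S2" for v
    proof (cases "v \<in> V")
      case True
      have "F i -` {v} \<inter> space surface \<in> sets surface" by (rule simple_functionD(2)[OF F(1)])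
      hence "F i -` {v} \<inter> space surface \<in> sets (restrict_space borel S2)" by (simp only: sets_surface)
      thus ?thesis unfolding sets_restrict_space image_iff by (metis inf_commute)
    next
      case False
      hence "F i -` {v} \<inter> space surface = {} \<inter> S2" by (auto simp: V_def)
      thus ?thesis by (intro bexI[of _ "{}"]) auto
    qed
    then obtain B where B: "\<And>v. B v \<in> sets borel" "\<And>v. F i -` {v} \<inter> space surface = B v \<inter> S2" by metis
    have "sqi surface (\<lambda>x. \<Sum>v\<in>W. v * indicat_real (B v) x) \<and> poly_approx (\<lambda>x. \<Sum>v\<in>W. v * indicat_real (B v) x)" if "finite W" for W
      using that
    proof induction
      case empty thus ?case by (simp add: poly_approx_continuous sqi_zero)
    next
      case (insert v W)
      have "sqi surface (\<lambda>x. v * indicat_real (B v) x)" using sqi_scaleR[OF sqi_indicator[OF B(1)], of v v] by simp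
      moreover have "(\<lambda>x. \<Sum>v\<in>insert v W. v * indicat_real (B v) x) = (\<lambda>x. v * indicat_real (B v) x + (\<Sum>v\<in>W. v * indicat_real (B v) x))"
        by (rule ext, rule sum.insert) (fact insert.hyps)+
      ultimately show ?case using insert.IH B(1)
        by (simp only:) (intro conjI sqi_add poly_approx_add poly_approx_scale poly_approx_indicator; blast)
    qed
    from this[OF V] have *: "poly_approx (\<lambda>x. \<Sum>v\<in>V. v * indicat_real (B v) x)" ..
    have "(\<Sum>v\<in>V. v * indicat_real (B v) x) = F i x" if "x \<in> S2" for x
    proof -
      have "x \<in> B v \<longleftrightarrow> F i x = v" for v using B(2)[of v] that unfolding space_surface by blast
      hence "(\<Sum>v\<in>V. v * indicat_real (B v) x) = (\<Sum>v\<in>V. if v = F i x then v else 0)"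
        by (intro sum.cong) (auto simp: indicator_def)
      also have "\<dots> = F i x" using V that by (auto simp: V_def space_surface)
      finally show ?thesis .
    qed
    with * have "poly_approx (F i)" by (rule poly_approx_cong[rotated])
    moreover have "sqi surface (F i)"
    proof (rule sqi_finite_bounded[OF finite_measure_surface borel_measurable_simple_function[OF F(1)]])
      show "norm (F i x) \<le> (\<Sum>v\<in>V. \<bar>v\<bar>)" if "x \<in> space surface" for x
        using that V by (simp add: V_def) (rule member_le_sum[where f = abs], auto)
    qed
    ultimately show ?thesis by simp
  qed
  show ?thesis
  proof (rule poly_approx_dominated[where s = F and g = "\<lambda>x. 9 * (f x)\<^sup>2"])
    show "integrable surface (\<lambda>x. 9 * (f x)\<^sup>2)" using f by (simp add: sqi_real_iff)
    show "(\<lambda>k. F k x) \<longlonglongrightarrow> f x" if "x \<in> S2" for x using F(2) that by (simp add: space_surface)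
    fix k x assume "x \<in> S2"
    hence "\<bar>F k x\<bar> \<le> 2 * \<bar>f x\<bar>" using F(3)[of x k] by (simp add: space_surface)
    hence "\<bar>f x - F k x\<bar> \<le> 3 * \<bar>f x\<bar>" by linarith
    hence "\<bar>f x - F k x\<bar>\<^sup>2 \<le> (3 * \<bar>f x\<bar>)\<^sup>2" by (intro power_mono) auto
    thus "(f x - F k x)\<^sup>2 \<le> 9 * (f x)\<^sup>2" by (simp add: power_mult_distrib)
  qed (use F2 f in auto)
qed

text \<open>For every polynomial p the squared norm of \<open>f\<close> equals the inner product of
  \<open>f\<close> with \<open>f - p\<close>, which density makes small.\<close>

lemma AE_zero_if_orthogonal_to_polys:
  assumes f: "sqi surface f" and orth: "\<And>p. real_polynomial_function p \<Longrightarrow> (LINT x|surface. f x * p x) = 0"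
  shows "AE x in surface. f x = 0"
proof -
  define a where "a = (LINT x|surface. (f x)\<^sup>2)"
  have a0: "a \<ge> 0" by (simp add: a_def)
  have "a \<le> e" if e: "e > 0" for e
  proof -
    obtain p where p: "real_polynomial_function p" "(LINT x|surface. (f x - p x)\<^sup>2) < e"
      using poly_dense[OF f] e by (auto simp: poly_approx_def)
    have "a = (LINT x|surface. f x * (f x - p x))"
      using sqi_inner_integrable[OF f sqi_poly[OF p(1)]] orth[OF p(1)] f
      by (simp add: a_def power2_eq_square right_diff_distrib sqi_real_iff)
    also have "\<dots> \<le> sqrt a * sqrt (LINT x|surface. (f x - p x)\<^sup>2)"
      using integral_Cauchy_Schwarz[OF f sqi_diff[OF f sqi_poly[OF p(1)]]] by (simp add: a_def)
    also have "\<dots> \<le> sqrt a * sqrt e" using p a0 by (intro mult_left_mono) auto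
    finally have "a\<^sup>2 \<le> (sqrt a * sqrt e)\<^sup>2" using a0 by (intro power_mono)
    also have "\<dots> = a * e" using a0 e by (simp add: power_mult_distrib)
    finally show "a \<le> e" using a0 e by (cases "a = 0") (auto simp: power2_eq_square)
  qed
  hence "a = 0" using a0 by (meson field_le_epsilon antisym add_0 order_refl less_eq_real_def dense not_le)
  hence "AE x in surface. (f x)\<^sup>2 = 0"
    using integral_nonneg_eq_0_iff_AE[of surface "\<lambda>x. (f x)\<^sup>2"] f by (auto simp: a_def sqi_real_iff)
  thus ?thesis by simp
qed

section \<open>Polynomials on the sphere\<close>

text \<open>
  Polynomials of degree at most \<open>d\<close>, up to equality on the sphere.
\<close>

inductive sp :: "nat \<Rightarrow> (real^3 \<Rightarrow> real) \<Rightarrow> bool" where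
  sp_const: "sp 0 (\<lambda>x. c)"
| sp_add: "sp d f \<Longrightarrow> sp d g \<Longrightarrow> sp d (\<lambda>x. f x + g x)"
| sp_coord: "sp d f \<Longrightarrow> sp (Suc d) (\<lambda>x. x $ i * f x)"
| sp_lift: "sp d f \<Longrightarrow> sp (Suc d) f"
| sp_cong: "sp d f \<Longrightarrow> (\<And>x. x \<in> S2 \<Longrightarrow> f x = g x) \<Longrightarrow> sp d g"

lemma sp_mono: "sp d f \<Longrightarrow> d \<le> e \<Longrightarrow> sp e f"
  by (induction e) (auto simp: le_Suc_eq intro: sp_lift)

lemma sp_const': "sp d (\<lambda>x. c)"
  using sp_mono[OF sp_const] by simp

lemma smooth_coord: "smooth_on_S2 (\<lambda>x. x $ i)"
  by (rule smooth_component[OF smooth_ident])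

lemma sp_smooth: "sp d f \<Longrightarrow> smooth_on_S2 f"
  by (induction rule: sp.induct) (auto intro: smooth_const smooth_add smooth_mult smooth_coord smooth_cong)

lemmas sp_sdiff = smooth_sdiff[OF sp_smooth]
lemmas sp_cont = smooth_continuous_on[OF sp_smooth]

lemma sp_scale: "sp d f \<Longrightarrow> sp d (\<lambda>x. c * f x)"
proof (induction rule: sp.induct)
  case (sp_const k) show ?case by (rule sp.sp_const)
next
  case (sp_add d f g)
  thus ?case using sp.sp_add[of d "\<lambda>x. c * f x" "\<lambda>x. c * g x"] by (simp add: distrib_left)
next
  case (sp_coord d f i)
  from sp.sp_coord[OF sp_coord.IH, of i] show ?case by (simp add: mult.left_commute)
next
  case (sp_lift d f) show ?case by (rule sp.sp_lift[OF sp_lift.IH])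
next
  case (sp_cong d f g)
  show ?case by (rule sp.sp_cong[OF sp_cong.IH]) (simp only: sp_cong.hyps)
qed

lemma sp_diff: "sp d f \<Longrightarrow> sp d g \<Longrightarrow> sp d (\<lambda>x. f x - g x)"
  using sp_add[of d f "\<lambda>x. - 1 * g x"] sp_scale[of d g "-1"] by simp

lemma sp_sum: "(\<And>i. i \<in> I \<Longrightarrow> sp d (f i)) \<Longrightarrow> sp d (\<lambda>x. \<Sum>i\<in>I. f i x)"
  by (induction I rule: infinite_finite_induct) (auto intro: sp_const' sp_add)

lemma linear_eq_coords:
  fixes h :: "real^3 \<Rightarrow> real" assumes "linear h"
  shows "h x = (\<Sum>j\<in>UNIV. x $ j * h (axis j 1))"
proof -
  have "x = (\<Sum>i\<in>UNIV. (x $ i) *\<^sub>R axis i 1)"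
    using basis_expansion[of x] by (simp add: scalar_mult_eq_scaleR)
  hence "h x = h (\<Sum>i\<in>UNIV. (x $ i) *\<^sub>R axis i 1)" by simp
  also have "\<dots> = (\<Sum>j\<in>UNIV. x $ j * h (axis j 1))"
    by (simp only: linear_sum[OF assms] linear_scale[OF assms]) simp
  finally show ?thesis .
qed

lemma sp_linear_mult: 
  assumes "linear h" "sp d f" shows "sp (Suc d) (\<lambda>x. h x * f x)"
proof -
  have "sp (Suc d) (\<lambda>x. \<Sum>j\<in>UNIV. x $ j * (h (axis j 1) * f x))"
    by (intro sp_sum sp_coord sp_scale assms)
  thus ?thesis
    by (rule sp_cong) (subst linear_eq_coords[OF assms(1)], simp add: sum_distrib_right mult.assoc)
qed

lemma sp_mult: "sp d f \<Longrightarrow> sp e g \<Longrightarrow> sp (d + e) (\<lambda>x. f x * g x)"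
proof (induction rule: sp.induct)
  case (sp_const c) thus ?case by (simp add: sp_scale)
next
  case (sp_add d f g') thus ?case using sp.sp_add by (simp add: distrib_right)
next
  case (sp_coord d f i)
  from sp.sp_coord[OF sp_coord.IH[OF sp_coord.prems], of i] show ?case by (simp add: mult.assoc)
next
  case (sp_lift d f) thus ?case using sp.sp_lift by simp
next
  case (sp_cong d f g')
  show ?case by (rule sp.sp_cong[OF sp_cong.IH[OF sp_cong.prems]]) (simp only: sp_cong.hyps)
qed

lemma poly_sp: "real_polynomial_function p \<Longrightarrow> \<exists>d. sp d p"
proof (induction rule: real_polynomial_function.induct)
  case (linear h)
  have "sp (Suc 0) (\<lambda>x. h x * 1)" by (rule sp_linear_mult[OF bounded_linear.linear[OF linear] sp_const])
  thus ?case by auto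
next
  case (const c) show ?case using sp_const by blast
next
  case (add f g)
  then obtain d e where "sp d f" "sp e g" by blast
  hence "sp (max d e) (\<lambda>x. f x + g x)" by (intro sp_add) (auto elim: sp_mono)
  thus ?case by blast
next
  case (mult f g) thus ?case using sp_mult by blast
qed

text \<open>Along the Killing field a coordinate is differentiated into another linear form, so the
  degree does not rise.\<close>

lemma sp_Lw: "sp d f \<Longrightarrow> sp d (Lw w f)"
proof (induction rule: sp.induct)
  case (sp_const c)
  have "Lw w (\<lambda>x. c) = (\<lambda>x. 0 :: real)" by (simp add: fun_eq_iff)
  thus ?case using sp.sp_const by simp
next
  case (sp_add d f g)
  show ?case
    by (rule sp_cong[OF sp.sp_add[OF sp_add.IH]]) (simp only: Lw_add[OF sp_sdiff[OF sp_add.hyps(1)] sp_sdiff[OF sp_add.hyps(2)] S2_nonzero])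
next
  case (sp_coord d f i)
  have l: "linear (\<lambda>x. cross3 w x $ i)"
    by (rule linearI) (auto simp: cross_add_right cross_mult_right)
  show ?case
    by (rule sp_cong[OF sp.sp_add[OF sp.sp_coord[OF sp_coord.IH, of i] sp_linear_mult[OF l sp_coord.hyps]]])
       (simp only: Lw_mult[OF smooth_sdiff[OF smooth_coord] sp_sdiff[OF sp_coord.hyps]] Lw_coord)
next
  case (sp_lift d f) thus ?case using sp.sp_lift by simp
next
  case (sp_cong d f g)
  show ?case by (rule sp.sp_cong[OF sp_cong.IH]) (use sp_cong.hyps in \<open>metis Lw_cong S2_nonzero\<close>)
qed

section \<open>The spherical Laplacian on polynomials\<close>

abbreviation La :: "3 \<Rightarrow> (real^3 \<Rightarrow> real) \<Rightarrow> real^3 \<Rightarrow> real" where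
  "La a \<equiv> Lw (axis a 1)"

definition Lap :: "(real^3 \<Rightarrow> real) \<Rightarrow> real^3 \<Rightarrow> real" where
  "Lap f x = (\<Sum>a\<in>UNIV. La a (La a f) x)"

lemma S2_norm2: "x \<in> S2 \<Longrightarrow> x$1 * x$1 + x$2 * x$2 + x$3 * x$3 = 1"
  using S2_inner[of x] by (simp add: inner_vec_def sum_3)

text \<open>Both sides are entries of the orthogonal projection onto the tangent plane at
  \<open>x\<close>, of which the three vectors \<open>cross3 (axis a 1) x\<close> form a Parseval
  frame.\<close>

lemma cross3_axis_sum:
  assumes "x \<in> S2"
  shows "(\<Sum>a\<in>UNIV. cross3 (axis a 1) x $ i * cross3 (axis a 1) x $ j) = of_bool (i = j) - x$i * x$j"
  using S2_norm2[OF assms] exhaust_3[of i] exhaust_3[of j]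
  by (auto simp: sum_3 cross3_def axis_def)

text \<open>The sum is the inner product of the surface gradients of the coordinate and of
  \<open>f\<close>. For homogeneous \<open>f\<close> of degree d, Euler's relation makes it the
  ambient partial derivative minus d times the coordinate times \<open>f\<close>, so only the last
  term can have degree d + 1. It is the cross term of the Laplacian of a product.\<close>

lemma grad_coord: "sp d f \<Longrightarrow> \<exists>h. sp d h \<and> (\<forall>x\<in>S2. (\<Sum>a\<in>UNIV. cross3 (axis a 1) x $ i * La a f x) = - real d * (x $ i * f x) + h x)"
proof (induction rule: sp.induct)
  case (sp_const c) thus ?case by (intro exI[of _ "\<lambda>x. 0"]) (simp add: sp.sp_const)
next
  case (sp_add d f g)
  then obtain h k where h: "sp d h" "\<forall>x\<in>S2. (\<Sum>a\<in>UNIV. cross3 (axis a 1) x $ i * La a f x) = - real d * (x $ i * f x) + h x"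
    and k: "sp d k" "\<forall>x\<in>S2. (\<Sum>a\<in>UNIV. cross3 (axis a 1) x $ i * La a g x) = - real d * (x $ i * g x) + k x" by blast
  have "(\<Sum>a\<in>UNIV. cross3 (axis a 1) x $ i * La a (\<lambda>x. f x + g x) x) = - real d * (x $ i * (f x + g x)) + (h x + k x)" if x: "x \<in> S2" for x
    using h(2)[rule_format, OF x] k(2)[rule_format, OF x] 
    by (simp add: Lw_add[OF sp_sdiff[OF sp_add.hyps(1)] sp_sdiff[OF sp_add.hyps(2)] S2_nonzero[OF x]] distrib_left sum.distrib)
  thus ?case using sp.sp_add[OF h(1) k(1)] by blast
next
  case (sp_coord d g j)
  then obtain h where h: "sp d h" "\<forall>x\<in>S2. (\<Sum>a\<in>UNIV. cross3 (axis a 1) x $ i * La a g x) = - real d * (x $ i * g x) + h x" by blast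
  have "(\<Sum>a\<in>UNIV. cross3 (axis a 1) x $ i * La a (\<lambda>x. x $ j * g x) x) = - real (Suc d) * (x $ i * (x $ j * g x)) + (of_bool (i = j) * g x + x $ j * h x)" if x: "x \<in> S2" for x
  proof -
    have "(\<Sum>a\<in>UNIV. cross3 (axis a 1) x $ i * La a (\<lambda>x. x $ j * g x) x)
      = (\<Sum>a\<in>UNIV. x $ j * (cross3 (axis a 1) x $ i * La a g x) + (cross3 (axis a 1) x $ i * cross3 (axis a 1) x $ j) * g x)"
      by (intro sum.cong refl) (simp only: Lw_mult[OF smooth_sdiff[OF smooth_coord] sp_sdiff[OF sp_coord.hyps] x] Lw_coord[OF x], simp add: algebra_simps)
    also have "\<dots> = x $ j * (- real d * (x $ i * g x) + h x) + (of_bool (i = j) - x$i * x$j) * g x"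
      unfolding sum.distrib sum_distrib_left[symmetric] sum_distrib_right[symmetric] cross3_axis_sum[OF x] h(2)[rule_format, OF x] ..
    finally show ?thesis by (simp add: algebra_simps)
  qed
  moreover have "sp (Suc d) (\<lambda>x. of_bool (i = j) * g x + x $ j * h x)"
    by (intro sp.sp_add sp.sp_coord sp.sp_lift sp_scale h sp_coord)
  ultimately show ?case by blast
next
  case (sp_lift d f)
  then obtain h where h: "sp d h" "\<forall>x\<in>S2. (\<Sum>a\<in>UNIV. cross3 (axis a 1) x $ i * La a f x) = - real d * (x $ i * f x) + h x" by blast
  have "sp (Suc d) (\<lambda>x. x $ i * f x + h x)" by (intro sp.sp_add sp.sp_coord sp.sp_lift h sp_lift)
  thus ?case using h(2) by (intro exI[of _ "\<lambda>x. x $ i * f x + h x"]) (simp add: algebra_simps)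
next
  case (sp_cong d f g)
  then obtain h where h: "sp d h" "\<forall>x\<in>S2. (\<Sum>a\<in>UNIV. cross3 (axis a 1) x $ i * La a f x) = - real d * (x $ i * f x) + h x" by blast
  have "(\<Sum>a\<in>UNIV. cross3 (axis a 1) x $ i * La a g x) = - real d * (x $ i * g x) + h x" if x: "x \<in> S2" for x
    using h(2)[rule_format, OF x] by (simp only: Lw_cong[OF sp_cong.hyps(2) S2_nonzero[OF x]] sp_cong.hyps(2)[OF x])
  thus ?case using h(1) by blast
qed

text \<open>Degree strictly below \<open>d\<close>. At \<open>d = 0\<close> only the zero function
  remains, whereas truncated subtraction would admit the constants.\<close>

definition lower :: "nat \<Rightarrow> (real^3 \<Rightarrow> real) \<Rightarrow> bool" where
  "lower d h \<longleftrightarrow> (if d = 0 then \<forall>x\<in>S2. h x = 0 else sp (d - 1) h)"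

lemma lower_0: "lower 0 h \<longleftrightarrow> (\<forall>x\<in>S2. h x = 0)" and lower_Suc: "lower (Suc d) h \<longleftrightarrow> sp d h"
  by (simp_all add: lower_def)

lemma lower_sp: "lower d h \<Longrightarrow> sp d h"
  by (cases d) (auto simp: lower_0 lower_Suc intro: sp_lift sp_cong[OF sp_const', of 0])

lemma lower_coord: "lower d h \<Longrightarrow> sp d (\<lambda>x. x $ i * h x)"
  by (cases d) (auto simp: lower_0 lower_Suc intro: sp_coord sp_cong[OF sp_const', of 0])

lemma lower_add: "lower d h \<Longrightarrow> lower d k \<Longrightarrow> lower d (\<lambda>x. h x + k x)"
  by (cases d) (auto simp: lower_0 lower_Suc intro: sp_add)

lemma lower_scale: "lower d h \<Longrightarrow> lower d (\<lambda>x. c * h x)"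
  by (cases d) (auto simp: lower_0 lower_Suc intro: sp_scale)

text \<open>The order of \<open>v\<close> and \<open>w\<close> is reversed because the outer
  derivative acts on the argument of the linear form that the inner one produces.\<close>

lemma Lw_Lw_coord: 
  assumes x: "x \<in> S2" shows "Lw w (Lw v (\<lambda>x. x $ i)) x = cross3 v (cross3 w x) $ i"
proof -
  have "Lw w (Lw v (\<lambda>x. x $ i)) x = Lw w (\<lambda>x. cross3 v x $ i) x"
    by (rule Lw_cong[OF Lw_coord S2_nonzero[OF x]])
  also have "\<dots> = cross3 v (Lw w (\<lambda>x. x) x) $ i"
  proof (rule Lw_linear[where T = "\<lambda>y. cross3 v y $ i"])
    show "bounded_linear (\<lambda>y. cross3 v y $ i)"
      unfolding linear_conv_bounded_linear[symmetric] by (rule linearI) (auto simp: cross_add_right cross_mult_right)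
  qed (rule smooth_sdiff[OF smooth_ident], rule S2_nonzero[OF x])
  finally show ?thesis by (simp only: Lw_ident[OF x])
qed

lemma Lw_Lw_mult:
  assumes f: "smooth_on_S2 f" "smooth_on_S2 g" and x: "x \<in> S2"
  shows "Lw w (Lw v (\<lambda>x. f x * g x)) x
     = f x * Lw w (Lw v g) x + Lw w f x * Lw v g x + Lw v f x * Lw w g x + Lw w (Lw v f) x * (g x :: real)"
proof -
  have "Lw w (Lw v (\<lambda>x. f x * g x)) x = Lw w (\<lambda>x. f x * Lw v g x + Lw v f x * g x) x"
    by (rule Lw_cong[OF Lw_mult S2_nonzero[OF x]]) (auto intro: smooth_sdiff f)
  also have "\<dots> = Lw w (\<lambda>x. f x * Lw v g x) x + Lw w (\<lambda>x. Lw v f x * g x) x"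
    by (intro Lw_add smooth_sdiff smooth_mult f smooth_Lw S2_nonzero[OF x])
  also have "\<dots> = f x * Lw w (Lw v g) x + Lw w f x * Lw v g x + (Lw v f x * Lw w g x + Lw w (Lw v f) x * g x)"
    by (intro arg_cong2[where f = "(+)"] Lw_mult smooth_sdiff f smooth_Lw x)
  finally show ?thesis by simp
qed

lemma Lap_cong: 
  assumes "\<And>x. x \<in> S2 \<Longrightarrow> f x = g x" "x \<in> S2" shows "Lap f x = Lap g x"
  unfolding Lap_def by (intro sum.cong refl Lw_cong[OF Lw_cong[OF assms(1)] S2_nonzero[OF assms(2)]] S2_nonzero)

text \<open>In the coordinate step the product rule contributes d(d+1) from the factor
  \<open>g\<close>, 2d from the gradient term of \<open>grad_coord\<close>, and 2 because the
  Laplacian of a coordinate is -2 times it. Together this is (d+1)(d+2).\<close>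

lemma Lap_leading: "sp d f \<Longrightarrow> \<exists>h. lower d h \<and> (\<forall>x\<in>S2. Lap f x = - (real d * (real d + 1)) * f x + h x)"
proof (induction rule: sp.induct)
  case (sp_const c)
  have "Lw w (\<lambda>x. c) = (\<lambda>x. 0 :: real)" for w by (simp add: fun_eq_iff)
  thus ?case by (intro exI[of _ "\<lambda>x. 0"]) (simp add: lower_0 Lap_def)
next
  case (sp_add d f g)
  then obtain h k where h: "lower d h" "\<forall>x\<in>S2. Lap f x = - (real d * (real d + 1)) * f x + h x"
    and k: "lower d k" "\<forall>x\<in>S2. Lap g x = - (real d * (real d + 1)) * g x + k x" by blast
  have "Lap (\<lambda>x. f x + g x) x = - (real d * (real d + 1)) * (f x + g x) + (h x + k x)" if x: "x \<in> S2" for x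
  proof -
    have "Lw w (Lw w (\<lambda>x. f x + g x)) x = Lw w (Lw w f) x + Lw w (Lw w g) x" for w
    proof -
      have "Lw w (Lw w (\<lambda>x. f x + g x)) x = Lw w (\<lambda>x. Lw w f x + Lw w g x) x"
        by (rule Lw_cong[OF Lw_add S2_nonzero[OF x]]) (auto intro: sp_sdiff sp_add)
      also have "\<dots> = Lw w (Lw w f) x + Lw w (Lw w g) x"
        by (intro Lw_add sp_sdiff sp_Lw S2_nonzero[OF x]) (rule sp_add.hyps)+
      finally show ?thesis .
    qed
    hence "Lap (\<lambda>x. f x + g x) x = Lap f x + Lap g x" by (simp add: Lap_def sum.distrib)
    thus ?thesis using h(2)[rule_format, OF x] k(2)[rule_format, OF x] by (simp add: algebra_simps)
  qed
  thus ?case using lower_add[OF h(1) k(1)] by blast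
next
  case (sp_coord d g i)
  then obtain h where h: "lower d h" "\<forall>x\<in>S2. Lap g x = - (real d * (real d + 1)) * g x + h x" by blast
  obtain k where k: "sp d k" "\<forall>x\<in>S2. (\<Sum>a\<in>UNIV. cross3 (axis a 1) x $ i * La a g x) = - real d * (x $ i * g x) + k x"
    using grad_coord[OF sp_coord.hyps] by blast
  have "Lap (\<lambda>x. x $ i * g x) x = - (real (Suc d) * (real (Suc d) + 1)) * (x $ i * g x) + (2 * k x + x $ i * h x)" if x: "x \<in> S2" for x
  proof -
    have "Lap (\<lambda>x. x $ i * g x) x = (\<Sum>a\<in>UNIV. x $ i * La a (La a g) x + 2 * (cross3 (axis a 1) x $ i * La a g x) + cross3 (axis a 1) (cross3 (axis a 1) x) $ i * g x)"
      unfolding Lap_def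
      by (intro sum.cong refl) (simp add: Lw_Lw_mult[OF smooth_coord sp_smooth[OF sp_coord.hyps] x] Lw_coord[OF x] Lw_Lw_coord[OF x])
    also have "\<dots> = x $ i * Lap g x + 2 * (- real d * (x $ i * g x) + k x) + (\<Sum>a\<in>UNIV. cross3 (axis a 1) (cross3 (axis a 1) x) $ i) * g x"
      unfolding Lap_def sum.distrib sum_distrib_left[symmetric] sum_distrib_right[symmetric] k(2)[rule_format, OF x] ..
    also have "(\<Sum>a\<in>UNIV. cross3 (axis a 1) (cross3 (axis a 1) x) $ i) = - 2 * x $ i"
      using exhaust_3[of i] by (auto simp: sum_3 cross3_def axis_def)
    finally show ?thesis using h(2)[rule_format, OF x] by (simp add: algebra_simps)
  qed
  moreover have "lower (Suc d) (\<lambda>x. 2 * k x + x $ i * h x)"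
    unfolding lower_Suc by (intro sp_add sp_scale lower_coord h k)
  ultimately show ?case by blast
next
  case (sp_lift d f)
  then obtain h where h: "lower d h" "\<forall>x\<in>S2. Lap f x = - (real d * (real d + 1)) * f x + h x" by blast
  \<comment> \<open>The coefficient is (d+1)(d+2) - d(d+1): relative to degree d + 1 the whole of
    \<open>f\<close> counts as lower.\<close>
  have "lower (Suc d) (\<lambda>x. 2 * (real d + 1) * f x + h x)"
    unfolding lower_Suc by (intro sp.sp_add sp_scale lower_sp h sp_lift)
  thus ?case using h(2) by (intro exI[of _ "\<lambda>x. 2 * (real d + 1) * f x + h x"]) (simp add: algebra_simps)
next
  case (sp_cong d f g)
  then obtain h where h: "lower d h" "\<forall>x\<in>S2. Lap f x = - (real d * (real d + 1)) * f x + h x" by blast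
  have "Lap g x = - (real d * (real d + 1)) * g x + h x" if x: "x \<in> S2" for x
    using h(2)[rule_format, OF x] by (simp only: Lap_cong[OF sp_cong.hyps(2) x] sp_cong.hyps(2)[OF x])
  thus ?case using h(1) by blast
qed

section \<open>Spherical harmonics\<close>

definition ip :: "(real^3 \<Rightarrow> real) \<Rightarrow> (real^3 \<Rightarrow> real) \<Rightarrow> real" where
  "ip f g = (LINT x|surface. f x * g x)"

lemma sp_sqi: "sp d f \<Longrightarrow> sqi surface f"
  by (rule sqi_continuous[OF sp_cont])

lemma ip_integrable: "sqi surface f \<Longrightarrow> sqi surface g \<Longrightarrow> integrable surface (\<lambda>x. f x * g x :: real)"
  using sqi_inner_integrable[of surface f g] by simp

lemma ip_commute: "ip f g = ip g f"
  by (simp add: ip_def mult.commute)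

lemma ip_add: "sqi surface f \<Longrightarrow> sqi surface g \<Longrightarrow> sqi surface h \<Longrightarrow> ip (\<lambda>x. f x + g x) h = ip f h + ip g h"
  using ip_integrable[of f h] ip_integrable[of g h] by (simp add: ip_def distrib_right)

lemma ip_scale: "ip (\<lambda>x. c * f x) h = c * ip f h"
  by (simp add: ip_def mult.assoc)

lemma ip_zero: "ip (\<lambda>x. 0) h = 0"
  by (simp add: ip_def)

lemma sqi_scale: "sqi M (f :: 'a \<Rightarrow> real) \<Longrightarrow> sqi M (\<lambda>x. c * f x)"
  using sqi_scaleR[of M f c] by simp

lemma ip_diff: "sqi surface f \<Longrightarrow> sqi surface g \<Longrightarrow> sqi surface h \<Longrightarrow> ip (\<lambda>x. f x - g x) h = ip f h - ip g h"
  using ip_integrable[of f h] ip_integrable[of g h] by (simp add: ip_def left_diff_distrib)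

lemma ip_sum: 
  "(\<And>i. i \<in> I \<Longrightarrow> sqi surface (f i)) \<Longrightarrow> sqi surface h \<Longrightarrow> ip (\<lambda>x. \<Sum>i\<in>I. c i * f i x) h = (\<Sum>i\<in>I. c i * ip (f i) h)"
proof (induction I rule: infinite_finite_induct)
  case (insert i I)
  have "ip (\<lambda>x. \<Sum>i\<in>insert i I. c i * f i x) h = ip (\<lambda>x. c i * f i x + (\<Sum>i\<in>I. c i * f i x)) h"
    using insert.hyps by simp
  also have "\<dots> = ip (\<lambda>x. c i * f i x) h + ip (\<lambda>x. \<Sum>i\<in>I. c i * f i x) h"
    using insert.prems by (intro ip_add sqi_sum sqi_scale) auto
  finally show ?case using insert by (simp add: ip_scale)
qed (auto simp: ip_zero)

lemma ip_cong: "(\<And>x. x \<in> S2 \<Longrightarrow> f x = f' x) \<Longrightarrow> (\<And>x. x \<in> S2 \<Longrightarrow> g x = g' x) \<Longrightarrow> ip f g = ip f' g'"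
  unfolding ip_def by (intro Bochner_Integration.integral_cong refl) (simp only: space_surface)

lemma ip_Lw:
  assumes f: "smooth_on_S2 f" "smooth_on_S2 g" and w: "norm w = 1"
  shows "ip (Lw w f) g = - ip f (Lw w g)"
proof -
  note sq = sqi_continuous[OF smooth_continuous_on]
  have "0 = (LINT x|surface. Lw w (\<lambda>x. f x * g x) x)"
    by (rule integral_Lw[OF smooth_mult[OF f] w, symmetric])
  also have "\<dots> = (LINT x|surface. f x * Lw w g x + Lw w f x * g x)"
    by (intro Bochner_Integration.integral_cong refl Lw_mult smooth_sdiff f) (simp only: space_surface)
  also have "\<dots> = ip f (Lw w g) + ip (Lw w f) g"
    unfolding ip_def by (intro Bochner_Integration.integral_add ip_integrable sq smooth_Lw f)
  finally show ?thesis by simp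
qed

text \<open>The cone over \<open>U\<close> is open in space, and a nonempty open set is not
  negligible.\<close>

lemma surface_null_open:
  assumes U: "openin (top_of_set S2) U" and null: "emeasure surface U = 0"
  shows "U = {}"
proof (rule ccontr)
  assume "U \<noteq> {}"
  then obtain y where y: "y \<in> U" by blast
  obtain T where T: "open T" "U = S2 \<inter> T" using U by (auto simp: openin_open)
  have US: "U \<in> sets surface" using T by (simp add: sets_surface sets_restrict_space)
  define C where "C = {x \<in> ball 0 1 - {0}. radial x \<in> U}"
  have "C = (ball 0 1 - {0}) \<inter> radial -` T"
    using radial_in_S2 by (auto simp: C_def T simp del: mem_sphere)
  moreover have "continuous_on (ball 0 1 - {0}) radial"
    unfolding radial_def by (auto intro!: continuous_intros)
  ultimately have "open C"
    using T(1) by (simp add: continuous_open_preimage open_delete)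
  have "3 * emeasure lborel C = 0" using emeasure_surface[OF US] null by (simp add: C_def)
  hence "emeasure lborel C = 0" by simp
  hence "C \<in> null_sets lborel" using \<open>open C\<close> by (auto intro: null_setsI)
  hence "negligible C" by (simp add: negligible_iff_null_sets null_sets_completionI)
  hence "C = {}" using open_not_negligible \<open>open C\<close> by blast
  moreover have "(1/2) *\<^sub>R y \<in> C"
  proof -
    have "y \<in> S2" using y T by blast
    thus ?thesis using y S2_nonzero[OF \<open>y \<in> S2\<close>] by (simp add: C_def radial_scaleR)
  qed
  ultimately show False by blast
qed

text \<open>A continuous function that vanishes almost everywhere is nonzero only on a relatively
  open null set. This turns equalities in the inner product into equalities at every point, where
  the sums of squares of harmonics are evaluated.\<close>

lemma ip_definite:
  assumes f: "continuous_on S2 f" and z: "ip f f = 0" and x: "x \<in> S2"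
  shows "f x = 0"
proof -
  have sq: "sqi surface f" by (rule sqi_continuous[OF f])
  define U where "U = {x \<in> S2. f x \<noteq> 0}"
  have "(LINT x|surface. (f x)\<^sup>2) = 0" using z by (simp add: ip_def power2_eq_square)
  hence "AE x in surface. (f x)\<^sup>2 = 0"
    using integral_nonneg_eq_0_iff_AE[of surface "\<lambda>x. (f x)\<^sup>2"] sq by (auto simp: sqi_real_iff)
  hence AE: "AE x in surface. \<not> f x \<noteq> 0" by simp
  have Us: "U = {x \<in> space surface. f x \<noteq> 0}" by (simp add: U_def space_surface)
  have "U \<in> sets surface" using sqi_measurable[OF sq] unfolding Us by measurable
  hence "emeasure surface U = 0"
    using AE unfolding Us by (simp add: AE_iff_measurable[OF _ refl])
  moreover have "openin (top_of_set S2) U"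
  proof -
    have "U = S2 \<inter> f -` (- {0})" by (auto simp: U_def)
    moreover have "open (- {0::real})" by (simp add: open_Compl)
    ultimately show ?thesis using continuous_openin_preimage_gen[OF f, of "- {0}"] by simp
  qed
  ultimately have "U = {}" by (rule surface_null_open[rotated])
  thus ?thesis using x by (auto simp: U_def)
qed

definition orthonormal :: "(real^3 \<Rightarrow> real) set \<Rightarrow> bool" where
  "orthonormal B \<longleftrightarrow> (\<forall>b\<in>B. \<forall>c\<in>B. ip b c = of_bool (b = c))"

text \<open>Membership in the span of an orthonormal \<open>B\<close>, stated through the Fourier
  coefficients of \<open>f\<close> itself and only on \<open>S2\<close>, because polynomials are
  identified when they agree there.\<close>

definition spanned :: "(real^3 \<Rightarrow> real) set \<Rightarrow> (real^3 \<Rightarrow> real) \<Rightarrow> bool" where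
  "spanned B f \<longleftrightarrow> (\<forall>x\<in>S2. f x = (\<Sum>b\<in>B. ip f b * b x))"

lemma spannedD: "spanned B f \<Longrightarrow> x \<in> S2 \<Longrightarrow> f x = (\<Sum>b\<in>B. ip f b * b x)"
  by (simp add: spanned_def)

lemma spanned_cong:
  assumes "spanned B f" "\<And>x. x \<in> S2 \<Longrightarrow> f x = g x" shows "spanned B g"
  unfolding spanned_def
proof
  fix x assume x: "x \<in> S2"
  have "ip f b = ip g b" for b by (rule ip_cong[OF assms(2) refl])
  thus "g x = (\<Sum>b\<in>B. ip g b * b x)" using spannedD[OF assms(1) x] assms(2)[OF x] by simp
qed

lemma spanned_add:
  assumes "spanned B f" "spanned B g" "sqi surface f" "sqi surface g" "\<And>b. b \<in> B \<Longrightarrow> sqi surface b"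
  shows "spanned B (\<lambda>x. f x + g x)"
  using assms unfolding spanned_def by (simp add: ip_add distrib_right sum.distrib cong: sum.cong)

lemma spanned_scale: "spanned B f \<Longrightarrow> spanned B (\<lambda>x. c * f x)"
  unfolding spanned_def by (simp add: ip_scale sum_distrib_left mult.assoc)

lemma spanned_zero: "spanned B (\<lambda>x. 0)"
  by (simp add: spanned_def ip_zero)

lemma spanned_sum:
  assumes "\<And>i. i \<in> I \<Longrightarrow> spanned B (f i)" "\<And>i. i \<in> I \<Longrightarrow> sqi surface (f i)" "\<And>b. b \<in> B \<Longrightarrow> sqi surface b"
  shows "spanned B (\<lambda>x. \<Sum>i\<in>I. c i * f i x)"
  using assms(1,2)
proof (induction I rule: infinite_finite_induct)
  case (insert i I)
  have "spanned B (\<lambda>x. c i * f i x + (\<Sum>i\<in>I. c i * f i x))"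
  proof (rule spanned_add[OF _ insert.IH _ _ assms(3)])
    show "sqi surface (\<lambda>x. \<Sum>i\<in>I. c i * f i x)"
      using insert.prems by (intro sqi_sum sqi_scale) auto
  qed (use insert.prems in \<open>auto intro: spanned_scale sqi_scale\<close>)
  thus ?case using insert.hyps by simp
qed (auto simp: spanned_zero)

lemma spanned_mono:
  assumes f: "spanned B f" and C: "finite C" "B \<subseteq> C" "orthonormal C" "\<And>c. c \<in> C \<Longrightarrow> sqi surface c"
  shows "spanned C f"
proof -
  have z: "ip f c = 0" if c: "c \<in> C - B" for c
  proof -
    have "ip f c = ip (\<lambda>x. \<Sum>b\<in>B. ip f b * b x) c" by (rule ip_cong[OF spannedD[OF f] refl])
    also have "\<dots> = (\<Sum>b\<in>B. ip f b * ip b c)" using C c by (intro ip_sum) auto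
    also have "\<dots> = 0" using C c by (intro sum.neutral) (auto simp: orthonormal_def)
    finally show ?thesis .
  qed
  show ?thesis unfolding spanned_def
  proof
    fix x assume x: "x \<in> S2"
    show "f x = (\<Sum>b\<in>C. ip f b * b x)"
      unfolding spannedD[OF f x] using C z by (intro sum.mono_neutral_left) auto
  qed
qed

text \<open>Each \<open>f\<close> adds at most its normalised residual \<open>h\<close>, whence the
  bound on the cardinality. A residual of norm zero vanishes at every point by
  \<open>ip_definite\<close>, and then \<open>f\<close> is already spanned.\<close>

lemma gram_schmidt:
  assumes B: "finite B" "orthonormal B" "\<And>b. b \<in> B \<Longrightarrow> sp d b"
    and F: "finite F" "\<And>f. f \<in> F \<Longrightarrow> sp d f"
  shows "\<exists>G. finite G \<and> card G \<le> card F \<and> (\<forall>b\<in>G. sp d b) \<and> B \<inter> G = {} \<and> orthonormal (B \<union> G) \<and> (\<forall>f\<in>F. spanned (B \<union> G) f)"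
  using F
proof (induction F)
  case empty
  show ?case using B by (intro exI[of _ "{}"]) auto
next
  case (insert f F)
  then obtain G where G: "finite G" "card G \<le> card F" "\<forall>b\<in>G. sp d b" "B \<inter> G = {}" "orthonormal (B \<union> G)" "\<forall>f\<in>F. spanned (B \<union> G) f"
    by auto
  define C where "C = B \<union> G"
  have C: "finite C" "\<And>b. b \<in> C \<Longrightarrow> sp d b" "orthonormal C" using G B by (auto simp: C_def)
  have f: "sp d f" using insert.prems by simp
  define h where "h x = f x - (\<Sum>b\<in>C. ip f b * b x)" for x
  have h: "sp d h" unfolding h_def by (intro sp_diff sp_sum sp_scale f C)
  have hC: "ip h c = 0" if c: "c \<in> C" for c
  proof -
    have "ip h c = ip f c - ip (\<lambda>x. \<Sum>b\<in>C. ip f b * b x) c"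
      unfolding h_def by (intro ip_diff sp_sqi[OF f] sp_sqi[of d, OF sp_sum] sp_sqi[OF C(2)[OF c]] sp_scale C)
    also have "ip (\<lambda>x. \<Sum>b\<in>C. ip f b * b x) c = (\<Sum>b\<in>C. ip f b * ip b c)"
      using C c by (intro ip_sum) (auto intro: sp_sqi)
    also have "\<dots> = (\<Sum>b\<in>C. if b = c then ip f c else 0)"
      using C(3) c by (intro sum.cong) (auto simp: orthonormal_def)
    also have "\<dots> = ip f c" using C(1) c by simp
    finally show ?thesis by simp
  qed
  show ?case
  proof (cases "ip h h = 0")
    case True
    have "spanned C f" unfolding spanned_def
      using ip_definite[OF sp_cont[OF h] True] by (simp add: h_def)
    thus ?thesis using G insert.hyps by (intro exI[of _ G]) (auto simp: C_def)
  next
    case False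
    have "ip h h \<ge> 0" by (simp add: ip_def)
    hence pos: "ip h h > 0" using False by simp
    define s where "s = sqrt (ip h h)"
    have s: "s > 0" "s * s = ip h h" using pos by (auto simp: s_def)
    define g where "g x = (1 / s) * h x" for x
    have g: "sp d g" unfolding g_def by (rule sp_scale[OF h])
    have gg: "ip g g = 1"
    proof -
      have "ip g g = (LINT x|surface. (1 / s * (1 / s)) * (h x * h x))"
        unfolding ip_def g_def by (simp only: mult_ac)
      also have "\<dots> = (1 / s * (1 / s)) * ip h h" unfolding ip_def by (rule integral_mult_right_zero)
      also have "\<dots> = 1" unfolding s(2)[symmetric] using s(1) by simp
      finally show ?thesis .
    qed
    have gC: "ip g c = 0" "ip c g = 0" if "c \<in> C" for c
    proof -
      have "ip g c = (1 / s) * ip h c" unfolding g_def[abs_def] by (rule ip_scale)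
      thus "ip g c = 0" using hC[OF that] by simp
      thus "ip c g = 0" by (metis ip_commute)
    qed
    have ng: "g \<notin> C" using gg gC by force
    have on: "orthonormal (insert g C)"
      unfolding orthonormal_def
    proof (intro ballI)
      fix b c assume "b \<in> insert g C" "c \<in> insert g C"
      then consider "b = g" "c = g" | "b = g" "c \<in> C" | "b \<in> C" "c = g" | "b \<in> C" "c \<in> C" by blast
      thus "ip b c = of_bool (b = c)"
      proof cases
        case 1 thus ?thesis using gg by simp
      next
        case 2
        hence "b \<noteq> c" using ng by blast
        thus ?thesis using gC(1)[OF 2(2)] 2 by simp
      next
        case 3
        hence "b \<noteq> c" using ng by blast
        thus ?thesis using gC(2)[OF 3(1)] 3 by simp
      next
        case 4 thus ?thesis using C(3) by (simp add: orthonormal_def)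
      qed
    qed
    have sq: "\<And>c. c \<in> insert g C \<Longrightarrow> sqi surface c" using C g sp_sqi by auto
    have "spanned (insert g C) (\<lambda>x. s * g x + (\<Sum>b\<in>C. ip f b * b x))"
    proof (intro spanned_add spanned_scale spanned_sum sqi_scale sqi_sum sq)
      have sp1: "spanned (insert g C) c" if c: "c \<in> insert g C" for c
        unfolding spanned_def
      proof
        fix x
        have "(\<Sum>b\<in>insert g C. ip c b * b x) = (\<Sum>b\<in>insert g C. if b = c then c x else 0)"
          using on c by (intro sum.cong) (auto simp: orthonormal_def)
        thus "c x = (\<Sum>b\<in>insert g C. ip c b * b x)" using C(1) c by (simp del: sum.insert)
      qed
      show "spanned (insert g C) g" "\<And>i. i \<in> C \<Longrightarrow> spanned (insert g C) i" using sp1 by auto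
    qed auto
    hence "spanned (insert g C) f" by (rule spanned_cong) (use s in \<open>simp add: g_def h_def\<close>)
    moreover have "spanned (insert g C) f'" if "f' \<in> F" for f'
      by (rule spanned_mono[of C]) (use that G(6) C on sq in \<open>auto simp: C_def\<close>)
    moreover have "insert g C = B \<union> insert g G" by (auto simp: C_def)
    ultimately have "\<forall>f'\<in>insert f F. spanned (B \<union> insert g G) f'" by auto
    moreover have "card (insert g G) \<le> card (insert f F)" using G insert.hyps by (simp add: card_insert_if)
    moreover have "orthonormal (B \<union> insert g G)" using on by (simp add: C_def)
    ultimately show ?thesis using G g ng by (intro exI[of _ "insert g G"]) (auto simp: C_def)
  qed
qed

text \<open>On the sphere \<open>z\<^sup>2 = 1 - x\<^sup>2 - y\<^sup>2\<close>, so modulo lower degree the monomials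
  \<open>x\<^sup>i y\<^sup>j z\<^sup>e\<close> with \<open>e \<le> 1\<close> suffice.\<close>

definition mono3 :: "nat \<times> nat \<times> nat \<Rightarrow> real^3 \<Rightarrow> real" where
  "mono3 = (\<lambda>(i, j, e) x. (x$1)^i * (x$2)^j * (x$3)^e)"

definition leading :: "nat \<Rightarrow> (nat \<times> nat \<times> nat) set" where
  "leading n = {(i, j, e). e \<le> 1 \<and> i + j + e = n}"

text \<open>There are n + 1 exponents with e = 0 and n with e = 1; the total 2n + 1 is the dimension
  of the harmonics of degree n.\<close>

lemma leading: "finite (leading n)" "card (leading n) \<le> 2 * n + 1"
proof -
  have sub: "leading n \<subseteq> (\<lambda>i. (i, n - i, 0)) ` {..n} \<union> (\<lambda>i. (i, n - 1 - i, 1)) ` {..<n}"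
  proof
    fix t assume "t \<in> leading n"
    then obtain i j e where t: "t = (i, j, e)" "e \<le> 1" "i + j + e = n" by (auto simp: leading_def)
    from t(2) have "e = 0 \<or> e = 1" by auto
    thus "t \<in> (\<lambda>i. (i, n - i, 0)) ` {..n} \<union> (\<lambda>i. (i, n - 1 - i, 1)) ` {..<n}"
      using t by (auto simp: image_iff)
  qed
  thus "finite (leading n)" by (rule finite_subset) auto
  have "card (leading n) \<le> card ((\<lambda>i. (i, n - i, 0::nat)) ` {..n} \<union> (\<lambda>i. (i, n - 1 - i, 1)) ` {..<n})"
    using sub by (intro card_mono) auto
  also have "\<dots> \<le> card ((\<lambda>i. (i, n - i, 0::nat)) ` {..n}) + card ((\<lambda>i. (i, n - 1 - i, 1::nat)) ` {..<n})"
    by (rule card_Un_le)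
  also have "\<dots> \<le> (n + 1) + n"
    by (intro add_mono order_trans[OF card_image_le]) auto
  finally show "card (leading n) \<le> 2 * n + 1" by simp
qed

lemma sp_power: "sp n (\<lambda>x. (x $ k) ^ n)"
  by (induction n) (auto intro: sp_const sp_coord)

lemma sp_mono3: "(i, j, e) \<in> leading n \<Longrightarrow> sp n (mono3 (i, j, e))"
  using sp_mult[OF sp_mult[OF sp_power[of i 1] sp_power[of j 2]] sp_power[of e 3]]
  by (simp add: mono3_def leading_def)

definition leading_rep :: "nat \<Rightarrow> (real^3 \<Rightarrow> real) \<Rightarrow> bool" where
  "leading_rep n f \<longleftrightarrow> (\<exists>c h. lower n h \<and> (\<forall>x\<in>S2. f x = (\<Sum>m\<in>leading n. c m * mono3 m x) + h x))"

lemma leading_rep_cong: 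
  assumes "leading_rep n f" "\<And>x. x \<in> S2 \<Longrightarrow> f x = g x" shows "leading_rep n g"
proof -
  obtain c h where 1: "lower n h" "\<forall>x\<in>S2. f x = (\<Sum>m\<in>leading n. c m * mono3 m x) + h x"
    using assms(1) unfolding leading_rep_def by blast
  have "g x = (\<Sum>m\<in>leading n. c m * mono3 m x) + h x" if x: "x \<in> S2" for x
    by (rule trans[OF assms(2)[OF x, symmetric] 1(2)[rule_format, OF x]])
  thus ?thesis unfolding leading_rep_def using 1(1) by blast
qed

lemma leading_rep_add: 
  assumes "leading_rep n f" "leading_rep n g" shows "leading_rep n (\<lambda>x. f x + g x)"
proof -
  obtain c h c' h' where 1: "lower n h" "\<forall>x\<in>S2. f x = (\<Sum>m\<in>leading n. c m * mono3 m x) + h x"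
    and 2: "lower n h'" "\<forall>x\<in>S2. g x = (\<Sum>m\<in>leading n. c' m * mono3 m x) + h' x"
    using assms unfolding leading_rep_def by blast
  have "\<forall>x\<in>S2. f x + g x = (\<Sum>m\<in>leading n. (c m + c' m) * mono3 m x) + (h x + h' x)"
  proof
    fix x assume x: "x \<in> S2"
    show "f x + g x = (\<Sum>m\<in>leading n. (c m + c' m) * mono3 m x) + (h x + h' x)"
      unfolding 1(2)[rule_format, OF x] 2(2)[rule_format, OF x] by (simp add: distrib_right sum.distrib)
  qed
  thus ?thesis unfolding leading_rep_def
    by (intro exI[of _ "\<lambda>m. c m + c' m"] exI[of _ "\<lambda>x. h x + h' x"] conjI lower_add 1 2)
qed

lemma leading_rep_scale: 
  assumes "leading_rep n f" shows "leading_rep n (\<lambda>x. a * f x)"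
proof -
  obtain c h where 1: "lower n h" "\<forall>x\<in>S2. f x = (\<Sum>m\<in>leading n. c m * mono3 m x) + h x"
    using assms unfolding leading_rep_def by blast
  have "\<forall>x\<in>S2. a * f x = (\<Sum>m\<in>leading n. (a * c m) * mono3 m x) + a * h x"
  proof
    fix x assume x: "x \<in> S2"
    show "a * f x = (\<Sum>m\<in>leading n. (a * c m) * mono3 m x) + a * h x"
      unfolding 1(2)[rule_format, OF x] by (simp add: distrib_left sum_distrib_left mult.assoc)
  qed
  thus ?thesis unfolding leading_rep_def
    by (intro exI[of _ "\<lambda>m. a * c m"] exI[of _ "\<lambda>x. a * h x"] conjI lower_scale 1)
qed

lemma leading_rep_lower: 
  assumes "lower n h" shows "leading_rep n h"
proof -
  have "\<forall>x\<in>S2. h x = (\<Sum>m\<in>leading n. 0 * mono3 m x) + h x" by simp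
  thus ?thesis unfolding leading_rep_def
    by (intro exI[of _ "\<lambda>_. 0"] exI[of _ h] conjI assms)
qed

lemma lower_zero: "lower n (\<lambda>x. 0)"
  by (cases n) (auto simp: lower_0 lower_Suc sp_const')

lemma leading_rep_sum: "(\<And>i. i \<in> I \<Longrightarrow> leading_rep n (f i)) \<Longrightarrow> leading_rep n (\<lambda>x. \<Sum>i\<in>I. f i x)"
  by (induction I rule: infinite_finite_induct) (auto intro: leading_rep_add leading_rep_lower lower_zero)

lemma leading_rep_mono3: "m \<in> leading n \<Longrightarrow> leading_rep n (mono3 m)"
proof -
  assume m: "m \<in> leading n"
  have "mono3 m x = (\<Sum>k\<in>leading n. of_bool (k = m) * mono3 k x) + 0" for x
  proof -
    have "(\<Sum>k\<in>leading n. of_bool (k = m) * mono3 k x) = (\<Sum>k\<in>leading n. if k = m then mono3 m x else 0)"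
      by (intro sum.cong) auto
    thus ?thesis using m leading(1) by simp
  qed
  thus ?thesis unfolding leading_rep_def
    by (intro exI[of _ "\<lambda>k. of_bool (k = m)"] exI[of _ "\<lambda>x. 0"] conjI lower_zero) simp
qed

lemma leading_rep_coord_mono3:
  assumes m: "m \<in> leading n"
  shows "leading_rep (Suc n) (\<lambda>x. x $ k * mono3 m x)"
proof -
  obtain i j e where m': "m = (i, j, e)" by (cases m)
  have e: "e \<le> 1" "i + j + e = n" using m by (auto simp: m' leading_def)
  consider "k = 1" | "k = 2" | "k = 3" "e = 0" | "k = 3" "e = 1" using exhaust_3[of k] e(1) by force
  thus ?thesis
  proof cases
    case 1
    show ?thesis
      by (rule leading_rep_cong[OF leading_rep_mono3[of "(Suc i, j, e)"]]) (use e 1 in \<open>auto simp: leading_def mono3_def m'\<close>)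
  next
    case 2
    show ?thesis
      by (rule leading_rep_cong[OF leading_rep_mono3[of "(i, Suc j, e)"]]) (use e 2 in \<open>auto simp: leading_def mono3_def m'\<close>)
  next
    case 3
    show ?thesis
      by (rule leading_rep_cong[OF leading_rep_mono3[of "(i, j, 1)"]]) (use e 3 in \<open>auto simp: leading_def mono3_def m'\<close>)
  next
    case 4
    \<comment> \<open>Here the product contains the square of the third coordinate. Replacing it by
      1 - x^2 - y^2, the term 1 lowers the degree by two and goes into the remainder.\<close>
    have low: "lower (Suc n) (mono3 (i, j, 0))"
      unfolding lower_Suc using e 4 by (intro sp_mono[OF sp_mono3[of i j 0 "i + j"]]) (auto simp: leading_def)
    have r: "leading_rep (Suc n) (\<lambda>x. (mono3 (i, j, 0) x + (-1) * mono3 (Suc (Suc i), j, 0) x) + (-1) * mono3 (i, Suc (Suc j), 0) x)"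
      using e 4 by (intro leading_rep_add leading_rep_scale leading_rep_mono3 leading_rep_lower[OF low]) (auto simp: leading_def)
    show ?thesis
    proof (rule leading_rep_cong[OF r])
      fix x assume x: "x \<in> S2"
      have "x$3 * x$3 = 1 - x$1 * x$1 - x$2 * x$2" using S2_norm2[OF x] by simp
      hence "x $ 3 * mono3 (i, j, 1) x = (x$1)^i * (x$2)^j * (1 - x$1 * x$1 - x$2 * x$2)"
        by (simp add: mono3_def mult_ac)
      thus "mono3 (i, j, 0) x + (-1) * mono3 (Suc (Suc i), j, 0) x + (-1) * mono3 (i, Suc (Suc j), 0) x = x $ k * mono3 m x"
        using 4 by (simp add: m' mono3_def algebra_simps)
    qed
  qed
qed

lemma sp_leading_rep: "sp n f \<Longrightarrow> leading_rep n f"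
proof (induction rule: sp.induct)
  case (sp_const c)
  have "(0, 0, 0) \<in> leading 0" by (simp add: leading_def)
  from leading_rep_scale[OF leading_rep_mono3[OF this], of c] show ?case
    by (rule leading_rep_cong) (simp add: mono3_def)
next
  case (sp_add d f g) show ?case by (rule leading_rep_add[OF sp_add.IH])
next
  case (sp_coord d f i)
  then obtain c h where 1: "lower d h" "\<forall>x\<in>S2. f x = (\<Sum>m\<in>leading d. c m * mono3 m x) + h x"
    unfolding leading_rep_def by blast
  have "leading_rep (Suc d) (\<lambda>x. (\<Sum>m\<in>leading d. c m * (x $ i * mono3 m x)) + x $ i * h x)"
    by (intro leading_rep_add leading_rep_sum leading_rep_scale leading_rep_coord_mono3 leading_rep_lower)
       (auto simp: lower_Suc intro: lower_coord 1)
  thus ?case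
  proof (rule leading_rep_cong)
    fix x assume x: "x \<in> S2"
    show "(\<Sum>m\<in>leading d. c m * (x $ i * mono3 m x)) + x $ i * h x = x $ i * f x"
      unfolding 1(2)[rule_format, OF x] by (simp add: distrib_left sum_distrib_left mult.left_commute)
  qed
next
  case (sp_lift d f) thus ?case by (intro leading_rep_lower) (simp add: lower_Suc)
next
  case (sp_cong d f g) show ?case by (rule leading_rep_cong[OF sp_cong.IH sp_cong.hyps(2)])
qed

text \<open>Stage n spans the polynomials of degree below n. Gram-Schmidt on the leading monomials
  of degree n extends it to the next stage, so the increment is orthogonal to all lower
  degrees.\<close>

lemma exists_basis:
  "\<exists>B :: nat \<Rightarrow> (real^3 \<Rightarrow> real) set. B 0 = {} \<and> (\<forall>n. (finite (B n) \<and> orthonormal (B n) \<and> (\<forall>b\<in>B n. lower n b) \<and> (\<forall>f. lower n f \<longrightarrow> spanned (B n) f))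
    \<and> (B n \<subseteq> B (Suc n) \<and> card (B (Suc n) - B n) \<le> 2 * n + 1))"
proof -
  define P where "P n B \<longleftrightarrow> finite B \<and> orthonormal B \<and> (\<forall>b\<in>B. lower n b) \<and> (\<forall>f. lower n f \<longrightarrow> spanned B f) \<and> (n = 0 \<longrightarrow> B = {})" for n and B :: "(real^3 \<Rightarrow> real) set"
  define Q where "Q n B B' \<longleftrightarrow> B \<subseteq> B' \<and> card (B' - B) \<le> 2 * n + 1" for n and B B' :: "(real^3 \<Rightarrow> real) set"
  have "\<exists>B. \<forall>n. P n (B n) \<and> Q n (B n) (B (Suc n))"
  proof (rule dependent_nat_choice)
    show "\<exists>B. P 0 B"
      by (intro exI[of _ "{}"]) (simp add: P_def orthonormal_def lower_0 spanned_def)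
  next
    fix B n assume B: "P n B"
    have "\<exists>G. finite G \<and> card G \<le> card (mono3 ` leading n) \<and> (\<forall>b\<in>G. sp n b) \<and> B \<inter> G = {} \<and> orthonormal (B \<union> G) \<and> (\<forall>f\<in>mono3 ` leading n. spanned (B \<union> G) f)"
      using B sp_mono3 leading by (intro gram_schmidt) (auto simp: P_def intro: lower_sp)
    then obtain G where G: "finite G" "card G \<le> card (mono3 ` leading n)" "\<forall>b\<in>G. sp n b" "B \<inter> G = {}" "orthonormal (B \<union> G)"
      "\<forall>f\<in>mono3 ` leading n. spanned (B \<union> G) f" by blast
    have spB: "sp n b" if "b \<in> B \<union> G" for b using that B G lower_sp by (auto simp: P_def)
    have "spanned (B \<union> G) f" if f: "sp n f" for f
    proof -
      obtain c h where h: "lower n h" "\<forall>x\<in>S2. f x = (\<Sum>m\<in>leading n. c m * mono3 m x) + h x"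
        using sp_leading_rep[OF f] unfolding leading_rep_def by blast
      have "spanned B h" using B h by (simp add: P_def)
      hence "spanned (B \<union> G) h" using B G spB by (elim spanned_mono) (auto simp: P_def intro: sp_sqi)
      hence "spanned (B \<union> G) (\<lambda>x. (\<Sum>m\<in>leading n. c m * mono3 m x) + h x)"
      proof (intro spanned_add spanned_sum sqi_sum sqi_scale)
        fix m assume m: "m \<in> leading n"
        thus "spanned (B \<union> G) (mono3 m)" using G by blast
        have "sp n (mono3 m)" using m sp_mono3[of "fst m" "fst (snd m)" "snd (snd m)"] by simp
        thus "sqi surface (mono3 m)" "sqi surface (mono3 m)" by (auto intro: sp_sqi)
      qed (auto intro: sp_sqi spB lower_sp h)
      thus ?thesis by (rule spanned_cong) (rule h(2)[rule_format, symmetric])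
    qed
    moreover have "card ((B \<union> G) - B) \<le> 2 * n + 1"
    proof -
      have "(B \<union> G) - B = G" using G(4) by auto
      thus ?thesis using G(2) card_image_le[OF leading(1), of mono3 n] leading(2)[of n] by simp
    qed
    ultimately show "\<exists>B'. P (Suc n) B' \<and> Q n B B'"
      using B G spB by (intro exI[of _ "B \<union> G"]) (auto simp: P_def Q_def lower_Suc)
  qed
  then obtain B where "\<And>n. P n (B n) \<and> Q n (B n) (B (Suc n))" by blast
  thus ?thesis by (intro exI[of _ B]) (simp add: P_def Q_def)
qed

definition basis_seq :: "nat \<Rightarrow> (real^3 \<Rightarrow> real) set" where
  "basis_seq = (SOME B. B 0 = {} \<and> (\<forall>n. (finite (B n) \<and> orthonormal (B n) \<and> (\<forall>b\<in>B n. lower n b) \<and> (\<forall>f. lower n f \<longrightarrow> spanned (B n) f))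
    \<and> (B n \<subseteq> B (Suc n) \<and> card (B (Suc n) - B n) \<le> 2 * n + 1)))"

lemma
  shows basis_seq_0: "basis_seq 0 = {}" and basis_seq_finite: "finite (basis_seq n)"
    and basis_seq_on: "orthonormal (basis_seq n)" and basis_seq_lower: "b \<in> basis_seq n \<Longrightarrow> lower n b"
    and basis_seq_spanned: "lower n f \<Longrightarrow> spanned (basis_seq n) f"
    and basis_seq_Suc: "basis_seq n \<subseteq> basis_seq (Suc n)" and basis_seq_card: "card (basis_seq (Suc n) - basis_seq n) \<le> 2 * n + 1"
  using someI_ex[OF exists_basis, folded basis_seq_def] by auto

text \<open>An orthonormal basis of the spherical harmonics of degree \<open>d\<close>.\<close>

definition sharm :: "nat \<Rightarrow> (real^3 \<Rightarrow> real) set" where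
  "sharm d = basis_seq (Suc d) - basis_seq d"

lemma finite_sharm: "finite (sharm d)"
  by (simp add: sharm_def basis_seq_finite)

lemma card_sharm: "card (sharm d) \<le> 2 * d + 1"
  using basis_seq_card[of d] by (simp add: sharm_def)

lemma sharm_sp: "b \<in> sharm d \<Longrightarrow> sp d b"
  using basis_seq_lower[of b "Suc d"] by (simp add: sharm_def lower_Suc)

lemma basis_seq_mono: "m \<le> n \<Longrightarrow> basis_seq m \<subseteq> basis_seq n"
  by (rule lift_Suc_mono_le) (rule basis_seq_Suc)

lemma basis_seq_eq: "basis_seq n = (\<Union>d<n. sharm d)"
proof (induction n)
  case (Suc n)
  have "basis_seq (Suc n) = basis_seq n \<union> sharm n" using basis_seq_Suc[of n] by (auto simp: sharm_def)
  thus ?case using Suc by (simp add: lessThan_Suc Un_commute)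
qed (simp add: basis_seq_0)

lemma sharm_disjoint: "d \<noteq> e \<Longrightarrow> sharm d \<inter> sharm e = {}"
proof (induction d e rule: linorder_wlog)
  case (le d e)
  hence "basis_seq (Suc d) \<subseteq> basis_seq e" by (intro basis_seq_mono) simp
  thus ?case by (auto simp: sharm_def)
qed auto

lemma sharm_ip: 
  assumes "b \<in> sharm d" "c \<in> sharm e" shows "ip b c = of_bool (b = c)"
proof -
  have "b \<in> basis_seq (Suc (max d e))" "c \<in> basis_seq (Suc (max d e))"
    using assms basis_seq_mono[of "Suc d" "Suc (max d e)"] basis_seq_mono[of "Suc e" "Suc (max d e)"] by (auto simp: sharm_def)
  thus ?thesis using basis_seq_on by (simp add: orthonormal_def)
qed

lemma sharm_sqi: "b \<in> sharm d \<Longrightarrow> sqi surface b"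
  by (rule sp_sqi[OF sharm_sp])

lemma sharm_ip_lower:
  assumes b: "b \<in> sharm d" and f: "lower d f"
  shows "ip f b = 0"
proof -
  have "ip f b = ip (\<lambda>x. \<Sum>c\<in>basis_seq d. ip f c * c x) b"
    by (rule ip_cong[OF spannedD[OF basis_seq_spanned[OF f]] refl])
  also have "\<dots> = (\<Sum>c\<in>basis_seq d. ip f c * ip c b)"
    by (intro ip_sum sharm_sqi[OF b] sp_sqi[OF lower_sp[OF basis_seq_lower]])
  also have "\<dots> = 0"
  proof (intro sum.neutral ballI)
    fix c assume c: "c \<in> basis_seq d"
    then obtain e where "c \<in> sharm e" by (auto simp: basis_seq_eq)
    moreover have "c \<noteq> b" using b c by (auto simp: sharm_def)
    ultimately show "ip f c * ip c b = 0" using sharm_ip[of c e b d] b by simp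
  qed
  finally show ?thesis .
qed

lemma Lw_zero:
  assumes "\<And>x. x \<in> S2 \<Longrightarrow> f x = (0::real)" "x \<in> S2" shows "Lw w f x = 0"
  using Lw_cong[of f "\<lambda>x. 0" x w] assms S2_nonzero by simp

lemma lower_Lw: "lower d f \<Longrightarrow> lower d (Lw w f)"
  by (cases d) (auto simp: lower_0 lower_Suc sp_Lw intro: Lw_zero simp del: mem_sphere)

lemma lower_sum: "(\<And>i. i \<in> I \<Longrightarrow> lower d (f i)) \<Longrightarrow> lower d (\<lambda>x. \<Sum>i\<in>I. f i x)"
  by (induction I rule: infinite_finite_induct) (auto intro: lower_add lower_zero)

lemma lower_Lap: "lower d f \<Longrightarrow> lower d (Lap f)"
  unfolding Lap_def by (intro lower_sum lower_Lw)

lemma norm_axis1: "norm (axis a (1::real) :: real^3) = 1"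
  by simp

text \<open>Expand in the basis of all degrees up to \<open>d\<close>. For a basis element of lower
  degree skewness moves the derivative onto it, where it stays of lower degree and is orthogonal to
  \<open>b\<close>.\<close>

lemma sharm_Lw:
  assumes b: "b \<in> sharm d" and w: "norm w = 1" and x: "x \<in> S2"
  shows "Lw w b x = (\<Sum>c\<in>sharm d. ip (Lw w b) c * c x)"
proof -
  have "lower (Suc d) (Lw w b)" using sharm_sp[OF b] by (simp add: lower_Suc sp_Lw)
  hence "Lw w b x = (\<Sum>c\<in>basis_seq (Suc d). ip (Lw w b) c * c x)"
    by (rule spannedD[OF basis_seq_spanned x])
  also have "\<dots> = (\<Sum>c\<in>sharm d. ip (Lw w b) c * c x)"
  proof (intro sum.mono_neutral_right ballI)
    fix c assume "c \<in> basis_seq (Suc d) - sharm d"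
    hence c: "c \<in> basis_seq d" by (auto simp: sharm_def)
    have "ip (Lw w b) c = - ip b (Lw w c)"
      using c by (intro ip_Lw sp_smooth[OF sharm_sp[OF b]] sp_smooth[OF lower_sp[OF basis_seq_lower]] w)
    also have "ip b (Lw w c) = 0"
      using sharm_ip_lower[OF b lower_Lw[OF basis_seq_lower[OF c]]] by (metis ip_commute)
    finally show "ip (Lw w b) c * c x = 0" by simp
  qed (auto simp: sharm_def basis_seq_finite)
  finally show ?thesis .
qed

lemma ip_Lap:
  assumes "sp d f" "sp e g"
  shows "ip (Lap f) g = - (\<Sum>a\<in>UNIV. ip (La a f) (La a g))" "ip (Lap f) g = ip f (Lap g)"
proof -
  have sq: "sqi surface (La a (La a f))" "sqi surface (La a (La a g))" "sqi surface f" "sqi surface g" for a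
    using assms by (auto intro!: sp_sqi sp_Lw)
  have *: "ip (Lap f) g = (\<Sum>a\<in>UNIV. ip (La a (La a f)) g)"
    unfolding Lap_def using ip_sum[of UNIV "\<lambda>a. La a (La a f)" g "\<lambda>_. 1"] sq by simp
  also have "\<dots> = (\<Sum>a\<in>UNIV. - ip (La a f) (La a g))"
    by (intro sum.cong refl ip_Lw norm_axis1 sp_smooth[OF sp_Lw] sp_smooth) (rule assms)+
  finally show "ip (Lap f) g = - (\<Sum>a\<in>UNIV. ip (La a f) (La a g))" by (simp add: sum_negf)
  also have "\<dots> = (\<Sum>a\<in>UNIV. ip f (La a (La a g)))"
    unfolding sum_negf[symmetric]
    by (intro sum.cong refl) (subst ip_Lw[OF sp_smooth[OF assms(1)] sp_smooth[OF sp_Lw[OF assms(2)]] norm_axis1], simp)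
  also have "\<dots> = ip (Lap g) f"
    unfolding Lap_def using ip_sum[of UNIV "\<lambda>a. La a (La a g)" f "\<lambda>_. 1"] sq by (simp add: ip_commute[of f])
  finally show "ip (Lap f) g = ip f (Lap g)" by (simp add: ip_commute)
qed

text \<open>The remainder \<open>h\<close> from \<open>Lap_leading\<close> has lower degree, so it
  is orthogonal to \<open>b\<close> and, by self-adjointness, to \<open>Lap b\<close>. Being a
  combination of these two, it is orthogonal to itself.\<close>

lemma sharm_Lap:
  assumes b: "b \<in> sharm d" and x: "x \<in> S2"
  shows "Lap b x = - (real d * (real d + 1)) * b x"
proof -
  obtain h where h: "lower d h" "\<forall>x\<in>S2. Lap b x = - (real d * (real d + 1)) * b x + h x"
    using Lap_leading[OF sharm_sp[OF b]] by blast
  have Lb: "sp d (Lap b)" unfolding Lap_def by (intro sp_sum sp_Lw sharm_sp[OF b])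
  have "ip h h = ip (\<lambda>x. Lap b x + (real d * (real d + 1)) * b x) h"
    using h(2) by (intro ip_cong) auto
  also have "\<dots> = ip (Lap b) h + (real d * (real d + 1)) * ip b h"
    using Lb h(1) sharm_sqi[OF b] by (subst ip_add) (auto intro: sp_sqi sqi_scale lower_sp simp: ip_scale)
  also have "ip (Lap b) h = ip b (Lap h)" by (rule ip_Lap(2)[OF sharm_sp[OF b] lower_sp[OF h(1)]])
  also have "ip b (Lap h) = 0" using sharm_ip_lower[OF b lower_Lap[OF h(1)]] by (metis ip_commute)
  also have "ip b h = 0" using sharm_ip_lower[OF b h(1)] by (metis ip_commute)
  finally have "ip h h = 0" by simp
  hence "h x = 0" by (rule ip_definite[OF sp_cont[OF lower_sp[OF h(1)]] _ x])
  thus ?thesis using h(2) x by auto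
qed

lemma sharm_grad_ip:
  assumes "b \<in> sharm d" "c \<in> sharm e"
  shows "(\<Sum>a\<in>UNIV. ip (La a b) (La a c)) = real d * (real d + 1) * of_bool (b = c)"
proof -
  have "- (\<Sum>a\<in>UNIV. ip (La a b) (La a c)) = ip (Lap b) c"
    by (rule ip_Lap(1)[OF sharm_sp[OF assms(1)] sharm_sp[OF assms(2)], symmetric])
  also have "\<dots> = ip (\<lambda>x. - (real d * (real d + 1)) * b x) c"
    by (rule ip_cong[OF sharm_Lap[OF assms(1)] refl])
  also have "\<dots> = - (real d * (real d + 1) * of_bool (b = c))"
    unfolding ip_scale sharm_ip[OF assms] by simp
  finally show ?thesis by simp
qed

text \<open>The derivative kills the radial part of \<open>v\<close>, and the tangential part is (x
  cross v) cross x divided by |x|^2. Rotational derivatives thus carry the complete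
  derivative.\<close>

lemma frechet_radial_eq_Lw:
  assumes f: "sdiff f" and x: "x \<noteq> 0"
  shows "frechet_derivative (f \<circ> radial) (at x) v = Lw (inverse (x \<bullet> x) *\<^sub>R cross3 x v) f x"
proof -
  define D where "D = frechet_derivative (f \<circ> radial) (at x)"
  have hd: "((f \<circ> radial) has_derivative D) (at x)" unfolding D_def by (rule sdiff_deriv[OF f x])
  have lin: "linear D" using hd by (rule has_derivative_linear)
  have xx: "x \<bullet> x > 0" using x by simp
  have Dx: "D x = 0"
  proof -
    have "((\<lambda>t::real. (1 + t) *\<^sub>R x) has_derivative (\<lambda>t. t *\<^sub>R x)) (at 0)"
      by (auto intro!: derivative_eq_intros)
    moreover have "((f \<circ> radial) has_derivative D) (at ((\<lambda>t::real. (1 + t) *\<^sub>R x) 0))" using hd by simp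
    ultimately have "(((f \<circ> radial) \<circ> (\<lambda>t::real. (1 + t) *\<^sub>R x)) has_derivative (D \<circ> (\<lambda>t. t *\<^sub>R x))) (at 0)"
      by (rule diff_chain_at)
    moreover have "(((f \<circ> radial) \<circ> (\<lambda>t::real. (1 + t) *\<^sub>R x)) has_derivative (\<lambda>t. 0)) (at 0)"
    proof (rule has_derivative_transform_within_open[where s = "ball 0 1"])
      show "((\<lambda>t::real. f (radial x)) has_derivative (\<lambda>t. 0)) (at 0)" by simp
      show "f (radial x) = ((f \<circ> radial) \<circ> (\<lambda>t::real. (1 + t) *\<^sub>R x)) t" if "t \<in> ball 0 1" for t
        using that by (simp add: radial_scaleR abs_less_iff)
    qed auto
    ultimately have "D \<circ> (\<lambda>t. t *\<^sub>R x) = (\<lambda>t. 0)" by (rule has_derivative_unique)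
    from fun_cong[OF this, of 1] show ?thesis by simp
  qed
  have "inverse (x \<bullet> x) *\<^sub>R cross3 (cross3 x v) x = v - (inverse (x \<bullet> x) * (x \<bullet> v)) *\<^sub>R x"
  proof -
    have "cross3 (cross3 x v) x = (x \<bullet> x) *\<^sub>R v - (x \<bullet> v) *\<^sub>R x"
      using Lagrange[of x x v] cross_skew[of "cross3 x v" x] by simp
    thus ?thesis using xx by (simp add: scaleR_diff_right)
  qed
  hence "D (cross3 (inverse (x \<bullet> x) *\<^sub>R cross3 x v) x) = D (v - (inverse (x \<bullet> x) * (x \<bullet> v)) *\<^sub>R x)"
    by (simp add: cross_mult_left)
  also have "\<dots> = D v" by (simp add: linear_diff[OF lin] linear_scale[OF lin] Dx)
  finally show ?thesis by (simp add: Lw_def D_def)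
qed

lemma Lw_expand:
  assumes "sdiff f" "x \<noteq> 0"
  shows "Lw w f x = (\<Sum>a\<in>UNIV. (w $ a) *\<^sub>R Lw (axis a 1) f x)"
proof -
  have "w = 1 *\<^sub>R (1 *\<^sub>R (w $ 1 *\<^sub>R axis 1 1) + w $ 2 *\<^sub>R axis 2 1) + w $ 3 *\<^sub>R axis 3 1"
    using exhaust_3 by (auto simp: vec_eq_iff axis_def) 
  also have "Lw \<dots> f x = 1 *\<^sub>R Lw (1 *\<^sub>R (w $ 1 *\<^sub>R axis 1 1) + w $ 2 *\<^sub>R axis 2 1) f x + w $ 3 *\<^sub>R Lw (axis 3 1) f x"
    by (rule Lw_direction[OF assms])
  also have "Lw (1 *\<^sub>R (w $ 1 *\<^sub>R axis 1 1) + w $ 2 *\<^sub>R axis 2 1) f x = 1 *\<^sub>R Lw (w $ 1 *\<^sub>R axis 1 1) f x + w $ 2 *\<^sub>R Lw (axis 2 1) f x"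
    by (rule Lw_direction[OF assms])
  also have "Lw (w $ 1 *\<^sub>R axis 1 1) f x = w $ 1 *\<^sub>R Lw (axis 1 1) f x"
    using Lw_direction[OF assms, of "w $ 1" "axis 1 1" 0 0] by simp
  finally show ?thesis by (simp add: sum_3)
qed

text \<open>If all rotational derivatives vanish, so does the full derivative of
  \<open>f \<circ> radial\<close>, and the punctured space is connected.\<close>

lemma constant_on_S2:
  fixes f :: "real^3 \<Rightarrow> real"
  assumes f: "smooth_on_S2 f" and z: "\<And>a x. x \<in> S2 \<Longrightarrow> La a f x = 0"
  obtains c where "\<And>x. x \<in> S2 \<Longrightarrow> f x = c"
proof -
  note sd = smooth_sdiff[OF f]
  have der: "((f \<circ> radial) has_derivative (\<lambda>h. 0)) (at x)" if x: "x \<noteq> 0" for x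
  proof -
    have "frechet_derivative (f \<circ> radial) (at x) v = 0" for v
    proof -
      have "La a f x = 0" for a
        using Lw_radial[OF sd x] z[OF radial_in_S2[OF x]] by metis
      thus ?thesis unfolding frechet_radial_eq_Lw[OF sd x] by (subst Lw_expand[OF sd x]) simp
    qed
    hence "frechet_derivative (f \<circ> radial) (at x) = (\<lambda>h. 0)" by (simp add: fun_eq_iff)
    thus ?thesis using sdiff_deriv[OF sd x] by simp
  qed
  have "(f \<circ> radial) constant_on punctured"
  proof (rule has_derivative_zero_connected_constant_on[where K = "{}"])
    have "connected (- {0::real^3})" by (rule connected_punctured_universe) simp
    thus "connected punctured" by (simp add: Compl_eq_Diff_UNIV)
    show "continuous_on punctured (f \<circ> radial)"
      using der by (intro continuous_at_imp_continuous_on ballI has_derivative_continuous) auto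
    show "\<forall>x\<in>punctured - {}. ((f \<circ> radial) has_derivative (\<lambda>h. 0)) (at x within punctured)"
      using der by (auto intro: has_derivative_at_withinI)
  qed (auto simp: open_punctured)
  then obtain c where "\<And>x. x \<in> punctured \<Longrightarrow> (f \<circ> radial) x = c" by (auto simp: constant_on_def)
  hence "f x = c" if "x \<in> S2" for x using that S2_nonzero[OF that] by fastforce
  thus ?thesis using that by blast
qed

text \<open>The matrix of \<open>Lw w\<close> on the harmonics of degree \<open>d\<close> is skew, so \<open>\<Sum>b\<^sup>2\<close> is annihilated by all \<open>Lw w\<close>.\<close>

lemma sharm_sum_sq_La:
  assumes x: "x \<in> S2"
  shows "La a (\<lambda>x. \<Sum>b\<in>sharm d. b x * b x) x = 0"
proof -
  have sm: "smooth_on_S2 b" if "b \<in> sharm d" for b by (rule sp_smooth[OF sharm_sp[OF that]])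
  define M where "M b c = ip (La a b) c" for b c
  have skew: "M b c = - M c b" if "b \<in> sharm d" "c \<in> sharm d" for b c
    using ip_Lw[OF sm[OF that(1)] sm[OF that(2)] norm_axis1[of a]] ip_commute unfolding M_def by metis
  have "La a (\<lambda>x. \<Sum>b\<in>sharm d. b x * b x) x = (\<Sum>b\<in>sharm d. La a (\<lambda>x. b x * b x) x)"
    by (intro Lw_sum smooth_mult sm S2_nonzero[OF x])
  also have "\<dots> = (\<Sum>b\<in>sharm d. 2 * (b x * La a b x))"
    by (intro sum.cong refl) (simp add: Lw_mult[OF smooth_sdiff[OF sm] smooth_sdiff[OF sm] x])
  also have "\<dots> = (\<Sum>b\<in>sharm d. 2 * (b x * (\<Sum>c\<in>sharm d. M b c * c x)))"
    by (intro sum.cong refl) (simp add: sharm_Lw[OF _ norm_axis1 x] M_def)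
  also have "\<dots> = 2 * (\<Sum>b\<in>sharm d. \<Sum>c\<in>sharm d. M b c * (b x * c x))" (is "_ = 2 * ?S")
    by (simp add: sum_distrib_left algebra_simps)
  also have "?S = - ?S"
  proof -
    have "?S = (\<Sum>c\<in>sharm d. \<Sum>b\<in>sharm d. M b c * (b x * c x))"
      by (rule sum.swap)
    also have "\<dots> = (\<Sum>c\<in>sharm d. \<Sum>b\<in>sharm d. - (M c b * (c x * b x)))"
      by (intro sum.cong refl) (subst skew, auto)
    finally show ?thesis by (simp only: sum_negf)
  qed
  hence "?S = 0" by linarith
  finally show ?thesis by simp
qed

text \<open>The addition theorem on the diagonal: the sum is constant by
  \<open>sharm_sum_sq_La\<close>, and its integral counts the basis elements.\<close>

lemma sharm_sum_sq:
  assumes x: "x \<in> S2"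
  shows "(\<Sum>b\<in>sharm d. b x * b x) = real (card (sharm d)) / (4 * pi)"
proof -
  interpret finite_measure surface by (rule finite_measure_surface)
  have sm: "smooth_on_S2 (\<lambda>x. \<Sum>b\<in>sharm d. b x * b x)"
    by (intro smooth_sum smooth_mult sp_smooth[OF sharm_sp])
  obtain c where c: "\<And>x. x \<in> S2 \<Longrightarrow> (\<Sum>b\<in>sharm d. b x * b x) = c"
    by (rule constant_on_S2[OF sm sharm_sum_sq_La]) (assumption, blast)
  have "4 * pi * c = (LINT x|surface. c)" by (simp add: space_surface measure_surface)
  also have "\<dots> = (LINT x|surface. (\<Sum>b\<in>sharm d. b x * b x))"
    by (intro Bochner_Integration.integral_cong refl) (simp only: space_surface c)
  also have "\<dots> = (\<Sum>b\<in>sharm d. ip b b)"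
    unfolding ip_def by (intro Bochner_Integration.integral_sum ip_integrable sharm_sqi)
  also have "\<dots> = real (card (sharm d))" by (simp add: sharm_ip)
  finally show ?thesis using c[OF x] by (simp add: field_simps)
qed

text \<open>The Laplacian of the constant sum of b^2 is zero. The product rule splits it into twice
  the sum of squared derivatives plus twice the sum of \<open>b x * Lap b x\<close>, and the latter
  is known from \<open>sharm_Lap\<close>.\<close>

lemma sharm_sum_grad_sq:
  assumes x: "x \<in> S2"
  shows "(\<Sum>b\<in>sharm d. \<Sum>a\<in>UNIV. (La a b x)\<^sup>2) = real d * (real d + 1) * (real (card (sharm d)) / (4 * pi))"
proof -
  have sm: "smooth_on_S2 b" if "b \<in> sharm d" for b by (rule sp_smooth[OF sharm_sp[OF that]])
  have "La a (La a (\<lambda>x. b x * b x)) x = 2 * (La a b x)\<^sup>2 + 2 * (b x * La a (La a b) x)" if "b \<in> sharm d" for a b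
    using Lw_Lw_mult[OF sm[OF that] sm[OF that] x] by (simp add: power2_eq_square)
  note 1 = this
  have "0 = La a (La a (\<lambda>x. \<Sum>b\<in>sharm d. b x * b x)) x" for a
    by (rule Lw_zero[OF sharm_sum_sq_La x, symmetric])
  also have "La a (La a (\<lambda>x. \<Sum>b\<in>sharm d. b x * b x)) x = La a (\<lambda>x. \<Sum>b\<in>sharm d. La a (\<lambda>x. b x * b x) x) x" for a
    by (rule Lw_cong[OF Lw_sum S2_nonzero[OF x]]) (intro smooth_mult sm S2_nonzero | assumption)+
  also have "\<dots> a = (\<Sum>b\<in>sharm d. La a (La a (\<lambda>x. b x * b x)) x)" for a
    by (intro Lw_sum smooth_Lw smooth_mult sm S2_nonzero[OF x])
  finally have "0 = (\<Sum>b\<in>sharm d. 2 * (La a b x)\<^sup>2 + 2 * (b x * La a (La a b) x))" for a using 1 by simp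
  hence "0 = (\<Sum>a\<in>UNIV. \<Sum>b\<in>sharm d. 2 * (La a b x)\<^sup>2 + 2 * (b x * La a (La a b) x))" by simp
  also have "\<dots> = (\<Sum>b\<in>sharm d. \<Sum>a\<in>UNIV. 2 * (La a b x)\<^sup>2 + 2 * (b x * La a (La a b) x))" by (rule sum.swap)
  also have "\<dots> = (\<Sum>b\<in>sharm d. 2 * (\<Sum>a\<in>UNIV. (La a b x)\<^sup>2) + 2 * (b x * Lap b x))"
    by (simp only: sum.distrib sum_distrib_left Lap_def)
  also have "\<dots> = 2 * (\<Sum>b\<in>sharm d. \<Sum>a\<in>UNIV. (La a b x)\<^sup>2) - 2 * (real d * (real d + 1) * (\<Sum>b\<in>sharm d. b x * b x))"
    by (simp add: sharm_Lap[OF _ x] sum.distrib sum_distrib_left algebra_simps sum_subtractf sum_negf)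
  finally show ?thesis unfolding sharm_sum_sq[OF x] by simp
qed

section \<open>Solenoidal fields\<close>

lemma cross3_Jacobi: "cross3 w (cross3 v x) - cross3 v (cross3 w x) = - cross3 (cross3 v w) x"
  using cross_skew[of "cross3 v w" x] by (simp add: Lagrange inner_commute)

lemma Lw_Lw_add:
  assumes f: "smooth_on_S2 f" "smooth_on_S2 g" and x: "x \<in> S2"
  shows "Lw w (Lw v (\<lambda>x. f x + g x)) x = Lw w (Lw v f) x + Lw w (Lw v g) x"
proof -
  have "Lw w (Lw v (\<lambda>x. f x + g x)) x = Lw w (\<lambda>x. Lw v f x + Lw v g x) x"
    by (rule Lw_cong[OF Lw_add S2_nonzero[OF x]]) (intro smooth_sdiff f S2_nonzero | assumption)+
  also have "\<dots> = Lw w (Lw v f) x + Lw w (Lw v g) x"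
    by (intro Lw_add smooth_sdiff smooth_Lw f S2_nonzero[OF x])
  finally show ?thesis .
qed

text \<open>For coordinates this is the Jacobi identity of the cross product. A commutator of
  derivations is again a derivation, so the relation extends to products.\<close>

lemma Lw_commutator:
  "sp d f \<Longrightarrow> x \<in> S2 \<Longrightarrow> Lw v (Lw w f) x - Lw w (Lw v f) x = - Lw (cross3 v w) f x"
proof (induction arbitrary: x rule: sp.induct)
  case (sp_const c)
  have "Lw w (\<lambda>x. c) = (\<lambda>x. 0 :: real)" for w by (simp add: fun_eq_iff)
  thus ?case by simp
next
  case (sp_add d f g)
  note s = sp_smooth[OF sp_add.hyps(1)] sp_smooth[OF sp_add.hyps(2)]
  show ?case
    unfolding Lw_Lw_add[OF s sp_add.prems] Lw_add[OF smooth_sdiff[OF s(1)] smooth_sdiff[OF s(2)] S2_nonzero[OF sp_add.prems]]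
    using sp_add.IH[OF sp_add.prems] by simp
next
  case (sp_coord d f i)
  note s = sp_smooth[OF sp_coord.hyps]
  note x = sp_coord.prems
  have "Lw v (Lw w (\<lambda>x. x $ i * f x)) x - Lw w (Lw v (\<lambda>x. x $ i * f x)) x
    = x $ i * (Lw v (Lw w f) x - Lw w (Lw v f) x) + (cross3 w (cross3 v x) - cross3 v (cross3 w x)) $ i * f x"
    unfolding Lw_Lw_mult[OF smooth_coord s x] Lw_coord[OF x] Lw_Lw_coord[OF x]
    by (simp add: algebra_simps)
  also have "\<dots> = - (x $ i * Lw (cross3 v w) f x + cross3 (cross3 v w) x $ i * f x)"
    unfolding sp_coord.IH[OF x] cross3_Jacobi by simp
  also have "\<dots> = - Lw (cross3 v w) (\<lambda>x. x $ i * f x) x"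
    unfolding Lw_mult[OF smooth_sdiff[OF smooth_coord] smooth_sdiff[OF s] x] Lw_coord[OF x] ..
  finally show ?case .
next
  case (sp_lift d f) thus ?case by simp
next
  case (sp_cong d f g)
  have 1: "Lw a f y = Lw a g y" if "y \<in> S2" for a y by (rule Lw_cong[OF sp_cong.hyps(2) S2_nonzero[OF that]])
  have "Lw b (Lw a f) x = Lw b (Lw a g) x" for a b by (rule Lw_cong[OF 1 S2_nonzero[OF sp_cong.prems]])
  thus ?case using sp_cong.IH[OF sp_cong.prems] 1[OF sp_cong.prems] by simp
qed

text \<open>This is \<open>x\<close> cross the surface gradient of \<open>f\<close>, that is, the
  gradient after a quarter turn.\<close>

definition LL :: "(real^3 \<Rightarrow> real) \<Rightarrow> real^3 \<Rightarrow> real^3" where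
  "LL f x = (\<chi> a. La a f x)"

lemma LL_component [simp]: "LL f x $ a = La a f x"
  by (simp add: LL_def)

lemma Lw_eq_LL: "sp d f \<Longrightarrow> x \<in> S2 \<Longrightarrow> Lw w f x = w \<bullet> LL f x"
  by (subst Lw_expand[OF sp_sdiff S2_nonzero]) (auto simp: inner_vec_def)

lemma LL_normal: "sp d f \<Longrightarrow> x \<in> S2 \<Longrightarrow> x \<bullet> LL f x = 0"
  unfolding Lw_eq_LL[symmetric] using linear_0[OF has_derivative_linear[OF sdiff_deriv[OF sp_sdiff S2_nonzero]]]
  by (simp add: Lw_def)

lemma LL_cont: "sp d f \<Longrightarrow> continuous_on S2 (LL f)"
  unfolding LL_def by (intro continuous_on_vec_lambda sp_cont[OF sp_Lw])

text \<open>Here \<open>p\<close> stands for \<open>LL f x\<close> and \<open>q c $ e\<close> for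
  the iterated derivative \<open>La c (La e f) x\<close>. The hypothesis on
  \<open>q c $ e - q e $ c\<close> is the commutator relation, the one on
  \<open>x \<bullet> q c\<close> comes from differentiating the tangency of \<open>LL f\<close>.
  From these the claim is an ideal membership in each coordinate.\<close>

lemma angular_algebra:
  fixes x u p :: "real^3" and q :: "3 \<Rightarrow> real^3"
  assumes h1: "x \<bullet> x = 1" and h2: "u \<bullet> x = 0" and h3: "x \<bullet> p = 0"
    and h4: "\<And>c e. q c $ e - q e $ c = - (cross3 (axis c 1) (axis e 1) \<bullet> p)"
    and h5: "\<And>c. x \<bullet> q c = - (cross3 (axis c 1) x \<bullet> p)"
  shows "(\<Sum>c\<in>UNIV. u $ c * q c $ a) = u $ a * (\<Sum>c\<in>UNIV. q c $ c)
      + (\<Sum>c\<in>UNIV. cross3 x u $ c * (cross3 (cross3 (axis c 1) x) p $ a + cross3 x (q c) $ a))"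
proof -
  have g1: "x$1*x$1+x$2*x$2+x$3*x$3 = 1" and g2: "u$1*x$1+u$2*x$2+u$3*x$3=0" and g3: "x$1*p$1+x$2*p$2+x$3*p$3=0"
    using h1 h2 h3 by (simp_all add: inner_vec_def sum_3)
  have g4: "q 1$2-q 2$1=-p$3" "q 2$3-q 3$2=-p$1" "q 3$1-q 1$3=-p$2"
    using h4[of 1 2] h4[of 2 3] h4[of 3 1] by (simp_all add: cross_basis inner_axis')
  have g5: "x$1*q 1$1+x$2*q 1$2+x$3*q 1$3 = x$3*p$2-x$2*p$3" "x$1*q 2$1+x$2*q 2$2+x$3*q 2$3 = x$1*p$3 - x$3*p$1"
    "x$1*q 3$1+x$2*q 3$2+x$3*q 3$3 = x$2*p$1-x$1*p$2"
    using h5[of 1] h5[of 2] h5[of 3] by (simp_all add: inner_vec_def sum_3 cross3_def axis_def)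
  note g = g1 g2 g3 g4 g5
  consider "a = 1" | "a = 2" | "a = 3" using exhaust_3 by blast
  thus ?thesis
  proof cases
    case 1
    show ?thesis unfolding 1 sum_3 by (simp add: cross3_def axis_def) (use g in algebra)
  next
    case 2
    show ?thesis unfolding 2 sum_3 by (simp add: cross3_def axis_def) (use g in algebra)
  next
    case 3
    show ?thesis unfolding 3 sum_3 by (simp add: cross3_def axis_def) (use g in algebra)
  qed
qed

lemma sp_cross_LL: "sp d f \<Longrightarrow> sp (Suc d) (\<lambda>x. cross3 x (LL f x) $ a)"
proof -
  assume f: "sp d f"
  have "sp (Suc d) (\<lambda>x. x $ i * La j f x - x $ k * La l f x)" for i j k l
    by (intro sp_diff sp_coord sp_Lw f)
  thus ?thesis using exhaust_3[of a] by (auto simp: cross3_def)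
qed

lemma La_cross_LL:
  assumes f: "sp d f" and x: "x \<in> S2"
  shows "Lw w (\<lambda>x. cross3 x (LL f x) $ a) x = cross3 (cross3 w x) (LL f x) $ a + cross3 x (\<chi> e. Lw w (La e f) x) $ a"
proof -
  have "Lw w (\<lambda>x. x $ i * La j f x - x $ k * La l f x) x
    = (x $ i * Lw w (La j f) x + cross3 w x $ i * La j f x) - (x $ k * Lw w (La l f) x + cross3 w x $ k * La l f x)" for i j k l
  proof -
    have m: "Lw w (\<lambda>x. x $ i * La j f x) x = x $ i * Lw w (La j f) x + cross3 w x $ i * La j f x" for i j
      using Lw_mult[OF smooth_sdiff[OF smooth_coord] sp_sdiff[OF sp_Lw[OF f]] x] Lw_coord[OF x] by simp
    have "Lw w (\<lambda>x. x $ i * La j f x + (- 1) * (x $ k * La l f x)) x = Lw w (\<lambda>x. x $ i * La j f x) x + Lw w (\<lambda>x. (- 1) * (x $ k * La l f x)) x"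
      by (intro Lw_add sp_sdiff[OF sp_coord[OF sp_Lw[OF f]]] sp_sdiff[OF sp_scale[OF sp_coord[OF sp_Lw[OF f]]]] S2_nonzero[OF x])
    also have "Lw w (\<lambda>x. (- 1) * (x $ k * La l f x)) x = (- 1) * Lw w (\<lambda>x. x $ k * La l f x) x"
      by (intro Lw_linear[where T = "\<lambda>y. (- 1) * y"] bounded_linear_mult_right sp_sdiff[OF sp_coord[OF sp_Lw[OF f]]] S2_nonzero[OF x])
    finally show ?thesis by (simp add: m)
  qed
  thus ?thesis using exhaust_3[of a] by (auto simp: cross3_def)
qed

text \<open>The pointwise source of \<open>solenoidal_coeff\<close>. The left side tests the
  rotation of \<open>u\<close> against \<open>La a f\<close>. The last term tests its divergence
  against a component of \<open>cross3 x (LL f x)\<close>, which is minus the surface gradient, so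
  for a solenoidal field it integrates to zero.\<close>

lemma angular_identity:
  assumes f: "sp d f" and x: "x \<in> S2" and u: "u \<bullet> x = 0"
  shows "u \<bullet> LL (La a f) x = u $ a * Lap f x + cross3 x u \<bullet> LL (\<lambda>x. cross3 x (LL f x) $ a) x"
proof -
  define q where "q c = (\<chi> e. La c (La e f) x)" for c :: 3
  have "(\<Sum>c\<in>UNIV. u $ c * q c $ a) = u $ a * (\<Sum>c\<in>UNIV. q c $ c)
      + (\<Sum>c\<in>UNIV. cross3 x u $ c * (cross3 (cross3 (axis c 1) x) (LL f x) $ a + cross3 x (q c) $ a))"
  proof (rule angular_algebra[OF S2_inner[OF x] u LL_normal[OF f x]])
    show "q c $ e - q e $ c = - (cross3 (axis c 1) (axis e 1) \<bullet> LL f x)" for c e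
      using Lw_commutator[OF f x] by (simp add: q_def Lw_eq_LL[OF f x])
    show "x \<bullet> q c = - (cross3 (axis c 1) x \<bullet> LL f x)" for c
    proof -
      have "0 = La c (\<lambda>x. \<Sum>e\<in>UNIV. x $ e * La e f x) x"
        by (rule Lw_zero[symmetric, OF _ x]) (use LL_normal[OF f] in \<open>simp add: inner_vec_def\<close>)
      also have "\<dots> = (\<Sum>e\<in>UNIV. La c (\<lambda>x. x $ e * La e f x) x)"
        by (intro Lw_sum sp_smooth[OF sp_coord[OF sp_Lw[OF f]]] S2_nonzero[OF x])
      also have "\<dots> = (\<Sum>e\<in>UNIV. x $ e * La c (La e f) x + cross3 (axis c 1) x $ e * La e f x)"
        using Lw_mult[OF smooth_sdiff[OF smooth_coord] sp_sdiff[OF sp_Lw[OF f]] x] Lw_coord[OF x] by simp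
      also have "\<dots> = x \<bullet> q c + cross3 (axis c 1) x \<bullet> LL f x"
        by (simp add: inner_vec_def q_def sum.distrib)
      finally show ?thesis by simp
    qed
  qed
  thus ?thesis by (simp add: q_def Lap_def inner_vec_def La_cross_LL[OF f x])
qed

lemma sqi_cross:
  assumes "sqi surface U" shows "sqi surface (\<lambda>x. cross3 x (U x))"
proof (rule sqi_dominated(1)[OF assms, where C = 1])
  show "(\<lambda>x. cross3 x (U x)) \<in> borel_measurable surface"
  proof (rule borel_measurable_continuous_Pair[where H = cross3 and f = "\<lambda>x. x" and g = U])
    show "continuous_on UNIV (\<lambda>x. cross3 (fst x) (snd x))"
      by (intro continuous_on_cross continuous_intros)
  qed (use assms in \<open>auto simp: sqi_def intro: borel_measurable_surface\<close>)
  fix x assume "x \<in> space surface"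
  hence "norm x = 1" by (simp add: space_surface)
  hence "(norm (cross3 x (U x)))\<^sup>2 + (x \<bullet> U x)\<^sup>2 = (norm (U x))\<^sup>2"
    using norm_cross_dot[of x "U x"] by simp
  hence "(norm (cross3 x (U x)))\<^sup>2 \<le> (norm (U x))\<^sup>2"
    using zero_le_power2[of "x \<bullet> U x"] by linarith
  thus "norm (cross3 x (U x)) \<le> 1 * norm (U x)" by (simp add: power2_le_iff_abs_le)
qed

lemma LL_sqi: "sp d f \<Longrightarrow> sqi surface (LL f)"
  by (rule sqi_continuous[OF LL_cont])

text \<open>
  \<open>U\<close> is a square integrable tangent field with \<open>div U = 0\<close> and \<open>rot U = W\<close>, tested against polynomials.
\<close>

definition solenoidal :: "(real^3 \<Rightarrow> real^3) \<Rightarrow> (real^3 \<Rightarrow> real) \<Rightarrow> bool" where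
  "solenoidal U W \<longleftrightarrow> sqi surface U \<and> sqi surface W \<and> (AE x in surface. U x \<bullet> x = 0) \<and>
     (\<forall>d f. sp d f \<longrightarrow> (LINT x|surface. cross3 x (U x) \<bullet> LL f x) = 0) \<and>
     (\<forall>d f. sp d f \<longrightarrow> ip W f = - (LINT x|surface. U x \<bullet> LL f x))"

lemma solenoidalD:
  assumes "solenoidal U W"
  shows "sqi surface U" "sqi surface W" "AE x in surface. U x \<bullet> x = 0"
    "sp d f \<Longrightarrow> (LINT x|surface. cross3 x (U x) \<bullet> LL f x) = 0"
    "sp d f \<Longrightarrow> ip W f = - (LINT x|surface. U x \<bullet> LL f x)"
  using assms by (auto simp: solenoidal_def)

lemma sqi_vec_nth: "sqi M U \<Longrightarrow> sqi M (\<lambda>x. (U x :: real^3) $ a)"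
  using sqi_component[of M U "axis a 1"] by (simp add: inner_axis)

text \<open>The weak form of \<open>L\<^sup>2 U\<^sub>a = L\<^sub>a W\<close>.\<close>

lemma solenoidal_coeff:
  assumes S: "solenoidal U W" and b: "b \<in> sharm d"
  shows "real d * (real d + 1) * ip (\<lambda>x. U x $ a) b = ip W (La a b)"
proof -
  note s = solenoidalD[OF S]
  have spb: "sp d b" by (rule sharm_sp[OF b])
  have g: "sp (Suc d) (\<lambda>x. cross3 x (LL b x) $ a)" by (rule sp_cross_LL[OF spb])
  have Lb: "sp d (Lap b)" unfolding Lap_def by (intro sp_sum sp_Lw spb)
  have i1: "integrable surface (\<lambda>x. U x $ a * Lap b x)"
    by (intro ip_integrable sqi_vec_nth s(1) sp_sqi[OF Lb])
  have i2: "integrable surface (\<lambda>x. cross3 x (U x) \<bullet> LL (\<lambda>x. cross3 x (LL b x) $ a) x)"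
    by (intro sqi_inner_integrable sqi_cross s(1) LL_sqi[OF g])
  have "ip W (La a b) = - (LINT x|surface. U x \<bullet> LL (La a b) x)"
    by (rule s(5)[OF sp_Lw[OF spb]])
  also have "(LINT x|surface. U x \<bullet> LL (La a b) x)
     = (LINT x|surface. U x $ a * Lap b x + cross3 x (U x) \<bullet> LL (\<lambda>x. cross3 x (LL b x) $ a) x)"
  proof (rule integral_cong_AE)
    show "(\<lambda>x. U x \<bullet> LL (La a b) x) \<in> borel_measurable surface"
      using sqi_inner_integrable[OF s(1) LL_sqi[OF sp_Lw[OF spb]]] by (rule borel_measurable_integrable)
    show "(\<lambda>x. U x $ a * Lap b x + cross3 x (U x) \<bullet> LL (\<lambda>x. cross3 x (LL b x) $ a) x) \<in> borel_measurable surface"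
      using i1 i2 by auto
    show "AE x in surface. U x \<bullet> LL (La a b) x = U x $ a * Lap b x + cross3 x (U x) \<bullet> LL (\<lambda>x. cross3 x (LL b x) $ a) x"
      using s(3) AE_space by eventually_elim (simp only: space_surface angular_identity[OF spb])
  qed
  also have "\<dots> = ip (\<lambda>x. U x $ a) (Lap b)"
    using i1 i2 s(4)[OF g] by (simp add: ip_def)
  also have "\<dots> = ip (Lap b) (\<lambda>x. U x $ a)" by (rule ip_commute)
  also have "\<dots> = ip (\<lambda>x. - (real d * (real d + 1)) * b x) (\<lambda>x. U x $ a)"
    by (rule ip_cong[OF sharm_Lap[OF b] refl])
  also have "\<dots> = - (real d * (real d + 1)) * ip b (\<lambda>x. U x $ a)" by (rule ip_scale)
  finally show ?thesis by (simp add: ip_commute[of b])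
qed

lemma sp_0: "sp d f \<Longrightarrow> d = 0 \<Longrightarrow> \<exists>c. \<forall>x\<in>S2. f x = c"
proof (induction rule: sp.induct)
  case (sp_add d f g)
  then obtain c c' where "\<forall>x\<in>S2. f x = c" "\<forall>x\<in>S2. g x = c'" by blast
  thus ?case by (intro exI[of _ "c + c'"]) simp
next
  case (sp_cong d f g) thus ?case by metis
qed auto

text \<open>At eigenvalue 0 \<open>solenoidal_coeff\<close> gives no information. However,
  \<open>U x $ a\<close> is the derivative of the coordinate function along \<open>U\<close>, so
  testing the divergence with that coordinate shows mean zero.\<close>

lemma solenoidal_coeff_0:
  fixes a :: 3
  assumes S: "solenoidal U W" and b: "b \<in> sharm 0"
  shows "ip (\<lambda>x. U x $ a) b = 0"
proof -
  note s = solenoidalD[OF S]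
  obtain c where c: "\<And>x. x \<in> S2 \<Longrightarrow> b x = c" using sp_0[OF sharm_sp[OF b]] by blast
  have co: "sp (Suc 0) (\<lambda>x. x $ a)" using sp_coord[OF sp_const[of 1], of a] by simp
  have "(LINT x|surface. U x $ a) = (LINT x|surface. cross3 x (U x) \<bullet> LL (\<lambda>x. x $ a) x)"
  proof (rule integral_cong_AE)
    show "(\<lambda>x. U x $ a) \<in> borel_measurable surface" by (rule sqi_measurable[OF sqi_vec_nth[OF s(1)]])
    show "(\<lambda>x. cross3 x (U x) \<bullet> LL (\<lambda>x. x $ a) x) \<in> borel_measurable surface"
      using sqi_inner_integrable[OF sqi_cross[OF s(1)] LL_sqi[OF co]] by (rule borel_measurable_integrable)
    show "AE x in surface. U x $ a = cross3 x (U x) \<bullet> LL (\<lambda>x. x $ a) x"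
      using s(3) AE_space
    proof eventually_elim
      fix x assume u: "U x \<bullet> x = 0" and "x \<in> space surface"
      hence x: "x \<in> S2" by (simp only: space_surface)
      have "cross3 x (U x) \<bullet> LL (\<lambda>x. x $ a) x = Lw (cross3 x (U x)) (\<lambda>x. x $ a) x"
        by (rule Lw_eq_LL[OF co x, symmetric])
      also have "\<dots> = cross3 (cross3 x (U x)) x $ a" by (rule Lw_coord[OF x])
      also have "cross3 (cross3 x (U x)) x = (x \<bullet> x) *\<^sub>R U x - (x \<bullet> U x) *\<^sub>R x"
        using Lagrange[of x x "U x"] cross_skew[of "cross3 x (U x)" x] by simp
      finally show "U x $ a = cross3 x (U x) \<bullet> LL (\<lambda>x. x $ a) x"
        using u S2_inner[OF x] by (simp add: inner_commute)
    qed
  qed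
  also have "\<dots> = 0" by (rule s(4)[OF co])
  finally have z: "(LINT x|surface. U x $ a) = 0" .
  have "ip (\<lambda>x. U x $ a) b = ip (\<lambda>x. U x $ a) (\<lambda>x. c)" by (rule ip_cong[OF refl c])
  thus ?thesis using z by (simp add: ip_def)
qed

section \<open>Expansion of solenoidal fields in vector harmonics\<close>

definition proj :: "nat \<Rightarrow> (real^3 \<Rightarrow> real) \<Rightarrow> real^3 \<Rightarrow> real" where
  "proj N f x = (\<Sum>b\<in>basis_seq N. ip f b * b x)"

lemma basis_seq_sqi: "b \<in> basis_seq N \<Longrightarrow> sqi surface b"
  by (rule sp_sqi[OF lower_sp[OF basis_seq_lower]])

lemma proj_sqi: "sqi surface (proj N f)"
  unfolding proj_def by (intro sqi_sum sqi_scale basis_seq_sqi)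

lemma proj_Bessel:
  assumes f: "sqi surface f"
  shows "ip (\<lambda>x. f x - proj N f x) (\<lambda>x. f x - proj N f x) = ip f f - (\<Sum>b\<in>basis_seq N. (ip f b)\<^sup>2)"
    and "ip (proj N f) (proj N f) = (\<Sum>b\<in>basis_seq N. (ip f b)\<^sup>2)"
proof -
  have pb: "ip (proj N f) b = ip f b" if b: "b \<in> basis_seq N" for b
  proof -
    have "ip (proj N f) b = (\<Sum>c\<in>basis_seq N. ip f c * ip c b)"
      unfolding proj_def by (intro ip_sum basis_seq_sqi[OF b] basis_seq_sqi[of _ N])
    also have "\<dots> = (\<Sum>c\<in>basis_seq N. if c = b then ip f b else 0)"
      using basis_seq_on[of N] b by (intro sum.cong) (auto simp: orthonormal_def)
    finally show ?thesis using b basis_seq_finite by simp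
  qed
  have fp: "ip (proj N f) g = (\<Sum>b\<in>basis_seq N. ip f b * ip b g)" if "sqi surface g" for g
    unfolding proj_def by (intro ip_sum basis_seq_sqi that)
  show pp: "ip (proj N f) (proj N f) = (\<Sum>b\<in>basis_seq N. (ip f b)\<^sup>2)"
    unfolding fp[OF proj_sqi] by (intro sum.cong refl) (simp add: ip_commute[of _ "proj N f"] pb power2_eq_square)
  have pf: "ip (proj N f) f = (\<Sum>b\<in>basis_seq N. (ip f b)\<^sup>2)"
    unfolding fp[OF f] by (intro sum.cong refl) (simp add: ip_commute[of _ f] power2_eq_square)
  have "ip (\<lambda>x. f x - proj N f x) (\<lambda>x. f x - proj N f x) = ip f (\<lambda>x. f x - proj N f x) - ip (proj N f) (\<lambda>x. f x - proj N f x)"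
    by (intro ip_diff f proj_sqi sqi_diff)
  also have "ip f (\<lambda>x. f x - proj N f x) = ip f f - ip (proj N f) f"
    by (subst ip_commute, intro ip_diff f proj_sqi)
  also have "ip (proj N f) (\<lambda>x. f x - proj N f x) = ip f (proj N f) - ip (proj N f) (proj N f)"
    by (subst ip_commute, intro ip_diff f proj_sqi)
  finally show "ip (\<lambda>x. f x - proj N f x) (\<lambda>x. f x - proj N f x) = ip f f - (\<Sum>b\<in>basis_seq N. (ip f b)\<^sup>2)"
    using pp pf by (simp add: ip_commute)
qed

lemma ip_nonneg: "ip f f \<ge> 0"
  by (simp add: ip_def)

lemma Bessel_le: "sqi surface f \<Longrightarrow> (\<Sum>b\<in>basis_seq N. (ip f b)\<^sup>2) \<le> ip f f"
  using proj_Bessel(1)[of f N] ip_nonneg[of "\<lambda>x. f x - proj N f x"] by simp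

text \<open>The projection reproduces an approximating polynomial p once N exceeds its degree. The
  residual of \<open>f\<close> is then the residual of f - p, whose norm is no larger than that of f
  - p.\<close>

lemma proj_tendsto:
  assumes f: "sqi surface f"
  shows "(\<lambda>N. LINT x|surface. (f x - proj N f x)\<^sup>2) \<longlonglongrightarrow> 0"
proof (rule LIMSEQ_I)
  fix e :: real assume e: "e > 0"
  obtain p where p: "real_polynomial_function p" "(LINT x|surface. (f x - p x)\<^sup>2) < e"
    using poly_dense[OF f] e unfolding poly_approx_def by blast
  obtain d where d: "sp d p" using poly_sp[OF p(1)] by blast
  have "(LINT x|surface. (f x - proj N f x)\<^sup>2) < e" if N: "N \<ge> Suc d" for N
  proof -
    have low: "lower N p" using sp_mono[OF d, of "N - 1"] N by (cases N) (auto simp: lower_Suc)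
    define r where "r x = f x - p x" for x
    have r: "sqi surface r" unfolding r_def by (intro sqi_diff f sp_sqi[OF d])
    have "f x - proj N f x = r x - proj N r x" if x: "x \<in> S2" for x
    proof -
      have "proj N r x = (\<Sum>b\<in>basis_seq N. (ip f b - ip p b) * b x)"
        unfolding proj_def r_def using f sp_sqi[OF d] basis_seq_sqi by (intro sum.cong refl) (simp add: ip_diff)
      also have "\<dots> = proj N f x - p x"
        using spannedD[OF basis_seq_spanned[OF low] x] by (simp add: proj_def left_diff_distrib sum_subtractf)
      finally show ?thesis by (simp add: r_def)
    qed
    hence "ip (\<lambda>x. f x - proj N f x) (\<lambda>x. f x - proj N f x) = ip (\<lambda>x. r x - proj N r x) (\<lambda>x. r x - proj N r x)"
      by (intro ip_cong)
    also have "\<dots> \<le> ip r r"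
      unfolding proj_Bessel(1)[OF r] by (simp add: sum_nonneg)
    also have "\<dots> < e" using p(2) by (simp add: ip_def r_def power2_eq_square)
    finally show ?thesis by (simp add: ip_def power2_eq_square)
  qed
  thus "\<exists>no. \<forall>N\<ge>no. norm ((LINT x|surface. (f x - proj N f x)\<^sup>2) - 0) < e"
    by (intro exI[of _ "Suc d"]) auto
qed

abbreviation ev :: "nat \<Rightarrow> real" where "ev d \<equiv> real d * (real d + 1)"

text \<open>The divergence free vector harmonics \<open>\<nabla>\<^sup>\<bottom> Y / \<surd>\<lambda>\<close>.\<close>

definition vharm :: "nat \<times> (real^3 \<Rightarrow> real) \<Rightarrow> real^3 \<Rightarrow> real^3" where
  "vharm = (\<lambda>(d, b) x. (- inverse (sqrt (ev d))) *\<^sub>R LL b x)"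

text \<open>Degree 0 is left out since constants have zero gradient. The strict upper bound matches
  \<open>basis_seq N\<close>, which spans the degrees below \<open>N\<close>.\<close>

definition modes :: "nat \<Rightarrow> (nat \<times> (real^3 \<Rightarrow> real)) set" where
  "modes N = Sigma {1..<N} sharm"

lemma finite_modes: "finite (modes N)"
  by (simp add: modes_def finite_sharm)

lemma inverse_sqrt_square: "x > 0 \<Longrightarrow> inverse (sqrt x) * inverse (sqrt x) = inverse x"
  by (metis abs_of_pos inverse_mult_distrib real_sqrt_mult_self)

lemma inverse_mult_cancel: "(x::real) > 0 \<Longrightarrow> inverse x * (x * c) = c"
  by simp

lemma ev_pos: "d \<ge> 1 \<Longrightarrow> ev d > 0"
  by simp

lemma vharm_sqi: "k \<in> modes N \<Longrightarrow> sqi surface (vharm k)"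
proof -
  assume "k \<in> modes N"
  then obtain d b where k: "k = (d, b)" "b \<in> sharm d" by (auto simp: modes_def)
  show ?thesis unfolding k vharm_def prod.case by (rule sqi_scaleR[OF LL_sqi[OF sharm_sp[OF k(2)]]])
qed

lemma vharm_orthonormal:
  assumes "k \<in> modes N" "l \<in> modes N"
  shows "(LINT x|surface. vharm k x \<bullet> vharm l x) = (if k = l then 1 else 0)"
proof -
  obtain d b where k: "k = (d, b)" "d \<ge> 1" "b \<in> sharm d" using assms(1) by (auto simp: modes_def)
  obtain e c where l: "l = (e, c)" "e \<ge> 1" "c \<in> sharm e" using assms(2) by (auto simp: modes_def)
  have kl: "k = l \<longleftrightarrow> b = c" using k l sharm_disjoint[of d e] by auto
  have "(LINT x|surface. vharm k x \<bullet> vharm l x) = (LINT x|surface. (inverse (sqrt (ev d)) * inverse (sqrt (ev e))) * (\<Sum>a\<in>UNIV. La a b x * La a c x))"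
    by (intro Bochner_Integration.integral_cong refl) (simp add: k l vharm_def inner_vec_def sum_distrib_left mult_ac)
  also have "\<dots> = (inverse (sqrt (ev d)) * inverse (sqrt (ev e))) * (\<Sum>a\<in>UNIV. ip (La a b) (La a c))"
    unfolding ip_def integral_mult_right_zero
    by (subst Bochner_Integration.integral_sum) (auto intro!: ip_integrable sp_sqi[OF sp_Lw[OF sharm_sp]] k l)
  also have "\<dots> = (inverse (sqrt (ev d)) * inverse (sqrt (ev e))) * (ev d * of_bool (b = c))"
    unfolding sharm_grad_ip[OF k(3) l(3)] ..
  also have "\<dots> = (if k = l then 1 else 0)"
  proof (cases "k = l")
    case True
    have "inverse (sqrt (ev d)) * inverse (sqrt (ev d)) * ev d = 1"
      unfolding inverse_sqrt_square[OF ev_pos[OF k(2)]] using inverse_mult_cancel[OF ev_pos[OF k(2)], of 1] by simp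
    thus ?thesis using True k l by simp
  next
    case False thus ?thesis using kl by simp
  qed
  finally show ?thesis .
qed

text \<open>For a solenoidal pair the coefficient is the inner product of U with
  \<open>vharm k\<close>: testing the rotation against a harmonic turns it into a coefficient of
  \<open>W\<close>, and the minus sign in \<open>vharm\<close> absorbs the one from integration by
  parts.\<close>

definition vproj :: "nat \<Rightarrow> (real^3 \<Rightarrow> real) \<Rightarrow> real^3 \<Rightarrow> real^3" where
  "vproj N W x = (\<Sum>k\<in>modes N. (ip W (snd k) * inverse (sqrt (ev (fst k)))) *\<^sub>R vharm k x)"

lemma basis_seq_sum:
  "(\<Sum>b\<in>basis_seq N. h b) = (\<Sum>d<N. \<Sum>b\<in>sharm d. h b)"
  unfolding basis_seq_eq by (rule sum.UNION_disjoint) (auto simp: finite_sharm sharm_disjoint)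

text \<open>Identifies the vector expansion with three scalar projections, so that its convergence
  to \<open>U\<close> is inherited from the density of scalar polynomials.\<close>

lemma vproj_component:
  assumes S: "solenoidal U W" and x: "x \<in> S2"
  shows "vproj N W x $ a = proj N (\<lambda>x. U x $ a) x"
proof -
  note s = solenoidalD[OF S]
  have deg: "(\<Sum>b\<in>sharm d. ip (\<lambda>x. U x $ a) b * b x) = (\<Sum>c\<in>sharm d. - (inverse (ev d) * ip W c * La a c x))" if d: "d \<ge> 1" for d
  proof -
    define M where "M b c = ip (La a b) c" for b c
    have sm: "smooth_on_S2 b" if "b \<in> sharm d" for b by (rule sp_smooth[OF sharm_sp[OF that]])
    have skew: "M b c = - M c b" if "b \<in> sharm d" "c \<in> sharm d" for b c
      using ip_Lw[OF sm[OF that(1)] sm[OF that(2)] norm_axis1[of a]] ip_commute unfolding M_def by metis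
    have WL: "ip W (La a b) = (\<Sum>c\<in>sharm d. M b c * ip W c)" if b: "b \<in> sharm d" for b
    proof -
      have "ip W (La a b) = ip (La a b) W" by (rule ip_commute)
      also have "\<dots> = ip (\<lambda>x. \<Sum>c\<in>sharm d. M b c * c x) W"
        unfolding M_def by (rule ip_cong[OF sharm_Lw[OF b norm_axis1] refl])
      also have "\<dots> = (\<Sum>c\<in>sharm d. M b c * ip c W)" by (intro ip_sum sharm_sqi s)
      finally show ?thesis by (simp add: ip_commute)
    qed
    have "(\<Sum>b\<in>sharm d. ip (\<lambda>x. U x $ a) b * b x) = (\<Sum>b\<in>sharm d. (inverse (ev d) * ip W (La a b)) * b x)"
      using solenoidal_coeff[OF S, of _ d a] ev_pos[OF d] by (intro sum.cong refl) (simp add: field_simps)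
    also have "\<dots> = (\<Sum>b\<in>sharm d. \<Sum>c\<in>sharm d. inverse (ev d) * (M b c * ip W c) * b x)"
      by (intro sum.cong refl) (simp add: WL sum_distrib_left sum_distrib_right)
    also have "\<dots> = (\<Sum>c\<in>sharm d. \<Sum>b\<in>sharm d. inverse (ev d) * (M b c * ip W c) * b x)"
      by (rule sum.swap)
    \<comment> \<open>Skewness of \<open>M\<close> moves the derivative from the coefficients of
      \<open>W\<close> back to the harmonics.\<close>
    also have "\<dots> = (\<Sum>c\<in>sharm d. \<Sum>b\<in>sharm d. - (inverse (ev d) * ip W c * (M c b * b x)))"
      by (intro sum.cong refl) (subst skew, auto)
    also have "\<dots> = (\<Sum>c\<in>sharm d. - (inverse (ev d) * ip W c * (\<Sum>b\<in>sharm d. M c b * b x)))"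
      by (simp only: sum_negf sum_distrib_left)
    also have "\<dots> = (\<Sum>c\<in>sharm d. - (inverse (ev d) * ip W c * La a c x))"
      by (intro sum.cong refl) (simp add: M_def sharm_Lw[OF _ norm_axis1 x])
    finally show ?thesis .
  qed
  have "proj N (\<lambda>x. U x $ a) x = (\<Sum>d<N. \<Sum>b\<in>sharm d. ip (\<lambda>x. U x $ a) b * b x)"
    unfolding proj_def by (rule basis_seq_sum)
  also have "\<dots> = (\<Sum>d\<in>{1..<N}. \<Sum>b\<in>sharm d. ip (\<lambda>x. U x $ a) b * b x)"
  proof (intro sum.mono_neutral_right ballI)
    fix d assume "d \<in> {..<N} - {1..<N}"
    hence "d = 0" by auto
    thus "(\<Sum>b\<in>sharm d. ip (\<lambda>x. U x $ a) b * b x) = 0" using solenoidal_coeff_0[OF S] by simp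
  qed auto
  also have "\<dots> = (\<Sum>d\<in>{1..<N}. \<Sum>c\<in>sharm d. - (inverse (ev d) * ip W c * La a c x))"
    by (intro sum.cong refl deg) auto
  also have "\<dots> = (\<Sum>k\<in>modes N. - (inverse (ev (fst k)) * ip W (snd k) * La a (snd k) x))"
    unfolding modes_def by (subst sum.Sigma) (auto simp: finite_sharm split_def)
  also have "\<dots> = vproj N W x $ a"
    unfolding vproj_def sum_component
  proof (intro sum.cong refl)
    fix k assume "k \<in> modes N"
    then obtain d b where k: "k = (d, b)" "d \<ge> 1" by (auto simp: modes_def)
    have "inverse (sqrt (ev d)) * inverse (sqrt (ev d)) = inverse (ev d)"
      by (rule inverse_sqrt_square[OF ev_pos[OF k(2)]])
    moreover have "- (i * i * w * l) = w * i * (- i * l)" for i w l :: real by simp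
    ultimately have "- (inverse (ev d) * ip W b * La a b x) = ip W b * inverse (sqrt (ev d)) * (- inverse (sqrt (ev d)) * La a b x)"
      by metis
    thus "- (inverse (ev (fst k)) * ip W (snd k) * La a (snd k) x) = ((ip W (snd k) * inverse (sqrt (ev (fst k)))) *\<^sub>R vharm k x) $ a"
      by (simp only: k vharm_def prod.case fst_conv snd_conv vector_scaleR_component LL_component real_scaleR_def)
  qed
  finally show ?thesis by simp
qed

lemma norm_vec_squared: "(norm (v :: real^3))\<^sup>2 = (\<Sum>a\<in>UNIV. (v $ a)\<^sup>2)"
  unfolding power2_norm_eq_inner inner_vec_def by (simp add: power2_eq_square)

lemma integral_norm_vec:
  assumes "sqi surface (U :: real^3 \<Rightarrow> real^3)"
  shows "(LINT x|surface. (norm (U x))\<^sup>2) = (\<Sum>a\<in>UNIV. ip (\<lambda>x. U x $ a) (\<lambda>x. U x $ a))"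
proof -
  have "(LINT x|surface. (norm (U x))\<^sup>2) = (LINT x|surface. (\<Sum>a\<in>UNIV. U x $ a * U x $ a))"
    unfolding norm_vec_squared by (simp add: power2_eq_square)
  also have "\<dots> = (\<Sum>a\<in>UNIV. ip (\<lambda>x. U x $ a) (\<lambda>x. U x $ a))"
    unfolding ip_def by (intro Bochner_Integration.integral_sum ip_integrable sqi_vec_nth assms)
  finally show ?thesis .
qed

lemma vproj_sqi: "sqi surface (vproj N W)"
  unfolding vproj_def by (intro sqi_sum sqi_scaleR vharm_sqi)

lemma vproj_tendsto:
  assumes S: "solenoidal U W"
  shows "(\<lambda>N. LINT x|surface. (norm (U x - vproj N W x))\<^sup>2) \<longlonglongrightarrow> 0"
proof -
  note s = solenoidalD[OF S]
  have "(LINT x|surface. (norm (U x - vproj N W x))\<^sup>2) = (\<Sum>a\<in>UNIV. LINT x|surface. (U x $ a - proj N (\<lambda>x. U x $ a) x)\<^sup>2)" for N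
  proof -
    have "(LINT x|surface. (norm (U x - vproj N W x))\<^sup>2) = (\<Sum>a\<in>UNIV. ip (\<lambda>x. (U x - vproj N W x) $ a) (\<lambda>x. (U x - vproj N W x) $ a))"
      by (intro integral_norm_vec sqi_diff s vproj_sqi)
    also have "\<dots> = (\<Sum>a\<in>UNIV. ip (\<lambda>x. U x $ a - proj N (\<lambda>x. U x $ a) x) (\<lambda>x. U x $ a - proj N (\<lambda>x. U x $ a) x))"
      by (intro sum.cong refl ip_cong) (simp_all only: vector_minus_component vproj_component[OF S])
    finally show ?thesis by (simp add: ip_def power2_eq_square)
  qed
  moreover have "(\<lambda>N. \<Sum>a\<in>UNIV. LINT x|surface. (U x $ a - proj N (\<lambda>x. U x $ a) x)\<^sup>2) \<longlonglongrightarrow> (\<Sum>a\<in>(UNIV::3 set). 0)"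
    by (intro tendsto_sum proj_tendsto sqi_vec_nth s)
  ultimately show ?thesis by simp
qed

text \<open>Bessel's inequality for the components of \<open>U\<close> and for \<open>W\<close>.
  Added with weights m^2 and 1, the two bounds give the Gram hypothesis of
  \<open>interpolation_bound\<close>.\<close>

lemma vproj_energy:
  assumes S: "solenoidal U W"
  shows "(\<Sum>k\<in>modes N. (ip W (snd k) * inverse (sqrt (ev (fst k))))\<^sup>2) \<le> (LINT x|surface. (norm (U x))\<^sup>2)"
    and "(\<Sum>k\<in>modes N. (ip W (snd k))\<^sup>2) \<le> (LINT x|surface. (W x)\<^sup>2)"
proof -
  note s = solenoidalD[OF S]
  have "(\<Sum>k\<in>modes N. (ip W (snd k) * inverse (sqrt (ev (fst k))))\<^sup>2) = (LINT x|surface. (norm (vproj N W x))\<^sup>2)"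
    unfolding vproj_def by (rule orthonormal_norm_sum[OF finite_modes vharm_sqi vharm_orthonormal, symmetric])
  also have "\<dots> = (\<Sum>a\<in>UNIV. ip (\<lambda>x. vproj N W x $ a) (\<lambda>x. vproj N W x $ a))"
    by (rule integral_norm_vec[OF vproj_sqi])
  also have "\<dots> = (\<Sum>a\<in>UNIV. ip (proj N (\<lambda>x. U x $ a)) (proj N (\<lambda>x. U x $ a)))"
    by (intro sum.cong refl ip_cong vproj_component[OF S])
  also have "\<dots> \<le> (\<Sum>a\<in>UNIV. ip (\<lambda>x. U x $ a) (\<lambda>x. U x $ a))"
    unfolding proj_Bessel(2)[OF sqi_vec_nth[OF s(1)]] by (intro sum_mono Bessel_le sqi_vec_nth s)
  also have "\<dots> = (LINT x|surface. (norm (U x))\<^sup>2)" by (rule integral_norm_vec[OF s(1), symmetric])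
  finally show "(\<Sum>k\<in>modes N. (ip W (snd k) * inverse (sqrt (ev (fst k))))\<^sup>2) \<le> (LINT x|surface. (norm (U x))\<^sup>2)" .
  have "(\<Sum>k\<in>modes N. (ip W (snd k))\<^sup>2) = (\<Sum>d\<in>{1..<N}. \<Sum>b\<in>sharm d. (ip W b)\<^sup>2)"
    unfolding modes_def by (subst sum.Sigma) (auto simp: finite_sharm split_def)
  also have "\<dots> \<le> (\<Sum>d<N. \<Sum>b\<in>sharm d. (ip W b)\<^sup>2)"
    by (intro sum_mono2) (auto intro: sum_nonneg)
  also have "\<dots> = (\<Sum>b\<in>basis_seq N. (ip W b)\<^sup>2)" by (rule basis_seq_sum[symmetric])
  also have "\<dots> \<le> ip W W" by (rule Bessel_le[OF s(2)])
  finally show "(\<Sum>k\<in>modes N. (ip W (snd k))\<^sup>2) \<le> (LINT x|surface. (W x)\<^sup>2)" by (simp add: ip_def power2_eq_square)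
qed

text \<open>The eigenvalue in \<open>sharm_sum_grad_sq\<close> cancels the normalisation of
  \<open>vharm\<close>, so degree d contributes at most (2d+1)/(4 pi) at every point;
  \<open>sum_eigenvalues_bound\<close> does the rest.\<close>

lemma vharm_pointwise:
  assumes m: "m > 0" and q: "q > 1" and x: "x \<in> S2"
  shows "(\<Sum>k\<in>modes N. (inverse (sqrt (m\<^sup>2 + ev (fst k)))) powr (2 * q) * (norm (vharm k x))\<^sup>2)
     \<le> m powr (- 2 * (q - 1)) / (q - 1) / (4 * pi)"
proof -
  have r: "(inverse (sqrt (m\<^sup>2 + ev d))) powr (2 * q) = (m\<^sup>2 + ev d) powr (- q)" for d
  proof -
    have p: "m\<^sup>2 + ev d > 0" using m by (intro add_pos_nonneg) auto
    have "inverse (sqrt (m\<^sup>2 + ev d)) = (m\<^sup>2 + ev d) powr (- (1/2))"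
      using p by (simp add: powr_half_sqrt powr_minus)
    thus ?thesis by (simp add: powr_powr)
  qed
  have "(\<Sum>k\<in>modes N. (inverse (sqrt (m\<^sup>2 + ev (fst k)))) powr (2 * q) * (norm (vharm k x))\<^sup>2)
    = (\<Sum>d\<in>{1..<N}. \<Sum>b\<in>sharm d. (m\<^sup>2 + ev d) powr (- q) * (norm (vharm (d, b) x))\<^sup>2)"
    unfolding modes_def by (subst sum.Sigma) (auto simp: finite_sharm split_def r)
  also have "\<dots> = (\<Sum>d\<in>{1..<N}. (m\<^sup>2 + ev d) powr (- q) * (real (card (sharm d)) / (4 * pi)))"
  proof (intro sum.cong refl)
    fix d assume d: "d \<in> {1..<N}"
    hence e: "ev d > 0" by (intro ev_pos) auto
    have "(norm (vharm (d, b) x))\<^sup>2 = inverse (ev d) * (\<Sum>a\<in>UNIV. (La a b x)\<^sup>2)" for b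
      using e by (simp add: vharm_def norm_vec_squared power_mult_distrib sum_distrib_left power_inverse)
    hence "(\<Sum>b\<in>sharm d. (m\<^sup>2 + ev d) powr (- q) * (norm (vharm (d, b) x))\<^sup>2)
      = (m\<^sup>2 + ev d) powr (- q) * (inverse (ev d) * (\<Sum>b\<in>sharm d. \<Sum>a\<in>UNIV. (La a b x)\<^sup>2))"
      by (simp only: sum_distrib_left)
    also have "\<dots> = (m\<^sup>2 + ev d) powr (- q) * (real (card (sharm d)) / (4 * pi))"
      unfolding sharm_sum_grad_sq[OF x] inverse_mult_cancel[OF e] ..
    finally show "(\<Sum>b\<in>sharm d. (m\<^sup>2 + ev d) powr (- q) * (norm (vharm (d, b) x))\<^sup>2) = (m\<^sup>2 + ev d) powr (- q) * (real (card (sharm d)) / (4 * pi))" .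
  qed
  also have "\<dots> \<le> (\<Sum>d\<in>{1..<N}. (m\<^sup>2 + ev d) powr (- q) * ((2 * real d + 1) / (4 * pi)))"
  proof (intro sum_mono mult_left_mono divide_right_mono)
    show "real (card (sharm d)) \<le> 2 * real d + 1" for d
      using card_sharm[of d] by (simp add: of_nat_mono flip: of_nat_mult of_nat_add of_nat_Suc)
  qed auto
  also have "\<dots> \<le> (\<Sum>d=1..N. (m\<^sup>2 + ev d) powr (- q) * ((2 * real d + 1) / (4 * pi)))"
    by (intro sum_mono2) auto
  also have "\<dots> = (\<Sum>d=1..N. (2 * real d + 1) * (m\<^sup>2 + ev d) powr (- q)) / (4 * pi)"
    by (simp add: sum_divide_distrib mult.commute)
  also have "\<dots> \<le> m powr (- 2 * (q - 1)) / (q - 1) / (4 * pi)"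
    by (intro divide_right_mono sum_eigenvalues_bound m q) auto
  finally show ?thesis .
qed

section \<open>The dual inequality\<close>

lemma solenoidal_sum:
  assumes S: "\<And>j. j \<in> J \<Longrightarrow> solenoidal (U j) (W j)" and J: "finite J"
  shows "solenoidal (\<lambda>x. \<Sum>j\<in>J. t j *\<^sub>R U j x) (\<lambda>x. \<Sum>j\<in>J. t j * W j x)"
  unfolding solenoidal_def
proof (intro conjI allI impI)
  note s = solenoidalD[OF S]
  show "sqi surface (\<lambda>x. \<Sum>j\<in>J. t j *\<^sub>R U j x)" by (intro sqi_sum sqi_scaleR s)
  show "sqi surface (\<lambda>x. \<Sum>j\<in>J. t j * W j x)" by (intro sqi_sum sqi_scale s)
  have "AE x in surface. \<forall>j\<in>J. U j x \<bullet> x = 0" using J s(3) by (simp add: AE_finite_all)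
  thus "AE x in surface. (\<Sum>j\<in>J. t j *\<^sub>R U j x) \<bullet> x = 0"
    by eventually_elim (simp add: inner_sum_left)
  fix d f assume f: "sp d f"
  have "(LINT x|surface. cross3 x (\<Sum>j\<in>J. t j *\<^sub>R U j x) \<bullet> LL f x) = (LINT x|surface. (\<Sum>j\<in>J. t j * (cross3 x (U j x) \<bullet> LL f x)))"
  proof (intro Bochner_Integration.integral_cong refl)
    fix x
    interpret bounded_bilinear cross3 by (rule bounded_bilinear_cross3)
    show "cross3 x (\<Sum>j\<in>J. t j *\<^sub>R U j x) \<bullet> LL f x = (\<Sum>j\<in>J. t j * (cross3 x (U j x) \<bullet> LL f x))"
      by (simp add: sum_right scaleR_right inner_sum_left)
  qed
  also have "\<dots> = (\<Sum>j\<in>J. t j * (LINT x|surface. cross3 x (U j x) \<bullet> LL f x))"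
    by (subst Bochner_Integration.integral_sum) (auto intro!: sqi_inner_integrable sqi_cross LL_sqi[OF f] s)
  also have "\<dots> = 0" using s(4)[OF _ f] by simp
  finally show "(LINT x|surface. cross3 x (\<Sum>j\<in>J. t j *\<^sub>R U j x) \<bullet> LL f x) = 0" .
  have "(LINT x|surface. (\<Sum>j\<in>J. t j *\<^sub>R U j x) \<bullet> LL f x) = (LINT x|surface. (\<Sum>j\<in>J. t j * (U j x \<bullet> LL f x)))"
    by (simp add: inner_sum_left)
  also have "\<dots> = (\<Sum>j\<in>J. t j * (LINT x|surface. U j x \<bullet> LL f x))"
    by (subst Bochner_Integration.integral_sum) (auto intro!: sqi_inner_integrable LL_sqi[OF f] s)
  finally have "- (LINT x|surface. (\<Sum>j\<in>J. t j *\<^sub>R U j x) \<bullet> LL f x) = (\<Sum>j\<in>J. t j * ip (W j) f)"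
    using s(5)[OF _ f] by (simp add: sum_negf)
  also have "\<dots> = ip (\<lambda>x. \<Sum>j\<in>J. t j * W j x) f" by (rule ip_sum[symmetric]) (auto intro: s sp_sqi[OF f])
  finally show "ip (\<lambda>x. \<Sum>j\<in>J. t j * W j x) f = - (LINT x|surface. (\<Sum>j\<in>J. t j *\<^sub>R U j x) \<bullet> LL f x)" by simp
qed

lemma simple_function_bounded:
  fixes V :: "'a \<Rightarrow> real"
  assumes "simple_function M V" obtains D where "\<And>x. x \<in> space M \<Longrightarrow> \<bar>V x\<bar> \<le> D"
proof
  show "\<bar>V x\<bar> \<le> (\<Sum>v\<in>V ` space M. \<bar>v\<bar>)" if "x \<in> space M" for x
    using assms that by (intro member_le_sum[where f = abs]) (auto simp: simple_function_def)
qed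

text \<open>Weak lower semicontinuity: the mixed integrals of V F.U tend to the left side T, and 2
  F.U <= |F|^2 + |U|^2 bounds them by C/2 + T/2.\<close>

lemma weighted_norm_limit:
  fixes U :: "'j \<Rightarrow> 'a \<Rightarrow> 'b::euclidean_space"
  assumes J: "finite J" and U: "\<And>j. j \<in> J \<Longrightarrow> sqi M (U j)" and F: "\<And>j N. j \<in> J \<Longrightarrow> sqi M (F j N)"
    and lim: "\<And>j. j \<in> J \<Longrightarrow> (\<lambda>N. LINT x|M. (norm (U j x - F j N x))\<^sup>2) \<longlonglongrightarrow> 0"
    and V: "V \<in> borel_measurable M" "\<And>x. x \<in> space M \<Longrightarrow> 0 \<le> V x" "\<And>x. x \<in> space M \<Longrightarrow> V x \<le> D"
    and C: "\<And>N. (\<Sum>j\<in>J. LINT x|M. V x * (norm (F j N x))\<^sup>2) \<le> C"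
  shows "(\<Sum>j\<in>J. LINT x|M. V x * (norm (U j x))\<^sup>2) \<le> C"
proof -
  define T where "T = (\<Sum>j\<in>J. LINT x|M. V x * (norm (U j x))\<^sup>2)"
  have sV: "sqi M (\<lambda>x. V x *\<^sub>R f x)" if "sqi M f" for f :: "'a \<Rightarrow> 'b"
    using V by (intro sqi_bounded_scale[where B = D] that) (auto simp: abs_le_iff intro: order_trans[of _ 0])
  have iV: "integrable M (\<lambda>x. V x * (f x \<bullet> g x))" if "sqi M f" "sqi M g" for f g :: "'a \<Rightarrow> 'b"
    using sqi_inner_integrable[OF sV[OF that(1)] that(2)] by simp
  have "(\<lambda>N. \<Sum>j\<in>J. LINT x|M. F j N x \<bullet> (V x *\<^sub>R U j x)) \<longlonglongrightarrow> (\<Sum>j\<in>J. LINT x|M. U j x \<bullet> (V x *\<^sub>R U j x))"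
    using U F lim by (intro tendsto_sum sqi_inner_tendsto sV) auto
  also have "(\<Sum>j\<in>J. LINT x|M. U j x \<bullet> (V x *\<^sub>R U j x)) = T"
    by (simp add: T_def power2_norm_eq_inner)
  finally have l: "(\<lambda>N. \<Sum>j\<in>J. LINT x|M. F j N x \<bullet> (V x *\<^sub>R U j x)) \<longlonglongrightarrow> T" .
  have "T \<le> C / 2 + T / 2"
  proof (rule LIMSEQ_le_const2[OF l], intro exI allI impI)
    fix N
    have "(\<Sum>j\<in>J. LINT x|M. F j N x \<bullet> (V x *\<^sub>R U j x)) \<le> (\<Sum>j\<in>J. LINT x|M. (1/2) * (V x * (F j N x \<bullet> F j N x)) + (1/2) * (V x * (U j x \<bullet> U j x)))"
    proof (intro sum_mono integral_mono)
      fix j assume j: "j \<in> J"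
      show "integrable M (\<lambda>x. F j N x \<bullet> (V x *\<^sub>R U j x))" by (intro sqi_inner_integrable F sV U j)
      show "integrable M (\<lambda>x. (1/2) * (V x * (F j N x \<bullet> F j N x)) + (1/2) * (V x * (U j x \<bullet> U j x)))"
        by (intro Bochner_Integration.integrable_add integrable_mult_right iV F U j)
      fix x assume x: "x \<in> space M"
      have "0 \<le> (F j N x - U j x) \<bullet> (F j N x - U j x)" by simp
      hence "F j N x \<bullet> U j x \<le> (1/2) * (F j N x \<bullet> F j N x) + (1/2) * (U j x \<bullet> U j x)"
        by (simp add: inner_diff_left inner_diff_right inner_commute)
      hence "V x * (F j N x \<bullet> U j x) \<le> V x * ((1/2) * (F j N x \<bullet> F j N x) + (1/2) * (U j x \<bullet> U j x))"
        using V(2)[OF x] by (rule mult_left_mono)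
      thus "F j N x \<bullet> (V x *\<^sub>R U j x) \<le> (1/2) * (V x * (F j N x \<bullet> F j N x)) + (1/2) * (V x * (U j x \<bullet> U j x))"
        by (simp add: algebra_simps)
    qed
    also have "\<dots> = (\<Sum>j\<in>J. (1/2) * (LINT x|M. V x * (norm (F j N x))\<^sup>2) + (1/2) * (LINT x|M. V x * (norm (U j x))\<^sup>2))"
      unfolding power2_norm_eq_inner
      using iV[OF F F] iV[OF U U] by (intro sum.cong refl) (subst Bochner_Integration.integral_add, auto)
    also have "\<dots> = (\<Sum>j\<in>J. LINT x|M. V x * (norm (F j N x))\<^sup>2) / 2 + T / 2"
      by (simp add: sum.distrib T_def sum_divide_distrib)
    also have "\<dots> \<le> C / 2 + T / 2" using C[of N] by simp
    finally show "(\<Sum>j\<in>J. LINT x|M. F j N x \<bullet> (V x *\<^sub>R U j x)) \<le> C / 2 + T / 2" .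
  qed
  thus ?thesis by (simp add: T_def)
qed

proposition solenoidal_dual_bound:
  fixes U :: "'j \<Rightarrow> real^3 \<Rightarrow> real^3" and W :: "'j \<Rightarrow> real^3 \<Rightarrow> real"
  assumes J: "finite J" "J \<noteq> {}" and S: "\<And>j. j \<in> J \<Longrightarrow> solenoidal (U j) (W j)"
    and m: "m > 0" and q: "q > 1"
    and Gram: "\<And>t. m\<^sup>2 * (LINT x|surface. (norm (\<Sum>j\<in>J. t j *\<^sub>R U j x))\<^sup>2) + (LINT x|surface. (\<Sum>j\<in>J. t j * W j x)\<^sup>2) \<le> (\<Sum>j\<in>J. (t j)\<^sup>2)"
    and V: "simple_function surface V" "\<And>x. x \<in> space surface \<Longrightarrow> V x \<ge> 0"
    and X: "X > 0" "m powr (- 2 * (q - 1)) / (q - 1) / (4 * pi) * (LINT x|surface. V x powr q) \<le> X"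
  shows "(\<Sum>j\<in>J. LINT x|surface. V x * (norm (U j x))\<^sup>2) \<le> real (card J) powr (1 - 1 / q) * X powr (1 / q)"
proof -
  note s = solenoidalD[OF S]
  obtain D where D: "\<And>x. x \<in> space surface \<Longrightarrow> \<bar>V x\<bar> \<le> D" using simple_function_bounded[OF V(1)] by blast
  hence VD: "V x \<le> D" if "x \<in> space surface" for x using that by (meson abs_le_iff)
  show ?thesis
  proof (rule weighted_norm_limit[where F = "\<lambda>j N. vproj N (W j)" and D = D])
    fix N
    define r where "r k = inverse (sqrt (m\<^sup>2 + ev (fst k)))" for k :: "nat \<times> (real^3 \<Rightarrow> real)"
    define s where "s j k = ip (W j) (snd k) * inverse (sqrt (ev (fst k)))" for j and k :: "nat \<times> (real^3 \<Rightarrow> real)"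
    \<comment> \<open>The factor undoes \<open>r\<close>, so \<open>c j k * r k\<close> is the
      coefficient of the expansion. It also makes the squares of \<open>c\<close> the energy m^2
      |U|^2 + |W|^2, in which the family is orthonormal.\<close>
    define c where "c j k = s j k * sqrt (m\<^sup>2 + ev (fst k))" for j and k :: "nat \<times> (real^3 \<Rightarrow> real)"
    have pos: "m\<^sup>2 + ev d > 0" for d using m by (intro add_pos_nonneg) auto
    have cr: "c j k * r k = s j k" for j k using pos[of "fst k"] by (simp add: c_def r_def)
    have "(\<Sum>j\<in>J. LINT x|surface. V x * (norm (\<Sum>k\<in>modes N. (c j k * r k) *\<^sub>R vharm k x))\<^sup>2)
      \<le> real (card J) powr (1 - 1 / q) * X powr (1 / q)"
    proof (rule interpolation_bound[OF J finite_modes vharm_sqi vharm_orthonormal _ _ _ q V finite_measure_surface X])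
      fix t :: "'j \<Rightarrow> real"
      define Ut Wt where "Ut x = (\<Sum>j\<in>J. t j *\<^sub>R U j x)" and "Wt x = (\<Sum>j\<in>J. t j * W j x)" for x
      have St: "solenoidal Ut Wt" unfolding Ut_def Wt_def by (rule solenoidal_sum[OF S J(1)])
      have ipt: "ip Wt b = (\<Sum>j\<in>J. t j * ip (W j) b)" if "sqi surface b" for b
        unfolding Wt_def using assms(3) by (intro ip_sum that) (auto dest: solenoidalD)
      have "(\<Sum>k\<in>modes N. (\<Sum>j\<in>J. t j * c j k)\<^sup>2) = (\<Sum>k\<in>modes N. m\<^sup>2 * (ip Wt (snd k) * inverse (sqrt (ev (fst k))))\<^sup>2 + (ip Wt (snd k))\<^sup>2)"
      proof (intro sum.cong refl)
        fix k assume "k \<in> modes N"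
        then obtain d b where k: "k = (d, b)" "d \<ge> 1" "b \<in> sharm d" by (auto simp: modes_def)
        have "(\<Sum>j\<in>J. t j * c j k) = ip Wt b * inverse (sqrt (ev d)) * sqrt (m\<^sup>2 + ev d)"
          by (simp add: ipt[OF sharm_sqi[OF k(3)]] c_def s_def k sum_distrib_right mult.assoc)
        hence "(\<Sum>j\<in>J. t j * c j k)\<^sup>2 = (ip Wt b * inverse (sqrt (ev d)))\<^sup>2 * (m\<^sup>2 + ev d)"
          using pos[of d] by (simp add: power_mult_distrib)
        also have "\<dots> = m\<^sup>2 * (ip Wt b * inverse (sqrt (ev d)))\<^sup>2 + (ip Wt b)\<^sup>2 * ((inverse (sqrt (ev d)) * inverse (sqrt (ev d))) * ev d)"
          by (simp add: power_mult_distrib power2_eq_square algebra_simps)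
        also have "(inverse (sqrt (ev d)) * inverse (sqrt (ev d))) * ev d = 1"
          unfolding inverse_sqrt_square[OF ev_pos[OF k(2)]] using inverse_mult_cancel[OF ev_pos[OF k(2)], of 1] by simp
        finally show "(\<Sum>j\<in>J. t j * c j k)\<^sup>2 = m\<^sup>2 * (ip Wt (snd k) * inverse (sqrt (ev (fst k))))\<^sup>2 + (ip Wt (snd k))\<^sup>2"
          by (simp add: k)
      qed
      also have "\<dots> \<le> m\<^sup>2 * (LINT x|surface. (norm (Ut x))\<^sup>2) + (LINT x|surface. (Wt x)\<^sup>2)"
        unfolding sum.distrib sum_distrib_left[symmetric]
        by (intro add_mono mult_left_mono vproj_energy[OF St]) auto
      also have "\<dots> \<le> (\<Sum>j\<in>J. (t j)\<^sup>2)" unfolding Ut_def Wt_def by (rule Gram)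
      finally show "(\<Sum>k\<in>modes N. (\<Sum>j\<in>J. t j * c j k)\<^sup>2) \<le> (\<Sum>j\<in>J. (t j)\<^sup>2)" .
    next
      show "r k > 0" for k using pos[of "fst k"] by (simp add: r_def)
      show "(\<Sum>k\<in>modes N. r k powr (2 * q) * (norm (vharm k x))\<^sup>2) \<le> m powr (- 2 * (q - 1)) / (q - 1) / (4 * pi)"
        if "x \<in> space surface" for x
        unfolding r_def using that by (intro vharm_pointwise m q) (simp only: space_surface)
    qed
    thus "(\<Sum>j\<in>J. LINT x|surface. V x * (norm (vproj N (W j) x))\<^sup>2) \<le> real (card J) powr (1 - 1 / q) * X powr (1 / q)"
      by (simp add: cr vproj_def s_def)
  qed (use J s VD V in \<open>auto intro: vproj_sqi vproj_tendsto[OF S] borel_measurable_simple_function\<close>)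
qed

text \<open>The optimal weight is the power p - 1 of \<open>\<rho>\<close>, but the p-th power of
  \<open>\<rho>\<close> is not known to be integrable beforehand. The weight is therefore built from
  simple functions below \<open>\<rho>\<close>: with X the finite integral of their p-th power this
  gives X <= C X^(1-1/p), and monotone convergence finishes.\<close>

lemma dual_Lp_bound:
  fixes \<rho> :: "'a \<Rightarrow> real"
  assumes fin: "finite_measure M" and p: "p > 1" and \<rho>: "integrable M \<rho>" "\<And>x. x \<in> space M \<Longrightarrow> \<rho> x \<ge> 0"
    and C: "C \<ge> 0"
    and dual: "\<And>V X. simple_function M V \<Longrightarrow> (\<And>x. x \<in> space M \<Longrightarrow> V x \<ge> 0) \<Longrightarrow> X > 0 \<Longrightarrow>
       (LINT x|M. V x powr (p / (p - 1))) \<le> X \<Longrightarrow> (LINT x|M. V x * \<rho> x) \<le> C * X powr (1 - 1 / p)"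
  shows "integrable M (\<lambda>x. \<rho> x powr p)" "(LINT x|M. \<rho> x powr p) powr (1 / p) \<le> C"
proof -
  interpret finite_measure M by fact
  have \<rho>m: "\<rho> \<in> borel_measurable M" using \<rho>(1) by simp
  have "(\<lambda>x. ennreal (\<rho> x)) \<in> borel_measurable M" using \<rho>m by simp
  then obtain F where F: "\<And>i. simple_function M (F i)" "incseq F" "\<And>i x. F i x < top" "\<And>x. (SUP i. F i x) = ennreal (\<rho> x)"
    by (rule borel_measurable_implies_simple_function_sequence') blast
  define s where "s i x = enn2real (F i x)" for i x
  have s: "simple_function M (s i)" for i
    unfolding s_def by (rule simple_function_compose1[OF F(1)])
  have s0: "s i x \<ge> 0" for i x by (simp add: s_def)
  have Fi: "F i x = ennreal (s i x)" for i x using F(3) by (simp add: s_def)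
  have sr: "s i x \<le> \<rho> x" if "x \<in> space M" for i x
  proof -
    have "F i x \<le> ennreal (\<rho> x)" unfolding F(4)[symmetric] by (rule SUP_upper) simp
    thus ?thesis using \<rho>(2)[OF that] by (simp add: Fi)
  qed
  have sm: "s i x \<le> s j x" if "i \<le> j" for i j x
    using F(2) that s0 unfolding incseq_def le_fun_def Fi by (metis ennreal_le_iff)
  have sl: "(\<lambda>i. s i x) \<longlonglongrightarrow> \<rho> x" if "x \<in> space M" for x
  proof -
    have "(\<lambda>i. F i x) \<longlonglongrightarrow> (SUP i. F i x)"
      using F(2) by (intro LIMSEQ_SUP) (auto simp: incseq_def le_fun_def)
    hence "(\<lambda>i. F i x) \<longlonglongrightarrow> ennreal (\<rho> x)" by (simp only: F(4))
    hence "(\<lambda>i. ennreal (s i x)) \<longlonglongrightarrow> ennreal (\<rho> x)" by (simp only: Fi)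
    thus ?thesis using s0 \<rho>(2)[OF that] by (subst (asm) tendsto_ennreal_iff) auto
  qed
  have simple_int: "integrable M f" if f: "simple_function M f" for f :: "'a \<Rightarrow> real"
  proof -
    obtain D where "\<And>x. x \<in> space M \<Longrightarrow> \<bar>f x\<bar> \<le> D" using simple_function_bounded[OF f] by blast
    thus ?thesis
      by (intro integrable_const_bound[where B = D] borel_measurable_simple_function[OF f] AE_I2) simp
  qed
  have isp: "integrable M (\<lambda>x. s i x powr p)" for i
    using simple_function_compose1[OF s, of "\<lambda>y. y powr p"] by (intro simple_int) simp
  have bound: "(LINT x|M. s i x powr p) \<le> C powr p" for i
  proof -
    define X where "X = (LINT x|M. s i x powr p)"
    have X0: "X \<ge> 0" by (simp add: X_def)
    show ?thesis
    proof (cases "X = 0")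
      case True thus ?thesis by (simp add: X_def)
    next
      case False
      hence X: "X > 0" using X0 by simp
      define V where "V x = s i x powr (p - 1)" for x
      have V: "simple_function M V" unfolding V_def using simple_function_compose1[OF s, of "\<lambda>y. y powr (p - 1)"] by simp
      have Vq: "V x powr (p / (p - 1)) = s i x powr p" for x
        using p by (simp add: V_def powr_powr)
      have Vs: "V x * s i x = s i x powr p" for x
        using p s0[of i x] by (cases "s i x = 0") (auto simp: V_def powr_mult_base powr_add[symmetric] powr_diff)
      have "X = (LINT x|M. V x * s i x)" by (simp add: X_def Vs)
      also have "\<dots> \<le> (LINT x|M. V x * \<rho> x)"
      proof (rule integral_mono)
        show "integrable M (\<lambda>x. V x * s i x)" using isp by (simp add: Vs)
        obtain D where D: "\<And>x. x \<in> space M \<Longrightarrow> \<bar>V x\<bar> \<le> D" using simple_function_bounded[OF V] by blast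
        show "integrable M (\<lambda>x. V x * \<rho> x)"
        proof (rule Bochner_Integration.integrable_bound)
          show "integrable M (\<lambda>x. D * \<rho> x)" using \<rho> by simp
          show "(\<lambda>x. V x * \<rho> x) \<in> borel_measurable M"
            using borel_measurable_simple_function[OF V] \<rho>m by simp
          show "AE x in M. norm (V x * \<rho> x) \<le> norm (D * \<rho> x)"
          proof (rule AE_I2)
            fix x assume x: "x \<in> space M"
            from D[OF x] show "norm (V x * \<rho> x) \<le> norm (D * \<rho> x)" using \<rho>(2)[OF x] by (auto simp: abs_mult intro!: mult_right_mono)
          qed
        qed
        fix x assume "x \<in> space M"
        thus "V x * s i x \<le> V x * \<rho> x" using sr by (intro mult_left_mono) (auto simp: V_def)
      qed
      also have "\<dots> \<le> C * X powr (1 - 1 / p)"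
        by (rule dual[OF V _ X]) (auto simp: V_def[symmetric] Vq X_def, simp add: V_def)
      finally have le: "X \<le> C * X powr (1 - 1 / p)" .
      have "X powr (1 / p) = X / X powr (1 - 1 / p)" using X by (simp add: powr_diff)
      also have "\<dots> \<le> C" using le X by (simp add: field_simps)
      finally have "(X powr (1 / p)) powr p \<le> C powr p" using p by (intro powr_mono2) auto
      thus ?thesis using X p by (simp add: powr_powr X_def)
    qed
  qed
  have lim: "(\<lambda>i. s i x powr p) \<longlonglongrightarrow> \<rho> x powr p" if "x \<in> space M" for x
    using sl[OF that] p by (intro tendsto_powr' tendsto_const) (auto simp: s0)
  have conv: "(\<lambda>i. LINT x|M. s i x powr p) \<longlonglongrightarrow> (SUP i. LINT x|M. s i x powr p)"
  proof (rule LIMSEQ_incseq_SUP)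
    show "bdd_above (range (\<lambda>i. LINT x|M. s i x powr p))" using bound by (auto intro!: bdd_aboveI)
    show "incseq (\<lambda>i. LINT x|M. s i x powr p)"
      unfolding incseq_def using p by (auto intro!: integral_mono isp powr_mono2 sm s0)
  qed
  have mono: "AE x in M. mono (\<lambda>n. s n x powr p)"
    using p by (auto intro!: AE_I2 monoI powr_mono2 sm s0)
  have li: "AE x in M. (\<lambda>i. s i x powr p) \<longlonglongrightarrow> \<rho> x powr p" using lim by auto
  have meas: "(\<lambda>x. \<rho> x powr p) \<in> borel_measurable M" using \<rho>m by measurable
  show "integrable M (\<lambda>x. \<rho> x powr p)"
    by (rule integrable_monotone_convergence[OF isp mono li conv meas])
  have "(LINT x|M. \<rho> x powr p) = (SUP i. LINT x|M. s i x powr p)"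
    by (rule integral_monotone_convergence[OF isp mono li conv meas])
  also have "\<dots> \<le> C powr p" by (rule cSUP_least) (auto intro: bound)
  finally have "(LINT x|M. \<rho> x powr p) powr (1 / p) \<le> (C powr p) powr (1 / p)"
    using p by (intro powr_mono2) auto
  thus "(LINT x|M. \<rho> x powr p) powr (1 / p) \<le> C" using p C by (simp add: powr_powr)
qed

section \<open>Test fields\<close>

lemma Lw_expand_component:
  assumes X: "smooth_on_S2 X" and x: "x \<in> S2"
  shows "Lw w X x $ b = (\<Sum>c\<in>UNIV. w $ c * La c (\<lambda>x. X x $ b) x)"
proof -
  have "Lw w X x $ b = Lw w (\<lambda>x. X x $ b) x"
    by (rule Lw_component[OF smooth_sdiff[OF X] S2_nonzero[OF x], symmetric])
  also have "\<dots> = (\<Sum>c\<in>UNIV. w $ c * La c (\<lambda>x. X x $ b) x)"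
    by (subst Lw_expand[OF smooth_sdiff[OF smooth_component[OF X]] S2_nonzero[OF x]]) simp
  finally show ?thesis .
qed

text \<open>The rotation about \<open>cross3 x v\<close> moves \<open>x\<close> in the direction of
  the tangential part of \<open>v\<close>.\<close>

lemma cov_deriv_apply:
  fixes X :: "real^3 \<Rightarrow> real^3"
  assumes X: "smooth_on_S2 X" and x: "x \<in> S2"
  shows "cov_deriv X x *v v = tan_proj x (Lw (cross3 x v) X x)"
proof -
  define D where "D = frechet_derivative (X \<circ> radial) (at x)"
  have D: "D v = Lw (cross3 x v) X x" for v
    using frechet_radial_eq_Lw[OF smooth_sdiff[OF X] S2_nonzero[OF x], of v] S2_inner[OF x] by (simp add: D_def)
  have "linear D"
    unfolding D_def by (rule has_derivative_linear[OF sdiff_deriv[OF smooth_sdiff[OF X] S2_nonzero[OF x]]])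
  hence "linear (\<lambda>v. tan_proj x (D v))"
    by (intro linearI) (simp_all add: tan_proj_def linear_add linear_scale inner_add_left algebra_simps)
  from matrix_works[OF linear_matrix_vector_mul_eq[THEN iffD2, OF this]] show ?thesis
    unfolding cov_deriv_def D_def[symmetric] D[symmetric] .
qed

lemma matrix_entry: "(A :: real^3^3) $ b $ a = (A *v axis a 1) $ b"
  by (simp add: matrix_vector_mult_def axis_def if_distrib cong: if_cong)

lemma cov_deriv_entry:
  fixes X :: "real^3 \<Rightarrow> real^3"
  assumes X: "smooth_on_S2 X" and x: "x \<in> S2"
  shows "cov_deriv X x $ b $ a = (\<Sum>c\<in>UNIV. cross3 x (axis a 1) $ c * La c (\<lambda>x. X x $ b) x)
     - (\<Sum>d\<in>UNIV. (\<Sum>c\<in>UNIV. cross3 x (axis a 1) $ c * La c (\<lambda>x. X x $ d) x) * x $ d) * x $ b"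
  unfolding matrix_entry[of "cov_deriv X x"] cov_deriv_apply[OF X x]
  by (simp add: tan_proj_def Lw_expand_component[OF X x] inner_vec_def)

lemma La_normal:
  assumes f: "smooth_on_S2 f" and x: "x \<in> S2"
  shows "(\<Sum>c\<in>UNIV. x $ c * La c f x) = 0"
proof -
  have "(\<Sum>c\<in>UNIV. x $ c * La c f x) = Lw x f x"
    by (subst Lw_expand[OF smooth_sdiff[OF f] S2_nonzero[OF x], of x]) simp
  also have "\<dots> = 0"
    using linear_0[OF has_derivative_linear[OF sdiff_deriv[OF smooth_sdiff[OF f] S2_nonzero[OF x]]]] by (simp add: Lw_def)
  finally show ?thesis .
qed

text \<open>\<open>A \<bullet> rot_mat x\<close> is the trace of \<open>v \<mapsto> (A v) \<times> x\<close>.\<close>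

definition rot_mat :: "real^3 \<Rightarrow> real^3^3" where
  "rot_mat x = (\<chi> b. cross3 (axis b 1) x)"

text \<open>The normal component of the curl, written with rotational derivatives so that
  integration by parts is \<open>ip_Lw\<close> in each component.\<close>

definition rot_S2 :: "(real^3 \<Rightarrow> real^3) \<Rightarrow> real^3 \<Rightarrow> real" where
  "rot_S2 X x = (\<Sum>a\<in>UNIV. La a (\<lambda>x. X x $ a) x)"

lemma matrix_inner: "(A :: real^3^3) \<bullet> B = (\<Sum>b\<in>UNIV. \<Sum>a\<in>UNIV. A $ b $ a * B $ b $ a)"
  by (simp add: inner_vec_def)

lemma trace_eq_inner: "trace A = (A :: real^3^3) \<bullet> mat 1"
  by (simp add: matrix_inner trace_def mat_def if_distrib cong: if_cong)

lemma cov_deriv_rot: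
  fixes X :: "real^3 \<Rightarrow> real^3"
  assumes X: "smooth_on_S2 X" and x: "x \<in> S2"
  shows "cov_deriv X x \<bullet> rot_mat x = rot_S2 X x"
proof -
  define l where "l c d = La c (\<lambda>x. X x $ d) x" for c d
  have n: "x$1 * l 1 d + x$2 * l 2 d + x$3 * l 3 d = 0" for d
    using La_normal[OF smooth_component[OF X] x, of d] by (simp add: l_def sum_3)
  note n = n[of 1] n[of 2] n[of 3]
  note h = S2_norm2[OF x]
  show ?thesis
    unfolding matrix_inner rot_S2_def cov_deriv_entry[OF X x] l_def[symmetric] rot_mat_def sum_3
    by (simp add: cross3_def axis_def) (use n h in algebra)
qed

text \<open>Divergence and rotation differ by a quarter turn of the field. Through this identity
  \<open>rot_S2_parts\<close> also integrates the divergence by parts.\<close>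

lemma cov_deriv_trace:
  fixes X :: "real^3 \<Rightarrow> real^3"
  assumes X: "smooth_on_S2 X" and x: "x \<in> S2" and t: "X x \<bullet> x = 0"
  shows "trace (cov_deriv X x) = rot_S2 (\<lambda>x. cross3 x (X x)) x"
proof -
  define l where "l c d = La c (\<lambda>x. X x $ d) x" for c d
  have n: "x$1 * l 1 d + x$2 * l 2 d + x$3 * l 3 d = 0" for d
    using La_normal[OF smooth_component[OF X] x, of d] by (simp add: l_def sum_3)
  note n = n[of 1] n[of 2] n[of 3]
  note h = S2_norm2[OF x]
  have t: "X x $ 1 * x $ 1 + X x $ 2 * x $ 2 + X x $ 3 * x $ 3 = 0" using t by (simp add: inner_vec_def sum_3)
  have L: "La c (\<lambda>x. cross3 x (X x) $ a) x = (cross3 x (\<chi> d. l c d) + cross3 (cross3 (axis c 1) x) (X x)) $ a" for c a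
  proof -
    have "Lw (axis c 1) X x = (\<chi> d. l c d)"
      using Lw_component[OF smooth_sdiff[OF X] S2_nonzero[OF x]] by (simp add: vec_eq_iff l_def)
    moreover have "La c (\<lambda>x. cross3 x (X x) $ a) x = Lw (axis c 1) (\<lambda>x. cross3 x (X x)) x $ a"
      by (rule Lw_component[OF smooth_sdiff[OF smooth_cross3[OF smooth_ident X]] S2_nonzero[OF x]])
    ultimately show ?thesis
      using Lw_bilinear[OF bounded_bilinear_cross3 smooth_sdiff[OF smooth_ident] smooth_sdiff[OF X] x, of "axis c 1"] Lw_ident[OF x] by simp
  qed
  show ?thesis
    unfolding trace_def rot_S2_def cov_deriv_entry[OF X x] L l_def[symmetric] sum_3
    by (simp add: cross3_def axis_def) (use n h t in algebra)
qed

text \<open>The quarter turn is parallel for the Levi-Civita connection: differentiating the factor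
  \<open>x\<close> of the cross product yields a normal vector, which the tangential projection
  removes.\<close>

lemma cov_deriv_perp:
  fixes Y :: "real^3 \<Rightarrow> real^3"
  assumes Y: "smooth_on_S2 Y" and x: "x \<in> S2" and t: "Y x \<bullet> x = 0"
  shows "cov_deriv (perp Y) x *v v = cross3 (cov_deriv Y x *v v) x"
proof -
  have pY: "smooth_on_S2 (perp Y)" unfolding perp_def by (intro smooth_cross3 Y smooth_ident)
  define w where "w = cross3 x v"
  have "Lw w (perp Y) x = cross3 (Y x) (cross3 w x) + cross3 (Lw w Y x) x"
    using Lw_bilinear[OF bounded_bilinear_cross3 smooth_sdiff[OF Y] smooth_sdiff[OF smooth_ident] x, of w] Lw_ident[OF x]
    by (simp add: perp_def[abs_def])
  also have "cross3 (Y x) (cross3 w x) = (- (Y x \<bullet> w)) *\<^sub>R x"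
    by (simp add: Lagrange t)
  finally have "tan_proj x (Lw w (perp Y) x) = cross3 (Lw w Y x) x"
    using S2_inner[OF x] by (simp add: tan_proj_def inner_add_left inner_diff_left inner_diff_right dot_cross_self inner_commute)
  moreover have "cross3 (tan_proj x (Lw w Y x)) x = cross3 (Lw w Y x) x"
    by (simp add: tan_proj_def Cross3.left_diff_distrib cross_mult_left)
  ultimately show ?thesis
    by (simp add: cov_deriv_apply[OF Y x] cov_deriv_apply[OF pY x] w_def)
qed

lemma smooth_rot_S2: "smooth_on_S2 X \<Longrightarrow> smooth_on_S2 (rot_S2 X)"
  unfolding rot_S2_def by (intro smooth_sum smooth_Lw smooth_component)

lemma cov_deriv_cont:
  fixes X :: "real^3 \<Rightarrow> real^3"
  assumes X: "smooth_on_S2 X" shows "continuous_on S2 (cov_deriv X)"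
proof -
  have s: "smooth_on_S2 (\<lambda>x. cross3 x (axis a 1) $ c * La c (\<lambda>x. X x $ b) x)" for a b c
    by (intro smooth_mult smooth_component[OF smooth_cross3[OF smooth_ident smooth_const]] smooth_Lw smooth_component X)
  have e: "smooth_on_S2 (\<lambda>x. (\<Sum>c\<in>UNIV. cross3 x (axis a 1) $ c * La c (\<lambda>x. X x $ b) x)
     + (- 1) * ((\<Sum>d\<in>UNIV. (\<Sum>c\<in>UNIV. cross3 x (axis a 1) $ c * La c (\<lambda>x. X x $ d) x) * x $ d) * x $ b))" for a b :: 3
    by (intro smooth_add smooth_sum smooth_mult s smooth_component smooth_ident smooth_const)
  have "continuous_on S2 (\<lambda>x. \<chi> b a. (\<Sum>c\<in>UNIV. cross3 x (axis a 1) $ c * La c (\<lambda>x. X x $ b) x)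
     - (\<Sum>d\<in>UNIV. (\<Sum>c\<in>UNIV. cross3 x (axis a 1) $ c * La c (\<lambda>x. X x $ d) x) * x $ d) * x $ b)"
    using smooth_continuous_on[OF e] by (intro continuous_on_vec_lambda) simp
  thus ?thesis
    by (rule continuous_on_eq) (simp add: vec_eq_iff cov_deriv_entry[OF X] del: mem_sphere)
qed

lemma rot_S2_parts:
  assumes X: "smooth_on_S2 X" and f: "sp d f"
  shows "(LINT x|surface. f x * rot_S2 X x) = - (LINT x|surface. X x \<bullet> LL f x)"
proof -
  note sq = sqi_continuous[OF smooth_continuous_on]
  have "(LINT x|surface. f x * rot_S2 X x) = (LINT x|surface. (\<Sum>a\<in>UNIV. f x * La a (\<lambda>x. X x $ a) x))"
    by (simp add: rot_S2_def sum_distrib_left)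
  also have "\<dots> = (\<Sum>a\<in>UNIV. ip f (La a (\<lambda>x. X x $ a)))"
    unfolding ip_def by (intro Bochner_Integration.integral_sum ip_integrable sq sp_smooth[OF f] smooth_Lw smooth_component X)
  also have "\<dots> = (\<Sum>a\<in>UNIV. - ip (\<lambda>x. X x $ a) (La a f))"
    using ip_Lw[OF sp_smooth[OF f] smooth_component[OF X] norm_axis1] by (simp add: ip_commute)
  also have "\<dots> = - (LINT x|surface. (\<Sum>a\<in>UNIV. X x $ a * La a f x))"
    unfolding ip_def sum_negf
    by (subst Bochner_Integration.integral_sum) (auto intro!: ip_integrable sq sp_smooth[OF sp_Lw[OF f]] smooth_component X)
  finally show ?thesis by (simp add: inner_vec_def)
qed

text \<open>As \<open>K\<close> is closed, the radial extension vanishes on an open set around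
  \<open>x\<close>; hence derivatives of a test field keep its support.\<close>

lemma vanish_off_compact:
  fixes X :: "real^3 \<Rightarrow> 'b::real_normed_vector"
  assumes K: "compact K" and X: "\<And>x. x \<in> S2 - K \<Longrightarrow> X x = 0" and x: "x \<in> S2 - K"
  shows "frechet_derivative (X \<circ> radial) (at x) v = 0"
proof -
  define T where "T = punctured \<inter> radial -` (- K)"
  have "open T"
    unfolding T_def using K
    by (intro continuous_open_preimage open_punctured) (auto simp: radial_def compact_imp_closed intro!: continuous_intros)
  moreover have "(X \<circ> radial) y = 0" if "y \<in> T" for y
    using that radial_in_S2 X by (auto simp: T_def)
  moreover have "x \<in> T" using x S2_nonzero[of x] by (auto simp: T_def)
  ultimately have "frechet_derivative (X \<circ> radial) (at x) = frechet_derivative (\<lambda>y. 0) (at x)"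
    by (intro frechet_cong) auto
  thus ?thesis by (simp add: frechet_derivative_const)
qed

lemma
  assumes X: "test_field \<Omega> X"
  shows test_smooth: "smooth_on_S2 X" and test_tangent: "x \<in> S2 \<Longrightarrow> X x \<bullet> x = 0"
    and test_off: "x \<in> S2 - \<Omega> \<Longrightarrow> X x = 0" and test_cov_off: "x \<in> S2 - \<Omega> \<Longrightarrow> cov_deriv X x = 0"
    and test_rot_supp: "\<exists>K. compact K \<and> K \<subseteq> \<Omega> \<and> (\<forall>x\<in>S2 - K. rot_S2 X x = 0)"
proof -
  obtain K where K: "compact K" "K \<subseteq> \<Omega>" "\<And>x. x \<in> S2 - K \<Longrightarrow> X x = 0" using X by (auto simp: test_field_def)
  show s: "smooth_on_S2 X" using X by (simp add: test_field_def)
  show "x \<in> S2 \<Longrightarrow> X x \<bullet> x = 0" using X by (simp add: test_field_def)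
  show "x \<in> S2 - \<Omega> \<Longrightarrow> X x = 0" using K by blast
  show "x \<in> S2 - \<Omega> \<Longrightarrow> cov_deriv X x = 0"
  proof -
    assume "x \<in> S2 - \<Omega>"
    hence "x \<in> S2 - K" using K by blast
    hence "frechet_derivative (X \<circ> radial) (at x) v = 0" for v by (intro vanish_off_compact[OF K(1)] K(3))
    hence "frechet_derivative (X \<circ> radial) (at x) = (\<lambda>v. 0)" by (simp add: fun_eq_iff)
    thus ?thesis by (simp add: cov_deriv_def tan_proj_def matrix_def vec_eq_iff)
  qed
  have "rot_S2 X x = 0" if x: "x \<in> S2 - K" for x
  proof -
    have "La a (\<lambda>x. X x $ a) x = 0" for a
      unfolding Lw_def by (rule vanish_off_compact[OF K(1) _ x]) (simp add: K(3))
    thus ?thesis by (simp add: rot_S2_def)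
  qed
  thus "\<exists>K. compact K \<and> K \<subseteq> \<Omega> \<and> (\<forall>x\<in>S2 - K. rot_S2 X x = 0)" using K by blast
qed

lemma test_perp:
  assumes "test_field \<Omega> X" shows "test_field \<Omega> (perp X)"
proof -
  obtain K where K: "compact K" "K \<subseteq> \<Omega>" "\<And>x. x \<in> S2 - K \<Longrightarrow> X x = 0" using assms by (auto simp: test_field_def)
  have "smooth_on_S2 (perp X)"
    unfolding perp_def using assms by (intro smooth_cross3 smooth_ident) (simp add: test_field_def)
  thus ?thesis unfolding test_field_def using K by (auto simp: perp_def dot_cross_self)
qed

lemma test_field_tangent_axis:
  assumes g: "smooth_on_S2 g" and K: "compact K" "K \<subseteq> \<Omega>" "\<And>x. x \<in> S2 - K \<Longrightarrow> g x = (0::real)"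
  shows "test_field \<Omega> (\<lambda>x. g x *\<^sub>R tan_proj x (axis a 1))"
proof -
  have "smooth_on_S2 (\<lambda>x. g x *\<^sub>R (axis a 1 + - ((axis a 1 \<bullet> x) *\<^sub>R x)))"
    by (intro smooth_scaleR smooth_add smooth_minus smooth_inner smooth_const smooth_ident g)
  hence "smooth_on_S2 (\<lambda>x. g x *\<^sub>R tan_proj x (axis a 1))" by (simp add: tan_proj_def)
  moreover have "(g x *\<^sub>R tan_proj x (axis a 1)) \<bullet> x = 0" if "x \<in> S2" for x
    using S2_inner[OF that] by (simp add: tan_proj_def inner_diff_left)
  ultimately show ?thesis unfolding test_field_def using K by (auto simp del: mem_sphere)
qed

section \<open>Weak derivatives\<close>

abbreviation zext :: "(real^3) set \<Rightarrow> (real^3 \<Rightarrow> 'b::real_vector) \<Rightarrow> real^3 \<Rightarrow> 'b" where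
  "zext \<Omega> f x \<equiv> indicat_real \<Omega> x *\<^sub>R f x"

lemma L2_iff_sqi: "L2 \<Omega> f \<longleftrightarrow> sqi surface (zext \<Omega> f)"
proof -
  have "(\<lambda>x. (norm (zext \<Omega> f x))\<^sup>2) = (\<lambda>x. zext \<Omega> (\<lambda>x. (norm (f x))\<^sup>2) x)"
    by (auto simp: fun_eq_iff indicator_def)
  thus ?thesis by (simp add: L2_def sqi_def set_borel_measurable_def set_integrable_def)
qed

lemma L2_inner_eq: "L2_inner \<Omega> f g = (LINT x|surface. zext \<Omega> f x \<bullet> zext \<Omega> g x)"
  unfolding L2_inner_def set_lebesgue_integral_def
  by (intro Bochner_Integration.integral_cong refl) (auto simp: indicator_def)

text \<open>The constant depends on \<open>g\<close> alone, so convergence in the mean of a sequence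
  passes to its inner products with \<open>g\<close>.\<close>

lemma inner_cont_dominated:
  fixes g :: "real^3 \<Rightarrow> 'b::euclidean_space"
  assumes g: "continuous_on S2 g"
  shows "\<exists>B. \<forall>f. sqi surface f \<longrightarrow> sqi surface (\<lambda>x. f x \<bullet> g x) \<and>
    (LINT x|surface. (f x \<bullet> g x)\<^sup>2) \<le> B * (LINT x|surface. (norm (f x))\<^sup>2)"
proof -
  obtain B where B: "\<And>x. x \<in> S2 \<Longrightarrow> norm (g x) \<le> B" using continuous_on_S2_bounded[OF g] by metis
  have m: "(\<lambda>x. f x \<bullet> g x) \<in> borel_measurable surface" if "sqi surface f" for f
    using sqi_measurable[OF that] continuous_on_surface[OF g] by (rule borel_measurable_inner)
  have le: "norm (f x \<bullet> g x) \<le> B * norm (f x)" if "x \<in> space surface" for f x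
  proof -
    have "norm (f x \<bullet> g x) \<le> norm (f x) * norm (g x)" by (simp add: Cauchy_Schwarz_ineq2)
    also have "\<dots> \<le> norm (f x) * B" using B that by (intro mult_left_mono) (simp_all only: space_surface norm_ge_zero)
    finally show ?thesis by (simp add: mult.commute)
  qed
  show ?thesis
  proof (intro exI[of _ "B\<^sup>2"] allI impI conjI)
    fix f :: "real^3 \<Rightarrow> 'b" assume f: "sqi surface f"
    show "sqi surface (\<lambda>x. f x \<bullet> g x)" by (rule sqi_dominated(1)[OF f m[OF f]]) (rule le)
    have "(LINT x|surface. (norm (f x \<bullet> g x))\<^sup>2) \<le> B\<^sup>2 * (LINT x|surface. (norm (f x))\<^sup>2)"
      by (rule sqi_dominated(2)[OF f m[OF f]]) (rule le)
    thus "(LINT x|surface. (f x \<bullet> g x)\<^sup>2) \<le> B\<^sup>2 * (LINT x|surface. (norm (f x))\<^sup>2)" by simp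
  qed
qed

lemma sqi_inner_cont: "sqi surface f \<Longrightarrow> continuous_on S2 g \<Longrightarrow> sqi surface (\<lambda>x. f x \<bullet> g x)"
  using inner_cont_dominated by blast

lemma rot_mat_cont: "continuous_on S2 rot_mat"
  unfolding rot_mat_def
  by (intro continuous_on_vec_lambda smooth_continuous_on smooth_cross3 smooth_const smooth_ident)

text \<open>Test fields vanish outside a compact part of \<open>\<Omega>\<close> and are smooth on
  the whole sphere, so their integration by parts against polynomials has no boundary term. Both
  identities in \<open>solenoidal\<close> are limits of these.\<close>

lemma solenoidal_limit:
  assumes X: "\<And>k. test_field \<Omega> (X k)"
    and U: "sqi surface U" and D: "sqi surface D"
    and limU: "(\<lambda>k. LINT x|surface. (norm (U x - X k x))\<^sup>2) \<longlonglongrightarrow> 0"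
    and limD: "(\<lambda>k. LINT x|surface. (norm (D x - cov_deriv (X k) x))\<^sup>2) \<longlonglongrightarrow> 0"
    and tan: "AE x in surface. U x \<bullet> x = 0" and tr: "AE x in surface. trace (D x) = 0"
  shows "solenoidal U (\<lambda>x. D x \<bullet> rot_mat x)"
    and "(\<lambda>k. LINT x|surface. (norm ((D x \<bullet> rot_mat x) - rot_S2 (X k) x))\<^sup>2) \<longlonglongrightarrow> 0"
proof -
  note Xs = test_smooth[OF X]
  have sX: "sqi surface (X k)" for k by (rule sqi_continuous[OF smooth_continuous_on[OF Xs]])
  have sC: "sqi surface (cov_deriv (X k))" for k by (rule sqi_continuous[OF cov_deriv_cont[OF Xs]])
  show "solenoidal U (\<lambda>x. D x \<bullet> rot_mat x)" unfolding solenoidal_def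
  proof (intro conjI allI impI U tan)
    show "sqi surface (\<lambda>x. D x \<bullet> rot_mat x)" by (rule sqi_inner_cont[OF D rot_mat_cont])
    fix d f assume f: "sp d f"
    have fm: "sqi surface (\<lambda>x. f x *\<^sub>R rot_mat x)"
      by (intro sqi_continuous continuous_on_scaleR sp_cont[OF f] rot_mat_cont)
    have e1: "(LINT x|surface. cov_deriv (X k) x \<bullet> (f x *\<^sub>R rot_mat x)) = - (LINT x|surface. X k x \<bullet> LL f x)" for k
    proof -
      have "(LINT x|surface. cov_deriv (X k) x \<bullet> (f x *\<^sub>R rot_mat x)) = (LINT x|surface. f x * rot_S2 (X k) x)"
        by (intro Bochner_Integration.integral_cong refl) (simp only: space_surface inner_scaleR_right cov_deriv_rot[OF Xs])
      thus ?thesis using rot_S2_parts[OF Xs f] by simp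
    qed
    have 1: "(\<lambda>k. - (LINT x|surface. X k x \<bullet> LL f x)) \<longlonglongrightarrow> (LINT x|surface. D x \<bullet> (f x *\<^sub>R rot_mat x))"
      using sqi_inner_tendsto[OF D sC fm limD] by (simp only: e1)
    have "(\<lambda>k. - (LINT x|surface. X k x \<bullet> LL f x)) \<longlonglongrightarrow> - (LINT x|surface. U x \<bullet> LL f x)"
      by (intro tendsto_minus sqi_inner_tendsto[OF U sX LL_sqi[OF f] limU])
    from LIMSEQ_unique[OF 1 this] show "ip (\<lambda>x. D x \<bullet> rot_mat x) f = - (LINT x|surface. U x \<bullet> LL f x)"
      by (simp add: ip_def mult.commute)
    have fm: "sqi surface (\<lambda>x. f x *\<^sub>R (mat 1 :: real^3^3))"
      by (intro sqi_continuous continuous_on_scaleR sp_cont[OF f] continuous_on_const)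
    have cl: "sqi surface (\<lambda>x. - cross3 x (LL f x))" by (intro sqi_minus sqi_cross LL_sqi[OF f])
    have e2: "(LINT x|surface. D x \<bullet> (f x *\<^sub>R mat 1)) = (LINT x|surface. 0)"
      by (rule integral_cong_AE) (use tr sqi_inner_integrable[OF D fm] in \<open>auto simp: trace_eq_inner\<close>)
    have e3: "(LINT x|surface. cov_deriv (X k) x \<bullet> (f x *\<^sub>R mat 1)) = - (LINT x|surface. X k x \<bullet> (- cross3 x (LL f x)))" for k
    proof -
      have "(LINT x|surface. cov_deriv (X k) x \<bullet> (f x *\<^sub>R mat 1)) = (LINT x|surface. f x * rot_S2 (\<lambda>x. cross3 x (X k x)) x)"
        by (intro Bochner_Integration.integral_cong refl)
           (simp only: space_surface inner_scaleR_right trace_eq_inner[symmetric] cov_deriv_trace[OF Xs _ test_tangent[OF X]])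
      also have "\<dots> = - (LINT x|surface. cross3 x (X k x) \<bullet> LL f x)"
        by (rule rot_S2_parts[OF smooth_cross3[OF smooth_ident Xs] f])
      also have "(LINT x|surface. cross3 x (X k x) \<bullet> LL f x) = (LINT x|surface. X k x \<bullet> (- cross3 x (LL f x)))"
        by (intro Bochner_Integration.integral_cong refl) (simp add: cross3_simps)
      finally show ?thesis .
    qed
    have 2: "(\<lambda>k. - (LINT x|surface. X k x \<bullet> (- cross3 x (LL f x)))) \<longlonglongrightarrow> 0"
      using sqi_inner_tendsto[OF D sC fm limD] by (simp only: e2 e3 integral_zero)
    have "(\<lambda>k. - (LINT x|surface. X k x \<bullet> (- cross3 x (LL f x)))) \<longlonglongrightarrow> - (LINT x|surface. U x \<bullet> (- cross3 x (LL f x)))"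
      by (intro tendsto_minus sqi_inner_tendsto[OF U sX cl limU])
    from LIMSEQ_unique[OF 2 this] have "(LINT x|surface. U x \<bullet> (- cross3 x (LL f x))) = 0" by simp
    moreover have "(LINT x|surface. cross3 x (U x) \<bullet> LL f x) = (LINT x|surface. U x \<bullet> (- cross3 x (LL f x)))"
      by (intro Bochner_Integration.integral_cong refl) (simp add: cross3_simps)
    ultimately show "(LINT x|surface. cross3 x (U x) \<bullet> LL f x) = 0" by simp
  qed
  obtain B where B: "\<And>f. sqi surface f \<Longrightarrow> (LINT x|surface. (f x \<bullet> rot_mat x)\<^sup>2) \<le> B * (LINT x|surface. (norm (f x))\<^sup>2)"
    using inner_cont_dominated[OF rot_mat_cont] by blast
  show "(\<lambda>k. LINT x|surface. (norm ((D x \<bullet> rot_mat x) - rot_S2 (X k) x))\<^sup>2) \<longlonglongrightarrow> 0"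
  proof (rule tendsto_sandwich[OF _ _ tendsto_const])
    show "(\<lambda>k. B * (LINT x|surface. (norm (D x - cov_deriv (X k) x))\<^sup>2)) \<longlonglongrightarrow> 0"
      using tendsto_mult[OF tendsto_const[of B] limD] by simp
    have "(LINT x|surface. (norm ((D x \<bullet> rot_mat x) - rot_S2 (X k) x))\<^sup>2) = (LINT x|surface. ((D x - cov_deriv (X k) x) \<bullet> rot_mat x)\<^sup>2)" for k
      by (intro Bochner_Integration.integral_cong refl) (simp only: space_surface inner_diff_left cov_deriv_rot[OF Xs] real_norm_def power2_abs)
    thus "\<forall>\<^sub>F k in sequentially. (LINT x|surface. (norm ((D x \<bullet> rot_mat x) - rot_S2 (X k) x))\<^sup>2) \<le> B * (LINT x|surface. (norm (D x - cov_deriv (X k) x))\<^sup>2)"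
      using B[OF sqi_diff[OF D sC]] by simp
  qed auto
qed

lemma has_weakD:
  assumes "has_weak_cov_deriv \<Omega> u D"
  shows "sqi surface (zext \<Omega> u)" "sqi surface (zext \<Omega> D)"
    "AE x in surface. x \<in> \<Omega> \<longrightarrow> u x \<bullet> x = 0 \<and> D x *v x = 0 \<and> (\<forall>v. (D x *v v) \<bullet> x = 0)"
    "test_field \<Omega> X \<Longrightarrow> test_field \<Omega> Y \<Longrightarrow> (LINT x:\<Omega>|surface. (D x *v X x) \<bullet> Y x) =
        - (LINT x:\<Omega>|surface. u x \<bullet> (cov_deriv Y x *v X x) + (u x \<bullet> Y x) * trace (cov_deriv X x))"
  using assms by (auto simp: has_weak_cov_deriv_def L2_iff_sqi)

text \<open>Test fields and their covariant derivatives vanish off \<open>\<Omega>\<close>, so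
  convergence in \<open>H10\<close> is convergence of the zero extensions on the whole
  sphere.\<close>

lemma H10_solenoidal:
  assumes Om: "\<Omega> \<subseteq> S2" and u: "u \<in> H10 \<Omega>" and div: "AE x in surface. x \<in> \<Omega> \<longrightarrow> weak_div \<Omega> u x = 0"
  obtains X where "\<And>k::nat. test_field \<Omega> (X k)"
    "solenoidal (zext \<Omega> u) (\<lambda>x. zext \<Omega> (weak_cov_deriv \<Omega> u) x \<bullet> rot_mat x)"
    "(\<lambda>k. LINT x|surface. (norm ((zext \<Omega> (weak_cov_deriv \<Omega> u) x \<bullet> rot_mat x) - rot_S2 (X k) x))\<^sup>2) \<longlonglongrightarrow> 0"
    "has_weak_cov_deriv \<Omega> u (weak_cov_deriv \<Omega> u)"
proof -
  define D where "D = weak_cov_deriv \<Omega> u"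
  have hD: "has_weak_cov_deriv \<Omega> u D"
  proof -
    have "\<exists>D. has_weak_cov_deriv \<Omega> u D" using u by (auto simp: H10_def H1_def)
    thus ?thesis unfolding D_def weak_cov_deriv_def by (rule someI_ex)
  qed
  note h = has_weakD[OF hD]
  obtain X where X: "\<And>k::nat. test_field \<Omega> (X k)"
    and lim: "(\<lambda>k. LINT x:\<Omega>|surface. (norm (u x - X k x))\<^sup>2 + (norm (D x - cov_deriv (X k) x))\<^sup>2) \<longlonglongrightarrow> 0"
    using u unfolding H10_def D_def by blast
  have sX: "sqi surface (X k)" for k by (rule sqi_continuous[OF smooth_continuous_on[OF test_smooth[OF X]]])
  have sC: "sqi surface (cov_deriv (X k))" for k by (rule sqi_continuous[OF cov_deriv_cont[OF test_smooth[OF X]]])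
  have i: "integrable surface (\<lambda>x. (norm (zext \<Omega> u x - X k x))\<^sup>2)" "integrable surface (\<lambda>x. (norm (zext \<Omega> D x - cov_deriv (X k) x))\<^sup>2)" for k
    using sqi_diff[OF h(1) sX[of k]] sqi_diff[OF h(2) sC[of k]] by (auto simp: sqi_def)
  have eq: "(LINT x:\<Omega>|surface. (norm (u x - X k x))\<^sup>2 + (norm (D x - cov_deriv (X k) x))\<^sup>2)
     = (LINT x|surface. (norm (zext \<Omega> u x - X k x))\<^sup>2) + (LINT x|surface. (norm (zext \<Omega> D x - cov_deriv (X k) x))\<^sup>2)" for k
  proof -
    have "(LINT x:\<Omega>|surface. (norm (u x - X k x))\<^sup>2 + (norm (D x - cov_deriv (X k) x))\<^sup>2)
      = (LINT x|surface. (norm (zext \<Omega> u x - X k x))\<^sup>2 + (norm (zext \<Omega> D x - cov_deriv (X k) x))\<^sup>2)"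
      unfolding set_lebesgue_integral_def
    proof (intro Bochner_Integration.integral_cong refl)
      fix x assume "x \<in> space surface"
      hence x: "x \<in> S2" by (simp only: space_surface)
      show "indicat_real \<Omega> x *\<^sub>R ((norm (u x - X k x))\<^sup>2 + (norm (D x - cov_deriv (X k) x))\<^sup>2)
         = (norm (zext \<Omega> u x - X k x))\<^sup>2 + (norm (zext \<Omega> D x - cov_deriv (X k) x))\<^sup>2"
      proof (cases "x \<in> \<Omega>")
        case False
        thus ?thesis using test_off[OF X] test_cov_off[OF X] x by simp
      qed simp
    qed
    thus ?thesis using i by simp
  qed
  have l1: "(\<lambda>k. LINT x|surface. (norm (zext \<Omega> u x - X k x))\<^sup>2) \<longlonglongrightarrow> 0"
    by (rule tendsto_sandwich[OF _ _ tendsto_const lim]) (auto simp: eq)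
  have l2: "(\<lambda>k. LINT x|surface. (norm (zext \<Omega> D x - cov_deriv (X k) x))\<^sup>2) \<longlonglongrightarrow> 0"
    by (rule tendsto_sandwich[OF _ _ tendsto_const lim]) (auto simp: eq)
  have tan: "AE x in surface. zext \<Omega> u x \<bullet> x = 0"
    using h(3) by eventually_elim (auto simp: indicator_def)
  have tr: "AE x in surface. trace (zext \<Omega> D x) = 0"
    using div by eventually_elim (auto simp: indicator_def weak_div_def D_def trace_eq_inner)
  show ?thesis
    by (rule that[of X, OF X solenoidal_limit[OF X h(1,2) l1 l2 tan tr, unfolded D_def] hD[unfolded D_def]])
qed

definition perp_deriv :: "(real^3 \<Rightarrow> real^3^3) \<Rightarrow> real^3 \<Rightarrow> real^3^3" where
  "perp_deriv D x = matrix (\<lambda>v. cross3 (D x *v v) x)"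

lemma perp_deriv_apply: "perp_deriv D x *v v = cross3 (D x *v v) x"
proof -
  have "linear (\<lambda>v. cross3 (D x *v v) x)"
    by (intro linearI) (simp_all add: matrix_vector_right_distrib cross_add_left matrix_vector_mult_scaleR cross_mult_left)
  thus ?thesis unfolding perp_deriv_def using matrix_works linear_matrix_vector_mul_eq by blast
qed

lemma matrix_axis_component: "((A :: real^3^3) *v axis a 1) $ b = A $ b $ a"
  by (rule matrix_entry[symmetric])

lemma trace_perp_deriv: "trace (perp_deriv D x) = D x \<bullet> rot_mat x"
proof -
  have "perp_deriv D x $ b $ a = cross3 (D x *v axis a 1) x $ b" for a b
    unfolding matrix_entry[of "perp_deriv D x"] perp_deriv_apply ..
  thus ?thesis
    by (simp add: trace_def matrix_inner rot_mat_def sum_3 cross3_def matrix_axis_component) (simp add: axis_def)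
qed

lemma sqi_scaleR_const:
  fixes f :: "'a \<Rightarrow> real" and v :: "'b::euclidean_space"
  assumes "sqi M f" shows "sqi M (\<lambda>x. f x *\<^sub>R v)"
  by (rule sqi_dominated(1)[OF assms, where C = "norm v"]) (use assms in \<open>auto simp: sqi_def mult.commute\<close>)

lemma sqi_matrix:
  assumes "\<And>b a. sqi M (\<lambda>x. (A x :: real^3^3) $ b $ a)" shows "sqi M A"
proof -
  have "A x = (\<Sum>b\<in>UNIV. \<Sum>a\<in>UNIV. A x $ b $ a *\<^sub>R axis b (axis a 1))" for x
  proof -
    have "(\<Sum>b\<in>UNIV. \<Sum>a\<in>UNIV. A x $ b $ a *\<^sub>R axis b (axis a 1 :: real^3)) $ i $ j = A x $ i $ j" for i j
      using exhaust_3[of i] exhaust_3[of j] by (auto simp: sum_3 axis_def)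
    thus ?thesis by (simp add: vec_eq_iff)
  qed
  hence "A = (\<lambda>x. \<Sum>b\<in>UNIV. \<Sum>a\<in>UNIV. A x $ b $ a *\<^sub>R axis b (axis a 1))" by (rule ext)
  moreover have "sqi M (\<lambda>x. \<Sum>b\<in>UNIV. \<Sum>a\<in>UNIV. A x $ b $ a *\<^sub>R axis b (axis a (1::real) :: real^3))"
    by (intro sqi_sum sqi_scaleR_const assms)
  ultimately show ?thesis by simp
qed

lemma sqi_matrix_entry: "sqi M A \<Longrightarrow> sqi M (\<lambda>x. (A x :: real^3^3) $ b $ a)"
  using sqi_component[of M A "axis b (axis a 1)"] by (simp add: inner_axis)

lemma sqi_perp_deriv:
  assumes D: "sqi surface (zext \<Omega> D)" shows "sqi surface (zext \<Omega> (perp_deriv D))"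
proof (rule sqi_matrix)
  fix b a
  have s: "sqi surface (\<lambda>x. x $ i *\<^sub>R (zext \<Omega> D x $ c $ a))" for i c
  proof (rule sqi_bounded_scale[where B = 1])
    show "(\<lambda>x. x $ i) \<in> borel_measurable surface"
      by (intro continuous_on_surface smooth_continuous_on smooth_coord)
    show "\<bar>x $ i\<bar> \<le> 1" if "x \<in> space surface" for x
      using component_le_norm_cart[of x i] that by (simp add: space_surface)
  qed (rule sqi_matrix_entry[OF D])
  have s2: "sqi surface (\<lambda>x. x $ i *\<^sub>R (zext \<Omega> D x $ c $ a) - x $ k *\<^sub>R (zext \<Omega> D x $ e $ a))" for i c k e
    by (rule sqi_diff[OF s s])
  have e: "zext \<Omega> (perp_deriv D) x $ b $ a = indicat_real \<Omega> x * cross3 (D x *v axis a 1) x $ b" for x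
    using matrix_entry[of "perp_deriv D x" b a] by (simp add: perp_deriv_apply)
  consider "b = 1" | "b = 2" | "b = 3" using exhaust_3 by blast
  thus "sqi surface (\<lambda>x. zext \<Omega> (perp_deriv D) x $ b $ a)"
  proof cases
    case 1
    have "indicat_real \<Omega> x * cross3 (D x *v axis a 1) x $ b = x $ 3 *\<^sub>R (zext \<Omega> D x $ 2 $ a) - x $ 2 *\<^sub>R (zext \<Omega> D x $ 3 $ a)" for x
      by (simp add: 1 cross3_def matrix_axis_component right_diff_distrib)
    thus ?thesis unfolding e using s2[of 3 2 2 3] by (simp only:)
  next
    case 2
    have "indicat_real \<Omega> x * cross3 (D x *v axis a 1) x $ b = x $ 1 *\<^sub>R (zext \<Omega> D x $ 3 $ a) - x $ 3 *\<^sub>R (zext \<Omega> D x $ 1 $ a)" for x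
      by (simp add: 2 cross3_def matrix_axis_component right_diff_distrib)
    thus ?thesis unfolding e using s2[of 1 3 3 1] by (simp only:)
  next
    case 3
    have "indicat_real \<Omega> x * cross3 (D x *v axis a 1) x $ b = x $ 2 *\<^sub>R (zext \<Omega> D x $ 1 $ a) - x $ 1 *\<^sub>R (zext \<Omega> D x $ 2 $ a)" for x
      by (simp add: 3 cross3_def matrix_axis_component right_diff_distrib)
    thus ?thesis unfolding e using s2[of 2 1 1 2] by (simp only:)
  qed
qed

text \<open>The quarter turn is skew-adjoint and parallel, so it can be moved from \<open>u\<close>
  onto the test field \<open>Y\<close>. Thus \<open>perp u\<close> has a weak derivative, and
  \<open>weak_rot\<close> is meaningful.\<close>

lemma has_weak_perp:
  assumes Om: "\<Omega> \<subseteq> S2" and hD: "has_weak_cov_deriv \<Omega> u D"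
  shows "has_weak_cov_deriv \<Omega> (perp u) (perp_deriv D)"
proof -
  note h = has_weakD[OF hD]
  have "sqi surface (\<lambda>x. - cross3 x (zext \<Omega> u x))" by (intro sqi_minus sqi_cross h)
  moreover have "(\<lambda>x. - cross3 x (zext \<Omega> u x)) = zext \<Omega> (perp u)"
  proof (rule ext)
    fix x
    show "- cross3 x (zext \<Omega> u x) = zext \<Omega> (perp u) x"
      by (simp add: perp_def cross_mult_right cross_skew[of "u x" x])
  qed
  ultimately have "L2 \<Omega> (perp u)" by (simp add: L2_iff_sqi)
  moreover have "L2 \<Omega> (perp_deriv D)" unfolding L2_iff_sqi by (rule sqi_perp_deriv[OF h(2)])
  moreover have "AE x in surface. x \<in> \<Omega> \<longrightarrow> perp u x \<bullet> x = 0 \<and> perp_deriv D x *v x = 0 \<and> (\<forall>v. (perp_deriv D x *v v) \<bullet> x = 0)"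
    using h(3) by eventually_elim (auto simp: perp_deriv_apply perp_def dot_cross_self)
  moreover have "(LINT x:\<Omega>|surface. (perp_deriv D x *v X x) \<bullet> Y x) =
        - (LINT x:\<Omega>|surface. perp u x \<bullet> (cov_deriv Y x *v X x) + (perp u x \<bullet> Y x) * trace (cov_deriv X x))"
    if X: "test_field \<Omega> X" and Y: "test_field \<Omega> Y" for X Y
  proof -
    have swap: "cross3 a x \<bullet> b = - (a \<bullet> cross3 b x)" for a b x :: "real^3"
      by (simp add: cross3_simps)
    have "(LINT x:\<Omega>|surface. (perp_deriv D x *v X x) \<bullet> Y x) = (LINT x:\<Omega>|surface. - ((D x *v X x) \<bullet> perp Y x))"
      by (simp add: perp_deriv_apply swap perp_def)
    also have "\<dots> = - (LINT x:\<Omega>|surface. (D x *v X x) \<bullet> perp Y x)"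
      by (simp add: set_lebesgue_integral_def)
    also have "\<dots> = (LINT x:\<Omega>|surface. u x \<bullet> (cov_deriv (perp Y) x *v X x) + (u x \<bullet> perp Y x) * trace (cov_deriv X x))"
      using h(4)[OF X test_perp[OF Y]] by simp
    also have "\<dots> = (LINT x:\<Omega>|surface. - (perp u x \<bullet> (cov_deriv Y x *v X x) + (perp u x \<bullet> Y x) * trace (cov_deriv X x)))"
      unfolding set_lebesgue_integral_def
    proof (intro Bochner_Integration.integral_cong refl)
      fix x assume "x \<in> space surface"
      hence x: "x \<in> S2" by (simp only: space_surface)
      show "indicat_real \<Omega> x *\<^sub>R (u x \<bullet> (cov_deriv (perp Y) x *v X x) + (u x \<bullet> perp Y x) * trace (cov_deriv X x))
        = indicat_real \<Omega> x *\<^sub>R - (perp u x \<bullet> (cov_deriv Y x *v X x) + (perp u x \<bullet> Y x) * trace (cov_deriv X x))"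
        by (simp add: cov_deriv_perp[OF test_smooth[OF Y] x test_tangent[OF Y x]] perp_def[of u] swap perp_def[of Y, symmetric])
    qed
    also have "\<dots> = - (LINT x:\<Omega>|surface. perp u x \<bullet> (cov_deriv Y x *v X x) + (perp u x \<bullet> Y x) * trace (cov_deriv X x))"
      unfolding set_lebesgue_integral_def scaleR_minus_right by (rule integral_minus)
    finally show ?thesis .
  qed
  ultimately show ?thesis unfolding has_weak_cov_deriv_def by blast
qed

lemma matrix_vector_inner: "((A :: real^3^3) *v v) \<bullet> y = A \<bullet> (\<chi> b a. y $ b * v $ a)"
  by (simp add: matrix_inner inner_vec_def matrix_vector_mult_def sum_distrib_left sum_distrib_right mult_ac)

lemma outer_cont:
  assumes "smooth_on_S2 X" "smooth_on_S2 Y"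
  shows "continuous_on S2 (\<lambda>x. \<chi> b a. (Y x :: real^3) $ b * (X x :: real^3) $ a)"
  by (intro continuous_on_vec_lambda smooth_continuous_on smooth_mult smooth_component assms)

text \<open>
  \<open>weak_rot\<close> is defined through the test fields of \<open>\<Omega>\<close> only, so no density argument in \<open>\<Omega>\<close> is available without
  cut-off functions. Testing against \<open>\<eta> p t\<^sub>a\<close> and \<open>\<eta> t\<^sub>a\<close>, with \<open>p\<close> a polynomial and \<open>t\<^sub>a\<close> the tangential part
  of the basis vector \<open>e\<^sub>a\<close>, shows that the two candidates agree wherever some test function \<open>\<eta>\<close> does not vanish.
\<close>

lemma weak_trace_unique:
  assumes Om: "\<Omega> \<subseteq> S2"
    and D: "has_weak_cov_deriv \<Omega> u D" and D': "has_weak_cov_deriv \<Omega> u D'"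
    and g: "smooth_on_S2 g" and K: "compact K" "K \<subseteq> \<Omega>" "\<And>x. x \<in> S2 - K \<Longrightarrow> g x = (0::real)"
  shows "(LINT x|surface. (trace (zext \<Omega> D x) - trace (zext \<Omega> D' x)) * g x) = 0"
proof -
  note h = has_weakD[OF D] and h' = has_weakD[OF D']
  define E where "E x = zext \<Omega> D x - zext \<Omega> D' x" for x
  have E: "sqi surface E" unfolding E_def by (intro sqi_diff h h')
  have test0: "(LINT x|surface. (E x *v X x) \<bullet> Y x) = 0" if X: "test_field \<Omega> X" and Y: "test_field \<Omega> Y" for X Y
  proof -
    have s: "(LINT x:\<Omega>|surface. (A x *v X x) \<bullet> Y x) = (LINT x|surface. (zext \<Omega> A x *v X x) \<bullet> Y x)" for A :: "real^3 \<Rightarrow> real^3^3"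
      unfolding set_lebesgue_integral_def
      by (intro Bochner_Integration.integral_cong refl) (auto simp: indicator_def)
    have i: "integrable surface (\<lambda>x. (A x *v X x) \<bullet> Y x)" if "sqi surface A" for A
      unfolding matrix_vector_inner
      by (intro sqi_inner_integrable that sqi_continuous outer_cont test_smooth[OF X] test_smooth[OF Y])
    have "(LINT x|surface. (E x *v X x) \<bullet> Y x) = (LINT x|surface. (zext \<Omega> D x *v X x) \<bullet> Y x - (zext \<Omega> D' x *v X x) \<bullet> Y x)"
      unfolding E_def by (simp only: matrix_vector_mult_diff_rdistrib inner_diff_left)
    also have "\<dots> = 0"
      using i[OF h(2)] i[OF h'(2)] h(4)[OF X Y] h'(4)[OF X Y] by (simp add: s)
    finally show ?thesis .
  qed
  define \<delta> where "\<delta> x = trace (zext \<Omega> D x) - trace (zext \<Omega> D' x)" for x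
  have \<delta>E: "\<delta> x = E x \<bullet> mat 1" for x by (simp only: \<delta>_def E_def trace_eq_inner inner_diff_left)
  have s\<delta>: "sqi surface \<delta>" unfolding \<delta>E by (intro sqi_inner_cont E continuous_on_const)
  have Etan: "AE x in surface. E x *v x = 0 \<and> (\<forall>v. (E x *v v) \<bullet> x = 0)"
    using h(3) h'(3)
    by eventually_elim (auto simp: E_def indicator_def matrix_vector_mult_diff_rdistrib inner_diff_left)
  define t where "t a x = tan_proj x (axis a 1)" for a :: 3 and x
  have sg: "sqi surface (\<lambda>x. (g x * g x) * \<delta> x)"
  proof -
    have c: "continuous_on S2 (\<lambda>x. g x * g x)" by (intro smooth_continuous_on smooth_mult g)
    obtain B where "\<And>x. x \<in> S2 \<Longrightarrow> norm (g x * g x) \<le> B" using continuous_on_S2_bounded[OF c] by metis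
    hence "\<And>x. x \<in> space surface \<Longrightarrow> \<bar>g x * g x\<bar> \<le> B" by (simp only: space_surface real_norm_def)
    from sqi_bounded_scale[OF s\<delta> continuous_on_surface[OF c] this] show ?thesis by simp
  qed
  \<comment> \<open>Each of the two test fields carries one factor \<open>g\<close>, whence the
    square. The weighted defect lives on the whole sphere, where polynomials are dense.\<close>
  have "AE x in surface. (g x * g x) * \<delta> x = 0"
  proof (rule AE_zero_if_orthogonal_to_polys[OF sg])
    fix p :: "real^3 \<Rightarrow> real" assume "real_polynomial_function p"
    then obtain d where "sp d p" using poly_sp by blast
    hence p: "smooth_on_S2 p" by (rule sp_smooth)
    have X: "test_field \<Omega> (\<lambda>x. (g x * p x) *\<^sub>R t a x)" for a
      unfolding t_def by (rule test_field_tangent_axis[OF smooth_mult[OF g p] K(1,2)]) (simp add: K(3))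
    have Y: "test_field \<Omega> (\<lambda>x. g x *\<^sub>R t a x)" for a
      unfolding t_def by (rule test_field_tangent_axis[OF g K(1,2)]) (simp add: K(3))
    have i: "integrable surface (\<lambda>x. (E x *v ((g x * p x) *\<^sub>R t a x)) \<bullet> (g x *\<^sub>R t a x))" for a
      unfolding matrix_vector_inner
      by (intro sqi_inner_integrable E sqi_continuous outer_cont test_smooth[OF X] test_smooth[OF Y])
    have "(LINT x|surface. (g x * g x) * \<delta> x * p x) = (LINT x|surface. (\<Sum>a\<in>UNIV. (E x *v ((g x * p x) *\<^sub>R t a x)) \<bullet> (g x *\<^sub>R t a x)))"
    proof (rule integral_cong_AE)
      have "integrable surface (\<lambda>x. (g x * g x * \<delta> x) * p x)"
        by (intro ip_integrable sg sqi_continuous smooth_continuous_on p)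
      thus "(\<lambda>x. (g x * g x) * \<delta> x * p x) \<in> borel_measurable surface" by simp
      show "(\<lambda>x. \<Sum>a\<in>UNIV. (E x *v ((g x * p x) *\<^sub>R t a x)) \<bullet> (g x *\<^sub>R t a x)) \<in> borel_measurable surface"
        by (intro borel_measurable_sum borel_measurable_integrable i)
      show "AE x in surface. (g x * g x) * \<delta> x * p x = (\<Sum>a\<in>UNIV. (E x *v ((g x * p x) *\<^sub>R t a x)) \<bullet> (g x *\<^sub>R t a x))"
        using Etan
      proof eventually_elim
        fix x assume e: "E x *v x = 0 \<and> (\<forall>v. (E x *v v) \<bullet> x = 0)"
        \<comment> \<open>\<open>E x\<close> kills the normal and has tangential values, so
          replacing basis vectors by their tangential parts leaves the diagonal entries
          unchanged.\<close>
        have Et: "E x *v t a x = E x *v axis a 1" for a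
          using e by (simp add: t_def tan_proj_def matrix_vector_mult_diff_distrib matrix_vector_mult_scaleR)
        have "(E x *v t a x) \<bullet> t a x = E x $ a $ a" for a
          unfolding Et using e by (simp add: t_def tan_proj_def inner_diff_right matrix_axis_component inner_axis)
        hence tr: "(\<Sum>a\<in>UNIV. (E x *v t a x) \<bullet> t a x) = \<delta> x"
          by (simp add: \<delta>E trace_eq_inner[symmetric] trace_def)
        have sc: "(E x *v ((g x * p x) *\<^sub>R t a x)) \<bullet> (g x *\<^sub>R t a x) = (g x * g x * p x) * ((E x *v t a x) \<bullet> t a x)" for a
          by (simp add: matrix_vector_mult_scaleR mult_ac)
        show "(g x * g x) * \<delta> x * p x = (\<Sum>a\<in>UNIV. (E x *v ((g x * p x) *\<^sub>R t a x)) \<bullet> (g x *\<^sub>R t a x))"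
          unfolding sc sum_distrib_left[symmetric] tr by (simp add: mult_ac)
      qed
    qed
    also have "\<dots> = 0"
      by (subst Bochner_Integration.integral_sum) (use i test0[OF X Y] in auto)
    finally show "(LINT x|surface. (g x * g x) * \<delta> x * p x) = 0" .
  qed
  hence "AE x in surface. \<delta> x * g x = 0" by eventually_elim auto
  hence "(LINT x|surface. \<delta> x * g x) = (LINT x|surface. 0)"
    using ip_integrable[OF s\<delta> sqi_continuous[OF smooth_continuous_on[OF g]]]
    by (intro integral_cong_AE) auto
  thus ?thesis by (simp add: \<delta>_def)
qed

text \<open>The two rotations compared are traces of weak derivatives of the same field
  \<open>perp u\<close>, one chosen and one equal to \<open>perp_deriv D\<close>. The function
  \<open>rot_S2 X\<close> is admissible in \<open>weak_trace_unique\<close> because its support lies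
  in \<open>\<Omega>\<close>.\<close>

lemma weak_rot_defect:
  assumes Om: "\<Omega> \<subseteq> S2" and D: "has_weak_cov_deriv \<Omega> u D"
  shows "sqi surface (zext \<Omega> (weak_rot \<Omega> u))"
    and "sqi surface (\<lambda>x. zext \<Omega> (weak_rot \<Omega> u) x - zext \<Omega> D x \<bullet> rot_mat x)"
    and "test_field \<Omega> X \<Longrightarrow> (LINT x|surface. (zext \<Omega> (weak_rot \<Omega> u) x - zext \<Omega> D x \<bullet> rot_mat x) * rot_S2 X x) = 0"
proof -
  have P: "has_weak_cov_deriv \<Omega> (perp u) (perp_deriv D)" by (rule has_weak_perp[OF Om D])
  hence Q: "has_weak_cov_deriv \<Omega> (perp u) (weak_cov_deriv \<Omega> (perp u))"
    unfolding weak_cov_deriv_def by (rule someI[of "has_weak_cov_deriv \<Omega> (perp u)"])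
  have e1: "zext \<Omega> (weak_rot \<Omega> u) x = trace (zext \<Omega> (weak_cov_deriv \<Omega> (perp u)) x)" for x
    by (simp add: weak_rot_def weak_div_def trace_eq_inner)
  have e2: "zext \<Omega> D x \<bullet> rot_mat x = trace (zext \<Omega> (perp_deriv D) x)" for x
    using trace_perp_deriv[of D x] by (simp add: trace_eq_inner)
  show 1: "sqi surface (zext \<Omega> (weak_rot \<Omega> u))"
    unfolding e1 trace_eq_inner by (intro sqi_inner_cont has_weakD(2)[OF Q] continuous_on_const)
  show "sqi surface (\<lambda>x. zext \<Omega> (weak_rot \<Omega> u) x - zext \<Omega> D x \<bullet> rot_mat x)"
    by (intro sqi_diff 1 sqi_inner_cont has_weakD(2)[OF D] rot_mat_cont)
  assume X: "test_field \<Omega> X"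
  obtain K where K: "compact K" "K \<subseteq> \<Omega>" "\<And>x. x \<in> S2 - K \<Longrightarrow> rot_S2 X x = 0" using test_rot_supp[OF X] by blast
  show "(LINT x|surface. (zext \<Omega> (weak_rot \<Omega> u) x - zext \<Omega> D x \<bullet> rot_mat x) * rot_S2 X x) = 0"
    unfolding e1 e2 by (rule weak_trace_unique[OF Om Q P smooth_rot_S2[OF test_smooth[OF X]] K])
qed

text \<open>
  With \<open>W j\<close> the limit of the rotations of approximating test fields, the defect \<open>weak_rot \<Omega> (u i) - W i\<close> is orthogonal to
  every \<open>W j\<close>. Replacing \<open>weak_rot\<close> by \<open>W\<close> therefore only decreases the Gram matrix.
\<close>

lemma solenoidal_family:
  fixes u :: "'j \<Rightarrow> real^3 \<Rightarrow> real^3"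
  assumes Om: "\<Omega> \<subseteq> S2" and J: "finite J" and u: "\<And>j. j \<in> J \<Longrightarrow> u j \<in> H10 \<Omega>"
    and div: "\<And>j. j \<in> J \<Longrightarrow> AE x in surface. x \<in> \<Omega> \<longrightarrow> weak_div \<Omega> (u j) x = 0"
    and on: "\<And>i j. i \<in> J \<Longrightarrow> j \<in> J \<Longrightarrow>
           m\<^sup>2 * L2_inner \<Omega> (u i) (u j) + L2_inner \<Omega> (weak_rot \<Omega> (u i)) (weak_rot \<Omega> (u j)) = (if i = j then 1 else 0)"
  obtains W where "\<And>j. j \<in> J \<Longrightarrow> solenoidal (zext \<Omega> (u j)) (W j)"
    "\<And>t. m\<^sup>2 * (LINT x|surface. (norm (\<Sum>j\<in>J. t j *\<^sub>R zext \<Omega> (u j) x))\<^sup>2) + (LINT x|surface. (\<Sum>j\<in>J. t j * W j x)\<^sup>2) \<le> (\<Sum>j\<in>J. (t j)\<^sup>2)"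
proof -
  define D where "D j = weak_cov_deriv \<Omega> (u j)" for j
  define W where "W j x = zext \<Omega> (D j) x \<bullet> rot_mat x" for j x
  define w where "w j = zext \<Omega> (weak_rot \<Omega> (u j))" for j
  define \<delta> where "\<delta> j x = w j x - W j x" for j x
  define P where "P j X \<longleftrightarrow> (\<forall>k::nat. test_field \<Omega> (X k)) \<and> solenoidal (zext \<Omega> (u j)) (W j) \<and>
      (\<lambda>k. LINT x|surface. (norm (W j x - rot_S2 (X k) x))\<^sup>2) \<longlonglongrightarrow> 0 \<and> has_weak_cov_deriv \<Omega> (u j) (D j)" for j X
  have "\<exists>X. P j X" if j: "j \<in> J" for j
    unfolding P_def W_def[abs_def] D_def
    by (rule H10_solenoidal[OF Om u[OF j] div[OF j]]) (rule exI conjI allI | assumption)+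
  hence "\<forall>j\<in>J. \<exists>X. P j X" by blast
  from bchoice[OF this] obtain X where "\<forall>j\<in>J. P j (X j)" by blast
  hence X: "\<And>j k. j \<in> J \<Longrightarrow> test_field \<Omega> (X j (k::nat))" and S: "\<And>j. j \<in> J \<Longrightarrow> solenoidal (zext \<Omega> (u j)) (W j)"
    and lim: "\<And>j. j \<in> J \<Longrightarrow> (\<lambda>k. LINT x|surface. (norm (W j x - rot_S2 (X j k) x))\<^sup>2) \<longlonglongrightarrow> 0"
    and hD: "\<And>j. j \<in> J \<Longrightarrow> has_weak_cov_deriv \<Omega> (u j) (D j)" by (simp_all add: P_def)
  note s = solenoidalD[OF S]
  have s\<delta>: "sqi surface (\<delta> j)" if "j \<in> J" for j
    using weak_rot_defect(2)[OF Om hD[OF that]] by (simp add: \<delta>_def[abs_def] w_def W_def)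
  have orth: "ip (W j) (\<delta> i) = 0" if i: "i \<in> J" and j: "j \<in> J" for i j
  proof -
    have sR: "sqi surface (rot_S2 (X j k))" for k
      by (intro sqi_continuous smooth_continuous_on smooth_rot_S2 test_smooth[OF X[OF j]])
    have "(\<lambda>k. LINT x|surface. rot_S2 (X j k) x \<bullet> \<delta> i x) \<longlonglongrightarrow> (LINT x|surface. W j x \<bullet> \<delta> i x)"
      by (rule sqi_inner_tendsto[OF s(2)[OF j] sR s\<delta>[OF i] lim[OF j]])
    moreover have "(LINT x|surface. rot_S2 (X j k) x \<bullet> \<delta> i x) = 0" for k
      using weak_rot_defect(3)[OF Om hD[OF i] X[OF j, of k]] by (simp add: \<delta>_def w_def W_def mult.commute)
    ultimately show ?thesis by (simp add: ip_def LIMSEQ_const_iff)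
  qed
  \<comment> \<open>Pythagoras: \<open>w\<close> is \<open>W + \<delta>\<close>, and all mixed
    products vanish by \<open>orth\<close>.\<close>
  have wW: "ip (w i) (w j) = ip (W i) (W j) + ip (\<delta> i) (\<delta> j)" if i: "i \<in> J" and j: "j \<in> J" for i j
  proof -
    have w: "w k = (\<lambda>x. W k x + \<delta> k x)" for k by (simp add: \<delta>_def fun_eq_iff)
    have "ip (w i) (w j) = ip (W i) (w j) + ip (\<delta> i) (w j)"
      unfolding w[of i] using weak_rot_defect(1)[OF Om hD[OF j]] by (intro ip_add s s\<delta> i j) (simp add: w_def)
    also have "ip (W i) (w j) = ip (W j) (W i) + ip (\<delta> j) (W i)"
      unfolding w[of j] by (subst ip_commute) (intro ip_add s s\<delta> i j)
    also have "ip (\<delta> i) (w j) = ip (W j) (\<delta> i) + ip (\<delta> j) (\<delta> i)"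
      unfolding w[of j] by (subst ip_commute) (intro ip_add s s\<delta> i j)
    finally show ?thesis using orth[OF i j] orth[OF j i] by (simp add: ip_commute)
  qed
  have gram: "m\<^sup>2 * (LINT x|surface. zext \<Omega> (u i) x \<bullet> zext \<Omega> (u j) x) + ip (W i) (W j) = (if i = j then 1 else 0) - ip (\<delta> i) (\<delta> j)"
    if i: "i \<in> J" and j: "j \<in> J" for i j
    using on[OF i j] wW[OF i j] by (simp add: L2_inner_eq ip_def w_def)
  have "m\<^sup>2 * (LINT x|surface. (norm (\<Sum>j\<in>J. t j *\<^sub>R zext \<Omega> (u j) x))\<^sup>2) + (LINT x|surface. (\<Sum>j\<in>J. t j * W j x)\<^sup>2) \<le> (\<Sum>j\<in>J. (t j)\<^sup>2)" for t
  proof -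
    have sqr: "(LINT x|surface. (norm (\<Sum>j\<in>J. t j *\<^sub>R f j x))\<^sup>2) = (\<Sum>i\<in>J. \<Sum>j\<in>J. t i * t j * (LINT x|surface. f i x \<bullet> f j x))"
      if f: "\<And>j. j \<in> J \<Longrightarrow> sqi surface (f j)" for f :: "'j \<Rightarrow> real^3 \<Rightarrow> 'c::euclidean_space"
    proof -
      have i: "integrable surface (\<lambda>x. t i * t j * (f i x \<bullet> f j x))" if "i \<in> J" "j \<in> J" for i j
        by (intro integrable_mult_right sqi_inner_integrable f that)
      have "(LINT x|surface. (norm (\<Sum>j\<in>J. t j *\<^sub>R f j x))\<^sup>2) = (LINT x|surface. (\<Sum>i\<in>J. \<Sum>j\<in>J. t i * t j * (f i x \<bullet> f j x)))"
        unfolding power2_norm_eq_inner inner_sum_sum ..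
      also have "\<dots> = (\<Sum>i\<in>J. LINT x|surface. (\<Sum>j\<in>J. t i * t j * (f i x \<bullet> f j x)))"
        by (intro Bochner_Integration.integral_sum Bochner_Integration.integrable_sum i)
      also have "\<dots> = (\<Sum>i\<in>J. \<Sum>j\<in>J. LINT x|surface. t i * t j * (f i x \<bullet> f j x))"
        by (intro sum.cong refl Bochner_Integration.integral_sum i)
      finally show ?thesis by (simp only: integral_mult_right_zero)
    qed
    have Usq: "(LINT x|surface. (norm (\<Sum>j\<in>J. t j *\<^sub>R zext \<Omega> (u j) x))\<^sup>2) = (\<Sum>i\<in>J. \<Sum>j\<in>J. t i * t j * (LINT x|surface. zext \<Omega> (u i) x \<bullet> zext \<Omega> (u j) x))"
      by (rule sqr[of "\<lambda>j. zext \<Omega> (u j)", OF s(1)])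
    have Wsq: "(LINT x|surface. (\<Sum>j\<in>J. t j * W j x)\<^sup>2) = (\<Sum>i\<in>J. \<Sum>j\<in>J. t i * t j * ip (W i) (W j))"
      using sqr[of W, OF s(2)] by (simp add: ip_def)
    have \<delta>sq: "(LINT x|surface. (\<Sum>j\<in>J. t j * \<delta> j x)\<^sup>2) = (\<Sum>i\<in>J. \<Sum>j\<in>J. t i * t j * ip (\<delta> i) (\<delta> j))"
      using sqr[of \<delta>, OF s\<delta>] by (simp add: ip_def)
    have "m\<^sup>2 * (LINT x|surface. (norm (\<Sum>j\<in>J. t j *\<^sub>R zext \<Omega> (u j) x))\<^sup>2) + (LINT x|surface. (\<Sum>j\<in>J. t j * W j x)\<^sup>2)
      = (\<Sum>i\<in>J. \<Sum>j\<in>J. t i * t j * (m\<^sup>2 * (LINT x|surface. zext \<Omega> (u i) x \<bullet> zext \<Omega> (u j) x) + ip (W i) (W j)))"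
      unfolding Wsq Usq by (simp only: sum_distrib_left sum.distrib[symmetric] distrib_left mult.left_commute[of "m\<^sup>2"])
    also have "\<dots> = (\<Sum>i\<in>J. \<Sum>j\<in>J. (if i = j then t i * t j else 0) - t i * t j * ip (\<delta> i) (\<delta> j))"
      by (intro sum.cong refl) (simp only: gram right_diff_distrib, simp)
    also have "\<dots> = (\<Sum>i\<in>J. (t i)\<^sup>2) - (LINT x|surface. (\<Sum>j\<in>J. t j * \<delta> j x)\<^sup>2)"
      unfolding \<delta>sq using J by (simp add: sum_subtractf power2_eq_square)
    finally show ?thesis by simp
  qed
  thus ?thesis using that S by blast
qed

lemma integrable_weighted:
  assumes "sqi M f" "V \<in> borel_measurable M" "\<And>x. x \<in> space M \<Longrightarrow> \<bar>V x\<bar> \<le> D"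
  shows "integrable M (\<lambda>x. V x * (norm (f x))\<^sup>2)"
  using sqi_inner_integrable[OF sqi_bounded_scale[OF assms] assms(1)] by (simp add: power2_norm_eq_inner)

theorem theorem2p1:
  fixes m p :: real and n :: nat and \<Omega> :: "(real^3) set"
    and u :: "nat \<Rightarrow> real^3 \<Rightarrow> real^3"
  defines "\<rho> \<equiv> \<lambda>x. \<Sum>j=1..n. (norm (u j x))\<^sup>2"
  assumes "m > 0" and "n \<ge> 1"
    and "sphere_domain \<Omega>"
    and "\<And>j. j \<in> {1..n} \<Longrightarrow> u j \<in> H10 \<Omega>"
    and "\<And>j. j \<in> {1..n} \<Longrightarrow> AE x in surface. x \<in> \<Omega> \<longrightarrow> weak_div \<Omega> (u j) x = 0"
    and "\<And>i j. i \<in> {1..n} \<Longrightarrow> j \<in> {1..n} \<Longrightarrow>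
           m\<^sup>2 * L2_inner \<Omega> (u i) (u j) + L2_inner \<Omega> (weak_rot \<Omega> (u i)) (weak_rot \<Omega> (u j))
             = (if i = j then 1 else 0)"
    and "p \<ge> 1"
  shows "Lp \<Omega> p \<rho> \<and>
         Lp_norm \<Omega> p \<rho> \<le> (if p = 1 then 1 else ((p - 1) / (4 * pi)) powr ((p - 1) / p))
                          * m powr (- 2 / p) * real n powr (1 / p)"
proof -
  have Om: "\<Omega> \<subseteq> S2" using assms(4) by (auto simp: sphere_domain_def openin_subset dest: openin_imp_subset)
  define J where "J = {1..n}"
  have J: "finite J" "J \<noteq> {}" and card: "card J = n" using assms(3) by (auto simp: J_def)
  obtain W where S: "\<And>j. j \<in> J \<Longrightarrow> solenoidal (zext \<Omega> (u j)) (W j)"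
    and Gram: "\<And>t. m\<^sup>2 * (LINT x|surface. (norm (\<Sum>j\<in>J. t j *\<^sub>R zext \<Omega> (u j) x))\<^sup>2) + (LINT x|surface. (\<Sum>j\<in>J. t j * W j x)\<^sup>2) \<le> (\<Sum>j\<in>J. (t j)\<^sup>2)"
    using solenoidal_family[OF Om J(1), of u m] assms(5,6,7) unfolding J_def by blast
  define R where "R x = (\<Sum>j\<in>J. (norm (zext \<Omega> (u j) x))\<^sup>2)" for x
  have R: "R x = indicat_real \<Omega> x *\<^sub>R \<rho> x" for x
    by (auto simp: R_def \<rho>_def J_def indicator_def)
  have R0: "R x \<ge> 0" for x by (simp add: R_def sum_nonneg)
  have sU: "sqi surface (zext \<Omega> (u j))" if "j \<in> J" for j by (rule solenoidalD(1)[OF S[OF that]])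
  have iR: "integrable surface R"
    unfolding R_def by (intro Bochner_Integration.integrable_sum sqi_integrable sU)
  have "\<rho> x \<ge> 0" for x by (simp add: \<rho>_def sum_nonneg)
  hence Rp: "indicat_real \<Omega> x *\<^sub>R (\<bar>\<rho> x\<bar> powr p) = R x powr p" for x
    using assms(8) by (auto simp: R indicator_def)
  have Lp_eq: "Lp \<Omega> p \<rho> \<longleftrightarrow> integrable surface (\<lambda>x. R x powr p)"
  proof -
    have "(\<lambda>x. indicat_real \<Omega> x *\<^sub>R \<rho> x) = R" by (simp add: R fun_eq_iff)
    thus ?thesis unfolding Lp_def set_borel_measurable_def set_integrable_def Rp using iR by simp
  qed
  have norm_eq: "Lp_norm \<Omega> p \<rho> = (LINT x|surface. R x powr p) powr (1 / p)"
    unfolding Lp_norm_def set_lebesgue_integral_def Rp ..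
  show ?thesis
  proof (cases "p = 1")
    case True
    \<comment> \<open>For p = 1 there is no finite dual exponent; the Gram bound at unit vectors
      already gives the claim after summation over \<open>j\<close>.\<close>
    have "m\<^sup>2 * (LINT x|surface. (norm (zext \<Omega> (u j) x))\<^sup>2) \<le> 1" if j: "j \<in> J" for j
    proof -
      have d: "(\<Sum>i\<in>J. of_bool (i = j) *\<^sub>R f i) = f j" for f :: "nat \<Rightarrow> 'c::real_vector"
      proof -
        have "(\<Sum>i\<in>J. of_bool (i = j) *\<^sub>R f i) = (\<Sum>i\<in>J. if i = j then f j else 0)" by (intro sum.cong) auto
        thus ?thesis using J(1) j by simp
      qed
      have "0 \<le> (LINT x|surface. (\<Sum>i\<in>J. of_bool (i = j) * W i x)\<^sup>2)" by simp
      with Gram[of "\<lambda>i. of_bool (i = j)"] have "m\<^sup>2 * (LINT x|surface. (norm (zext \<Omega> (u j) x))\<^sup>2) \<le> (\<Sum>i\<in>J. (of_bool (i = j))\<^sup>2)"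
        unfolding d by linarith
      also have "(\<Sum>i\<in>J. (of_bool (i = j))\<^sup>2) = (\<Sum>i\<in>J. if i = j then 1 else (0::real))" by (intro sum.cong) auto
      also have "\<dots> = 1" using J(1) j by simp
      finally show ?thesis .
    qed
    hence e: "(LINT x|surface. (norm (zext \<Omega> (u j) x))\<^sup>2) \<le> 1 / m\<^sup>2" if "j \<in> J" for j
      using that assms(2) by (simp add: field_simps)
    have "(LINT x|surface. R x) = (\<Sum>j\<in>J. LINT x|surface. (norm (zext \<Omega> (u j) x))\<^sup>2)"
      unfolding R_def by (intro Bochner_Integration.integral_sum sqi_integrable sU)
    also have "\<dots> \<le> (\<Sum>j\<in>J. 1 / m\<^sup>2)" by (intro sum_mono e)
    also have "\<dots> = m powr (- 2) * real n" using assms(2) by (simp add: card powr_minus field_simps)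
    finally have "(LINT x|surface. R x) \<le> m powr (- 2) * real n" .
    moreover have "(LINT x|surface. R x) \<ge> 0" using R0 by simp
    ultimately show ?thesis unfolding Lp_eq norm_eq using True R0 iR by simp
  next
    case False
    hence p: "p > 1" using assms(8) by simp
    \<comment> \<open>The conjugate exponent; the relation \<open>q - 1 = 1 / (p - 1)\<close> is the
      origin of the factor p - 1 in the constant.\<close>
    define q where "q = p / (p - 1)"
    have q: "q > 1" "1 - 1 / q = 1 / p" "1 / q = 1 - 1 / p" "q - 1 = 1 / (p - 1)" using p by (auto simp: q_def field_simps)
    have q_inv: "1 / q = (p - 1) / p" by (simp add: q_def)
    \<comment> \<open>The bound of \<open>vharm_pointwise\<close>. Its power 1/q is the claimed
      constant times m^(-2/p), because 2/(p-1) times 1/q = (p-1)/p is 2/p.\<close>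
    define B where "B = m powr (- 2 * (q - 1)) / (q - 1) / (4 * pi)"
    have B: "B > 0" using assms(2) q(1) by (simp add: B_def)
    define C where "C = real n powr (1 / p) * B powr (1 / q)"
    have dual: "(LINT x|surface. V x * R x) \<le> C * X powr (1 - 1 / p)"
      if V: "simple_function surface V" "\<And>x. x \<in> space surface \<Longrightarrow> V x \<ge> 0" and X: "X > 0"
        "(LINT x|surface. V x powr (p / (p - 1))) \<le> X" for V X
    proof -
      obtain D where VD: "\<And>x. x \<in> space surface \<Longrightarrow> \<bar>V x\<bar> \<le> D" using simple_function_bounded[OF V(1)] by blast
      have iV: "integrable surface (\<lambda>x. V x * (norm (zext \<Omega> (u j) x))\<^sup>2)" if j: "j \<in> J" for j
        by (rule integrable_weighted[OF sU[OF j] borel_measurable_simple_function[OF V(1)] VD])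
      have "(LINT x|surface. V x * R x) = (LINT x|surface. (\<Sum>j\<in>J. V x * (norm (zext \<Omega> (u j) x))\<^sup>2))"
        by (simp add: R_def sum_distrib_left)
      also have "\<dots> = (\<Sum>j\<in>J. LINT x|surface. V x * (norm (zext \<Omega> (u j) x))\<^sup>2)"
        by (intro Bochner_Integration.integral_sum iV)
      also have "\<dots> \<le> real (card J) powr (1 - 1 / q) * (B * X) powr (1 / q)"
      proof (rule solenoidal_dual_bound[OF J S assms(2) q(1) Gram V])
        show "B * X > 0" using B X by simp
        show "m powr (- 2 * (q - 1)) / (q - 1) / (4 * pi) * (LINT x|surface. V x powr q) \<le> B * X"
          using X(2) B unfolding B_def[symmetric] q_def[symmetric] by (intro mult_left_mono) auto
      qed
      also have "\<dots> = C * X powr (1 - 1 / p)"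
        using B X by (simp add: C_def q(2) card powr_mult q(3)[symmetric])
      finally show ?thesis .
    qed
    have C0: "C \<ge> 0" by (simp add: C_def)
    note L = dual_Lp_bound[OF finite_measure_surface p iR R0 C0 dual]
    have "B = (p - 1) / (4 * pi) * m powr (- 2 / (p - 1))"
      using p by (simp add: B_def q(4) field_simps)
    hence "B powr (1 / q) = ((p - 1) / (4 * pi)) powr ((p - 1) / p) * m powr (- 2 / (p - 1) * ((p - 1) / p))"
      by (simp only: powr_mult powr_powr q_inv)
    also have "- 2 / (p - 1) * ((p - 1) / p) = - 2 / p"
    proof -
      have "(a / b) * (b / c) = a / c" if "b \<noteq> 0" for a b c :: real using that by simp
      from this[of "p - 1" "- 2" p] show ?thesis using p by simp
    qed
    finally have "C = ((p - 1) / (4 * pi)) powr ((p - 1) / p) * m powr (- 2 / p) * real n powr (1 / p)"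
      unfolding C_def by (simp only: mult_ac)
    thus ?thesis using L False by (simp add: Lp_eq norm_eq)
  qed
qed

end
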